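(* The fragment of $\mathbf{C}^2$ with cardinality constraints and a single linear order axiom $LO(R)$ is domain-liftable.
   Context: $\mathbf{C}^2$: function-free first-order logic with at most two variables plus counting quantifiers $\exists_{=k},\exists_{\le k},\exists_{\ge k}$. A possible world over $[n]=\{1,\dots,n\}$ assigns truth values to all ground atoms; its weight under real weighting functions $w,\overline{w}$ on predicates is the product of $w(P)$ over true ground atoms of $P$ and $\overline{w}(P)$ over false ones; $\mathrm{WFOMC}(\Psi,n,w,\overline{w})$ is the sum of weights of models of $\Psi$ over $[n]$. "$\mathbf{C}^2$ with cardinality constraints" means sentences $\Phi\wedge\Gamma$ with $\Phi\in\mathbf{C}^2$ and $\Gamma$ a conjunction of cardinality constraints $|P|\bowtie m$ (restricting the number of true ground atoms of $P$) and ground unary literals. The axiom $LO(R)$ requires that $R$ is a linear order on the domain, i.e., the directed graph $G(R)$ (edge $a\to b$ iff $R(a,b)$) is an acyclic tournament with a self-loop added at each vertex; $\mathrm{WFOMC}(\Psi\wedge LO(R),n,w,\overline{w})$ sums the weights of models of $\Psi$ in which this holds. Domain-liftable: for every fixed $\Phi\in\mathbf{C}^2$, fixed $w,\overline{w}$, fixed $R$, $\mathrm{WFOMC}(\Phi\wedge\Gamma\wedge LO(R),n,w,\overline{w})$ is computable in time polynomial in $n$ ($n$ in unary, $\Gamma$ part of the input in binary, possibly depending on $n$). *)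

theory Defs
  imports Complex_Main "HOL-Library.Log_Nat" "HOL-Computational_Algebra.Polynomial"
begin

section \<open>The two-variable fragment with counting quantifiers\<close>

text \<open>
  A vocabulary is a list of arities: its predicates are the indices below the length of the
  list, and \<^term>\<open>V ! P\<close> is the arity of predicate \<^term>\<open>P\<close>.  Any arity is allowed, including 0.
\<close>

type_synonym vocabulary = "nat list"

datatype var = X | Y

datatype fm =
    Atom nat "var list"
  | Equal var var
  | Neg fm
  | Conj fm fm
  | Disj fm fm
  | Forall var fm
  | Exists var fm
  | ExistsEq nat var fm
  | ExistsLe nat var fm
  | ExistsGe nat var fm

primrec wf_fm :: "vocabulary \<Rightarrow> fm \<Rightarrow> bool" where
  "wf_fm V (Atom P vs) \<longleftrightarrow> P < length V \<and> length vs = V ! P"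
| "wf_fm V (Equal x y) \<longleftrightarrow> True"
| "wf_fm V (Neg \<phi>) \<longleftrightarrow> wf_fm V \<phi>"
| "wf_fm V (Conj \<phi> \<psi>) \<longleftrightarrow> wf_fm V \<phi> \<and> wf_fm V \<psi>"
| "wf_fm V (Disj \<phi> \<psi>) \<longleftrightarrow> wf_fm V \<phi> \<and> wf_fm V \<psi>"
| "wf_fm V (Forall x \<phi>) \<longleftrightarrow> wf_fm V \<phi>"
| "wf_fm V (Exists x \<phi>) \<longleftrightarrow> wf_fm V \<phi>"
| "wf_fm V (ExistsEq k x \<phi>) \<longleftrightarrow> wf_fm V \<phi>"
| "wf_fm V (ExistsLe k x \<phi>) \<longleftrightarrow> wf_fm V \<phi>"
| "wf_fm V (ExistsGe k x \<phi>) \<longleftrightarrow> wf_fm V \<phi>"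

primrec fv :: "fm \<Rightarrow> var set" where
  "fv (Atom P vs) = set vs"
| "fv (Equal x y) = {x, y}"
| "fv (Neg \<phi>) = fv \<phi>"
| "fv (Conj \<phi> \<psi>) = fv \<phi> \<union> fv \<psi>"
| "fv (Disj \<phi> \<psi>) = fv \<phi> \<union> fv \<psi>"
| "fv (Forall x \<phi>) = fv \<phi> - {x}"
| "fv (Exists x \<phi>) = fv \<phi> - {x}"
| "fv (ExistsEq k x \<phi>) = fv \<phi> - {x}"
| "fv (ExistsLe k x \<phi>) = fv \<phi> - {x}"
| "fv (ExistsGe k x \<phi>) = fv \<phi> - {x}"

definition C2_sentence :: "vocabulary \<Rightarrow> fm \<Rightarrow> bool" where
  "C2_sentence V \<phi> \<longleftrightarrow> wf_fm V \<phi> \<and> fv \<phi> = {}"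


section \<open>Possible worlds and weighted model counting\<close>

type_synonym atom = "nat \<times> nat list"

text \<open>A possible world is the set of the ground atoms that are true in it.\<close>

type_synonym world = "atom set"

definition ground_atoms :: "vocabulary \<Rightarrow> nat \<Rightarrow> atom set" where
  "ground_atoms V n = {(P, as). P < length V \<and> length as = V ! P \<and> set as \<subseteq> {1..n}}"

lemma finite_ground_atoms: "finite (ground_atoms V n)"
proof -
  have "ground_atoms V n \<subseteq>
      (\<Union>P<length V. Pair P ` {as. set as \<subseteq> {1..n} \<and> length as = V ! P})"
    unfolding ground_atoms_def by auto
  then show ?thesis by (rule finite_subset) (auto intro: finite_lists_length_eq)
qed

primrec sat :: "nat \<Rightarrow> world \<Rightarrow> (var \<Rightarrow> nat) \<Rightarrow> fm \<Rightarrow> bool" where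
  "sat n \<omega> e (Atom P vs) \<longleftrightarrow> (P, map e vs) \<in> \<omega>"
| "sat n \<omega> e (Equal x y) \<longleftrightarrow> e x = e y"
| "sat n \<omega> e (Neg \<phi>) \<longleftrightarrow> \<not> sat n \<omega> e \<phi>"
| "sat n \<omega> e (Conj \<phi> \<psi>) \<longleftrightarrow> sat n \<omega> e \<phi> \<and> sat n \<omega> e \<psi>"
| "sat n \<omega> e (Disj \<phi> \<psi>) \<longleftrightarrow> sat n \<omega> e \<phi> \<or> sat n \<omega> e \<psi>"
| "sat n \<omega> e (Forall x \<phi>) \<longleftrightarrow> (\<forall>a\<in>{1..n}. sat n \<omega> (e(x := a)) \<phi>)"
| "sat n \<omega> e (Exists x \<phi>) \<longleftrightarrow> (\<exists>a\<in>{1..n}. sat n \<omega> (e(x := a)) \<phi>)"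
| "sat n \<omega> e (ExistsEq k x \<phi>) \<longleftrightarrow> card {a\<in>{1..n}. sat n \<omega> (e(x := a)) \<phi>} = k"
| "sat n \<omega> e (ExistsLe k x \<phi>) \<longleftrightarrow> card {a\<in>{1..n}. sat n \<omega> (e(x := a)) \<phi>} \<le> k"
| "sat n \<omega> e (ExistsGe k x \<phi>) \<longleftrightarrow> card {a\<in>{1..n}. sat n \<omega> (e(x := a)) \<phi>} \<ge> k"

lemma sat_cong_fv: "(\<And>v. v \<in> fv \<phi> \<Longrightarrow> e v = e' v) \<Longrightarrow> sat n \<omega> e \<phi> \<longleftrightarrow> sat n \<omega> e' \<phi>"
proof (induction \<phi> arbitrary: e e')
  case (Atom P vs)
  then have "map e vs = map e' vs" by simp
  then show ?case by (simp only: sat.simps)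
next
  case (Neg \<phi>)
  have "sat n \<omega> e \<phi> = sat n \<omega> e' \<phi>" by (rule Neg.IH) (use Neg.prems in auto)
  then show ?case by simp
next
  case (Conj \<phi> \<psi>)
  have "sat n \<omega> e \<phi> = sat n \<omega> e' \<phi>" by (rule Conj.IH(1)) (use Conj.prems in auto)
  moreover have "sat n \<omega> e \<psi> = sat n \<omega> e' \<psi>" by (rule Conj.IH(2)) (use Conj.prems in auto)
  ultimately show ?case by simp
next
  case (Disj \<phi> \<psi>)
  have "sat n \<omega> e \<phi> = sat n \<omega> e' \<phi>" by (rule Disj.IH(1)) (use Disj.prems in auto)
  moreover have "sat n \<omega> e \<psi> = sat n \<omega> e' \<psi>" by (rule Disj.IH(2)) (use Disj.prems in auto)
  ultimately show ?case by simp
next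
  case (Forall x \<phi>)
  have "sat n \<omega> (e(x := a)) \<phi> = sat n \<omega> (e'(x := a)) \<phi>" for a
    by (rule Forall.IH) (use Forall.prems in auto)
  then show ?case by simp
next
  case (Exists x \<phi>)
  have "sat n \<omega> (e(x := a)) \<phi> = sat n \<omega> (e'(x := a)) \<phi>" for a
    by (rule Exists.IH) (use Exists.prems in auto)
  then show ?case by simp
next
  case (ExistsEq k x \<phi>)
  have "sat n \<omega> (e(x := a)) \<phi> = sat n \<omega> (e'(x := a)) \<phi>" for a
    by (rule ExistsEq.IH) (use ExistsEq.prems in auto)
  then show ?case by simp
next
  case (ExistsLe k x \<phi>)
  have "sat n \<omega> (e(x := a)) \<phi> = sat n \<omega> (e'(x := a)) \<phi>" for a
    by (rule ExistsLe.IH) (use ExistsLe.prems in auto)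
  then show ?case by simp
next
  case (ExistsGe k x \<phi>)
  have "sat n \<omega> (e(x := a)) \<phi> = sat n \<omega> (e'(x := a)) \<phi>" for a
    by (rule ExistsGe.IH) (use ExistsGe.prems in auto)
  then show ?case by simp
qed auto

text \<open>Only used for sentences, for which the assignment is irrelevant.\<close>

definition models :: "nat \<Rightarrow> world \<Rightarrow> fm \<Rightarrow> bool" where
  "models n \<omega> \<phi> \<longleftrightarrow> sat n \<omega> (\<lambda>_. 1) \<phi>"

definition world_weight ::
  "vocabulary \<Rightarrow> nat \<Rightarrow> (nat \<Rightarrow> real) \<Rightarrow> (nat \<Rightarrow> real) \<Rightarrow> world \<Rightarrow> real" where
  "world_weight V n w wbar \<omega> =
     (\<Prod>a\<in>\<omega>. w (fst a)) * (\<Prod>a\<in>ground_atoms V n - \<omega>. wbar (fst a))"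

text \<open>The condition \<^term>\<open>\<Psi>\<close> is given semantically, so that axioms outside first-order logic
  can be conjoined to a sentence.\<close>

definition WFOMC ::
  "vocabulary \<Rightarrow> (world \<Rightarrow> bool) \<Rightarrow> nat \<Rightarrow> (nat \<Rightarrow> real) \<Rightarrow> (nat \<Rightarrow> real) \<Rightarrow> real" where
  "WFOMC V \<Psi> n w wbar =
     (\<Sum>\<omega> | \<omega> \<subseteq> ground_atoms V n \<and> \<Psi> \<omega>. world_weight V n w wbar \<omega>)"


section \<open>Cardinality constraints and unary evidence\<close>

datatype cmp = Lt | Le | Eq | Ge | Gt

primrec compare :: "cmp \<Rightarrow> nat \<Rightarrow> nat \<Rightarrow> bool" where
  "compare Lt a b \<longleftrightarrow> a < b"
| "compare Le a b \<longleftrightarrow> a \<le> b"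
| "compare Eq a b \<longleftrightarrow> a = b"
| "compare Ge a b \<longleftrightarrow> a \<ge> b"
| "compare Gt a b \<longleftrightarrow> a > b"

text \<open>\<open>PosLit P a\<close> and \<open>NegLit P a\<close> are the ground literals $P(a)$ and $\neg P(a)$.\<close>

datatype constr =
    Card nat cmp nat
  | PosLit nat nat
  | NegLit nat nat

primrec wf_constr :: "vocabulary \<Rightarrow> nat \<Rightarrow> constr \<Rightarrow> bool" where
  "wf_constr V n (Card P c m) \<longleftrightarrow> P < length V"
| "wf_constr V n (PosLit P a) \<longleftrightarrow> P < length V \<and> V ! P = 1 \<and> a \<in> {1..n}"
| "wf_constr V n (NegLit P a) \<longleftrightarrow> P < length V \<and> V ! P = 1 \<and> a \<in> {1..n}"

primrec sat_constr :: "world \<Rightarrow> constr \<Rightarrow> bool" where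
  "sat_constr \<omega> (Card P c m) \<longleftrightarrow> compare c (card {a\<in>\<omega>. fst a = P}) m"
| "sat_constr \<omega> (PosLit P a) \<longleftrightarrow> (P, [a]) \<in> \<omega>"
| "sat_constr \<omega> (NegLit P a) \<longleftrightarrow> (P, [a]) \<notin> \<omega>"

text \<open>A list of constraints stands for their conjunction.\<close>

definition sat_constrs :: "world \<Rightarrow> constr list \<Rightarrow> bool" where
  "sat_constrs \<omega> \<Gamma> \<longleftrightarrow> (\<forall>\<kappa>\<in>set \<Gamma>. sat_constr \<omega> \<kappa>)"


section \<open>The linear order axiom\<close>

definition digraph_of :: "nat \<Rightarrow> world \<Rightarrow> (nat \<times> nat) set" where
  "digraph_of R \<omega> = {(a, b). (R, [a, b]) \<in> \<omega>}"

definition tournament_on :: "'a set \<Rightarrow> 'a rel \<Rightarrow> bool" where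
  "tournament_on A E \<longleftrightarrow> E \<subseteq> A \<times> A \<and> irrefl E \<and>
     (\<forall>a\<in>A. \<forall>b\<in>A. a \<noteq> b \<longrightarrow> ((a, b) \<in> E \<longleftrightarrow> (b, a) \<notin> E))"

definition LO :: "nat \<Rightarrow> nat \<Rightarrow> world \<Rightarrow> bool" where
  "LO R n \<omega> \<longleftrightarrow>
     (\<exists>T. tournament_on {1..n} T \<and> acyclic T \<and> digraph_of R \<omega> = T \<union> Id_on {1..n})"

lemma acyclic_tournament_iff_linear_order:
  "(\<exists>T. tournament_on A T \<and> acyclic T \<and> E = T \<union> Id_on A) \<longleftrightarrow> linear_order_on A E"
proof
  assume "\<exists>T. tournament_on A T \<and> acyclic T \<and> E = T \<union> Id_on A"
  then obtain T where T: "tournament_on A T" "acyclic T" and E: "E = T \<union> Id_on A" by blast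
  have sub: "T \<subseteq> A \<times> A" and tot: "\<And>a b. a \<in> A \<Longrightarrow> b \<in> A \<Longrightarrow> a \<noteq> b \<Longrightarrow> (a, b) \<in> T \<longleftrightarrow> (b, a) \<notin> T"
    using T(1) unfolding tournament_on_def by blast+
  have trT: "trans T"
  proof (rule transI)
    fix a b c assume ab: "(a, b) \<in> T" and bc: "(b, c) \<in> T"
    then have ac: "(a, c) \<in> T\<^sup>+" by (meson r_into_trancl' trancl_trans)
    then have ne: "a \<noteq> c" using T(2) unfolding acyclic_def by blast
    have "(c, a) \<notin> T"
      using ac T(2) unfolding acyclic_def by (meson trancl.trancl_into_trancl)
    then show "(a, c) \<in> T" using tot[of a c] ne sub ab bc by blast
  qed
  have "E \<subseteq> A \<times> A" using sub E by auto
  moreover have "refl_on A E" using E by (auto simp: refl_on_def)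
  moreover have "trans E"
    using trT unfolding E trans_def by auto
  moreover have "antisym E"
    using tot sub unfolding E antisym_def by blast
  moreover have "total_on A E"
    using tot unfolding E total_on_def by blast
  ultimately show "linear_order_on A E"
    by (simp add: linear_order_on_def partial_order_on_def preorder_on_def)
next
  assume lin: "linear_order_on A E"
  then have E: "E \<subseteq> A \<times> A" "refl_on A E" "trans E" "antisym E" "total_on A E"
    by (auto simp: linear_order_on_def partial_order_on_def preorder_on_def)
  have "tournament_on A (E - Id)"
    using E unfolding tournament_on_def irrefl_def total_on_def antisym_def by blast
  moreover have "acyclic (E - Id)"
  proof -
    have "trans (E - Id)" using E by (simp add: trans_diff_Id)
    then show ?thesis by (simp add: acyclic_irrefl irrefl_def trancl_id)
  qed
  moreover have "E = (E - Id) \<union> Id_on A"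
    using E unfolding refl_on_def by auto
  ultimately show "\<exists>T. tournament_on A T \<and> acyclic T \<and> E = T \<union> Id_on A" by blast
qed

lemma LO_iff_linear_order: "LO R n \<omega> \<longleftrightarrow> linear_order_on {1..n} (digraph_of R \<omega>)"
  unfolding LO_def by (rule acyclic_tournament_iff_linear_order)


section \<open>The machine model\<close>

text \<open>
  A random access machine with two memories, both addressed by integers, and with structured
  control flow.  The integer memory has the logarithmic (bit) cost measure, so that the integer
  part is polynomially equivalent to a Turing machine.  The real memory supports exact ring
  operations on finitely many given real constants (for model counting: the weights).  The
  constants are the only source of non-integer reals; in particular a program cannot contain
  further real numbers.

  Every real cell carries a number, its formal size, which is what handling its content costs.
  A cell of size \<open>b\<close> holds a value $p(c_1,\dots,c_k)$, where the $c_i$ are the constants and \<open>p\<close> is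
  an integer polynomial of degree at most \<open>b\<close> whose coefficients have absolute values of sum at
  most $2^b$.  Hence polynomial cost implies a polynomial number of real operations, and for
  rational constants also polynomial bit complexity (lemma \<open>fits_rval\<close>): repeated squaring is not
  cheap.
\<close>

definition bits :: "int \<Rightarrow> nat" where
  "bits x = Suc (floorlog 2 (nat \<bar>x\<bar>))"

type_synonym state = "(int \<Rightarrow> int) \<times> (int \<Rightarrow> real \<times> nat)"

datatype iexp =
    Const int
  | Read iexp
  | Add iexp iexp
  | Sub iexp iexp
  | Mul iexp iexp
  | Div iexp iexp
  | Mod iexp iexp

primrec ival :: "iexp \<Rightarrow> state \<Rightarrow> int" where
  "ival (Const x) s = x"
| "ival (Read a) s = fst s (ival a s)"
| "ival (Add a b) s = ival a s + ival b s"
| "ival (Sub a b) s = ival a s - ival b s"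
| "ival (Mul a b) s = ival a s * ival b s"
| "ival (Div a b) s = ival a s div ival b s"
| "ival (Mod a b) s = ival a s mod ival b s"

primrec icost :: "iexp \<Rightarrow> state \<Rightarrow> nat" where
  "icost (Const x) s = bits x"
| "icost (Read a) s = bits (ival (Read a) s) + icost a s"
| "icost (Add a b) s = bits (ival (Add a b) s) + icost a s + icost b s"
| "icost (Sub a b) s = bits (ival (Sub a b) s) + icost a s + icost b s"
| "icost (Mul a b) s = bits (ival (Mul a b) s) + icost a s + icost b s"
| "icost (Div a b) s = bits (ival (Div a b) s) + icost a s + icost b s"
| "icost (Mod a b) s = bits (ival (Mod a b) s) + icost a s + icost b s"

datatype rexp =
    OfInt iexp
  | RConst nat
  | RRead iexp
  | RAdd rexp rexp
  | RSub rexp rexp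
  | RMul rexp rexp

primrec rval :: "real list \<Rightarrow> rexp \<Rightarrow> state \<Rightarrow> real \<times> nat" where
  "rval cs (OfInt a) s = (of_int (ival a s), bits (ival a s))"
| "rval cs (RConst i) s = (if i < length cs then cs ! i else 0, 1)"
| "rval cs (RRead a) s = snd s (ival a s)"
| "rval cs (RAdd a b) s = (case (rval cs a s, rval cs b s) of
     ((x, k), (y, l)) \<Rightarrow> (x + y, Suc (max k l)))"
| "rval cs (RSub a b) s = (case (rval cs a s, rval cs b s) of
     ((x, k), (y, l)) \<Rightarrow> (x - y, Suc (max k l)))"
| "rval cs (RMul a b) s = (case (rval cs a s, rval cs b s) of
     ((x, k), (y, l)) \<Rightarrow> (x * y, k + l))"

primrec rcost :: "real list \<Rightarrow> rexp \<Rightarrow> state \<Rightarrow> nat" where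
  "rcost cs (OfInt a) s = snd (rval cs (OfInt a) s) + icost a s"
| "rcost cs (RConst i) s = snd (rval cs (RConst i) s)"
| "rcost cs (RRead a) s = snd (rval cs (RRead a) s) + icost a s"
| "rcost cs (RAdd a b) s = snd (rval cs (RAdd a b) s) + rcost cs a s + rcost cs b s"
| "rcost cs (RSub a b) s = snd (rval cs (RSub a b) s) + rcost cs a s + rcost cs b s"
| "rcost cs (RMul a b) s = snd (rval cs (RMul a b) s) + rcost cs a s + rcost cs b s"

datatype bexp =
    Less iexp iexp
  | Not bexp
  | And bexp bexp

primrec bval :: "bexp \<Rightarrow> state \<Rightarrow> bool" where
  "bval (Less a b) s \<longleftrightarrow> ival a s < ival b s"
| "bval (Not b) s \<longleftrightarrow> \<not> bval b s"
| "bval (And b c) s \<longleftrightarrow> bval b s \<and> bval c s"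

primrec bcost :: "bexp \<Rightarrow> state \<Rightarrow> nat" where
  "bcost (Less a b) s = Suc (icost a s + icost b s)"
| "bcost (Not b) s = Suc (bcost b s)"
| "bcost (And b c) s = Suc (bcost b s + bcost c s)"

datatype com =
    Skip
  | Store iexp iexp
  | RStore iexp rexp
  | Seq com com
  | If bexp com com
  | While bexp com

text \<open>\<open>exec cs c s t s'\<close>: with real constants \<open>cs\<close>, program \<open>c\<close> started in state \<open>s\<close> halts in
  state \<open>s'\<close> after time \<open>t\<close>.\<close>

inductive exec :: "real list \<Rightarrow> com \<Rightarrow> state \<Rightarrow> nat \<Rightarrow> state \<Rightarrow> bool" for cs where
  Skip: "exec cs Skip s 1 s"
| Store: "exec cs (Store a e) s (Suc (icost a s + icost e s))
            ((fst s)(ival a s := ival e s), snd s)"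
| RStore: "exec cs (RStore a e) s (Suc (icost a s + rcost cs e s))
            (fst s, (snd s)(ival a s := rval cs e s))"
| Seq: "exec cs c s t s' \<Longrightarrow> exec cs d s' u s'' \<Longrightarrow> exec cs (Seq c d) s (Suc (t + u)) s''"
| IfTrue: "bval b s \<Longrightarrow> exec cs c s t s' \<Longrightarrow> exec cs (If b c d) s (Suc (bcost b s + t)) s'"
| IfFalse: "\<not> bval b s \<Longrightarrow> exec cs d s t s' \<Longrightarrow> exec cs (If b c d) s (Suc (bcost b s + t)) s'"
| WhileFalse: "\<not> bval b s \<Longrightarrow> exec cs (While b c) s (Suc (bcost b s)) s"
| WhileTrue: "bval b s \<Longrightarrow> exec cs c s t s' \<Longrightarrow> exec cs (While b c) s' u s'' \<Longrightarrow>
            exec cs (While b c) s (Suc (bcost b s + t + u)) s''"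

lemma exec_deterministic:
  "exec cs c s t s' \<Longrightarrow> exec cs c s u s'' \<Longrightarrow> t = u \<and> s' = s''"
proof (induction arbitrary: u s'' rule: exec.induct)
  case (Seq c s t s' d v s3)
  from Seq.prems Seq.IH show ?case by (cases rule: exec.cases) blast+
next
  case (IfTrue b s c t s' d)
  from IfTrue.prems IfTrue.hyps IfTrue.IH show ?case by (cases rule: exec.cases) blast+
next
  case (IfFalse b s d t s' c)
  from IfFalse.prems IfFalse.hyps IfFalse.IH show ?case by (cases rule: exec.cases) blast+
next
  case (WhileFalse b s c)
  from WhileFalse.prems WhileFalse.hyps show ?case by (cases rule: exec.cases) blast+
next
  case (WhileTrue b s c t s' v s3)
  from WhileTrue.prems WhileTrue.hyps WhileTrue.IH show ?case by (cases rule: exec.cases) blast+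
qed (auto elim: exec.cases)

text \<open>The meaning of the formal size for rational constants: with \<open>D\<close> a common denominator and
  $2^B$ a bound on the constants, a cell of size \<open>b\<close> is a fraction with denominator $D^b$ and
  absolute value at most $2^{Bb}$.\<close>

definition fits :: "nat \<Rightarrow> int \<Rightarrow> real \<times> nat \<Rightarrow> bool" where
  "fits B D r \<longleftrightarrow> (case r of (x, b) \<Rightarrow> of_int D ^ b * x \<in> \<int> \<and> \<bar>x\<bar> \<le> 2 ^ (B * b))"

lemma abs_le_two_power_bits: "\<bar>real_of_int z\<bar> \<le> 2 ^ bits z"
proof (cases "z = 0")
  case False
  then have "nat \<bar>z\<bar> < 2 ^ floorlog 2 (nat \<bar>z\<bar>)"
    using floorlog_bounds[of "nat \<bar>z\<bar>" 2] by simp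
  then have "real (nat \<bar>z\<bar>) < real (2 ^ floorlog 2 (nat \<bar>z\<bar>))"
    by (simp only: of_nat_less_iff)
  then have "\<bar>real_of_int z\<bar> < 2 ^ floorlog 2 (nat \<bar>z\<bar>)" by simp
  also have "\<dots> \<le> 2 ^ bits z" by (simp add: bits_def)
  finally show ?thesis by simp
qed simp

lemma fits_mono_denominator:
  assumes "of_int D ^ k * x \<in> \<int>" "k \<le> m"
  shows "of_int D ^ m * (x :: real) \<in> \<int>"
proof -
  have "of_int D ^ m * x = of_int D ^ (m - k) * (of_int D ^ k * x)"
    using assms(2) by (simp add: mult.assoc[symmetric] power_add[symmetric])
  moreover have "of_int D ^ (m - k) * (of_int D ^ k * x) \<in> \<int>"
    by (rule Ints_mult[OF _ assms(1)]) simp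
  ultimately show ?thesis by (simp only:)
qed

lemma two_power_sum_le:
  assumes "\<bar>x\<bar> \<le> 2 ^ (B * k)" "\<bar>y\<bar> \<le> 2 ^ (B * l)" "1 \<le> B"
  shows "\<bar>x\<bar> + \<bar>y\<bar> \<le> (2 :: real) ^ (B * Suc (max k l))"
proof -
  have "\<bar>x\<bar> \<le> 2 ^ (B * max k l)" "\<bar>y\<bar> \<le> 2 ^ (B * max k l)"
    using order_trans[OF assms(1), of "2 ^ (B * max k l)"]
      order_trans[OF assms(2), of "2 ^ (B * max k l)"] by (simp_all add: power_increasing)
  then have "\<bar>x\<bar> + \<bar>y\<bar> \<le> 2 ^ Suc (B * max k l)" by simp
  also have "\<dots> \<le> 2 ^ (B * Suc (max k l))"
    using assms(3) by (intro power_increasing) auto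
  finally show ?thesis .
qed

lemma fits_rval:
  assumes "1 \<le> B"
    and "\<And>c. c \<in> set cs \<Longrightarrow> of_int D * c \<in> \<int> \<and> \<bar>c\<bar> \<le> 2 ^ B"
    and "\<And>i. fits B D (snd s i)"
  shows "fits B D (rval cs e s)"
proof (induction e)
  case (OfInt a)
  have "\<bar>real_of_int (ival a s)\<bar> \<le> 2 ^ bits (ival a s)" by (rule abs_le_two_power_bits)
  also have "\<dots> \<le> 2 ^ (B * bits (ival a s))"
    using assms(1) by (intro power_increasing) auto
  finally show ?case by (simp add: fits_def)
next
  case (RConst i)
  then show ?case using assms(2)[of "cs ! i"] by (auto simp: fits_def)
next
  case (RRead a)
  then show ?case using assms(3) by simp
next
  case (RAdd a b)
  obtain x k y l where xy: "rval cs a s = (x, k)" "rval cs b s = (y, l)" by fastforce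
  have f: "fits B D (x, k)" "fits B D (y, l)" using RAdd.IH xy by auto
  have "of_int D ^ Suc (max k l) * x \<in> \<int>" "of_int D ^ Suc (max k l) * y \<in> \<int>"
    using f by (auto simp: fits_def intro: fits_mono_denominator simp del: power_Suc)
  then have "of_int D ^ Suc (max k l) * (x + y) \<in> \<int>"
    unfolding distrib_left by (rule Ints_add)
  moreover have "\<bar>x + y\<bar> \<le> 2 ^ (B * Suc (max k l))"
    using two_power_sum_le[of x B k y l] f assms(1) by (simp add: fits_def)
  ultimately show ?case using xy by (simp add: fits_def)
next
  case (RSub a b)
  obtain x k y l where xy: "rval cs a s = (x, k)" "rval cs b s = (y, l)" by fastforce
  have f: "fits B D (x, k)" "fits B D (y, l)" using RSub.IH xy by auto
  have "of_int D ^ Suc (max k l) * x \<in> \<int>" "of_int D ^ Suc (max k l) * y \<in> \<int>"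
    using f by (auto simp: fits_def intro: fits_mono_denominator simp del: power_Suc)
  then have "of_int D ^ Suc (max k l) * (x - y) \<in> \<int>"
    unfolding right_diff_distrib by (rule Ints_diff)
  moreover have "\<bar>x - y\<bar> \<le> 2 ^ (B * Suc (max k l))"
    using two_power_sum_le[of x B k y l] f assms(1) by (simp add: fits_def)
  ultimately show ?case using xy by (simp add: fits_def)
next
  case (RMul a b)
  obtain x k y l where xy: "rval cs a s = (x, k)" "rval cs b s = (y, l)" by fastforce
  have f: "fits B D (x, k)" "fits B D (y, l)" using RMul.IH xy by auto
  have "of_int D ^ (k + l) * (x * y) = (of_int D ^ k * x) * (of_int D ^ l * y)"
    by (simp add: power_add)
  moreover have "(of_int D ^ k * x) * (of_int D ^ l * y) \<in> \<int>"
    by (rule Ints_mult) (use f in \<open>auto simp: fits_def\<close>)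
  ultimately have "of_int D ^ (k + l) * (x * y) \<in> \<int>" by (simp only:)
  moreover have "\<bar>x * y\<bar> \<le> 2 ^ (B * (k + l))"
    using f by (simp add: fits_def abs_mult power_add distrib_left mult_mono)
  ultimately show ?case using xy by (simp add: fits_def)
qed

text \<open>The input is a list of integers, placed in the integer cells 0, 1, 2, \<open>\<dots>\<close>; the output is
  the value of real cell 0.\<close>

definition init :: "int list \<Rightarrow> state" where
  "init xs = (\<lambda>i. if 0 \<le> i \<and> nat i < length xs then xs ! nat i else 0, \<lambda>_. (0, 1))"

definition result_of :: "state \<Rightarrow> real" where
  "result_of s = fst (snd s 0)"

definition polytime_computable ::
  "real list \<Rightarrow> 'a set \<Rightarrow> ('a \<Rightarrow> int list) \<Rightarrow> ('a \<Rightarrow> nat) \<Rightarrow> ('a \<Rightarrow> real) \<Rightarrow> bool" where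
  "polytime_computable cs I enc sz f \<longleftrightarrow>
     (\<exists>c. \<exists>p :: nat poly. \<forall>x\<in>I. \<exists>t s.
        exec cs c (init (enc x)) t s \<and> result_of s = f x \<and> t \<le> poly p (sz x))"


section \<open>Domain-liftability\<close>

primrec cmp_code :: "cmp \<Rightarrow> int" where
  "cmp_code Lt = 0"
| "cmp_code Le = 1"
| "cmp_code Eq = 2"
| "cmp_code Ge = 3"
| "cmp_code Gt = 4"

primrec enc_constr :: "constr \<Rightarrow> int list" where
  "enc_constr (Card P c m) = [cmp_code c, int P, int m]"
| "enc_constr (PosLit P a) = [5, int P, int a]"
| "enc_constr (NegLit P a) = [6, int P, int a]"

fun enc_instance :: "nat \<times> constr list \<Rightarrow> int list" where
  "enc_instance (n, \<Gamma>) = int n # int (length \<Gamma>) # concat (map enc_constr \<Gamma>)"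

text \<open>The domain size counts in unary, the constraints in binary.\<close>

fun instance_size :: "nat \<times> constr list \<Rightarrow> nat" where
  "instance_size (n, \<Gamma>) = n + (\<Sum>x\<leftarrow>enc_instance (n, \<Gamma>). bits x)"

definition wf_instances :: "vocabulary \<Rightarrow> (nat \<times> constr list) set" where
  "wf_instances V = {(n, \<Gamma>). 1 \<le> n \<and> (\<forall>\<kappa>\<in>set \<Gamma>. wf_constr V n \<kappa>)}"

text \<open>
  \<open>domain_liftable V \<Phi> A\<close>: for all fixed weights, the weighted count of the sentence \<^term>\<open>\<Phi>\<close> together
  with cardinality constraints, unary evidence and the axiom \<^term>\<open>A\<close> is computable in
  polynomial time, where the program may depend on everything but the domain size and the
  constraints.
\<close>

definition domain_liftable :: "vocabulary \<Rightarrow> fm \<Rightarrow> (nat \<Rightarrow> world \<Rightarrow> bool) \<Rightarrow> bool" where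
  "domain_liftable V \<Phi> A \<longleftrightarrow>
     (\<forall>w wbar. polytime_computable
        (map w [0..<length V] @ map wbar [0..<length V])
        (wf_instances V) enc_instance instance_size
        (\<lambda>(n, \<Gamma>). WFOMC V (\<lambda>\<omega>. models n \<omega> \<Phi> \<and> sat_constrs \<omega> \<Gamma> \<and> A n \<omega>) n w wbar))"

end

theory Submission
  imports Defs
begin

text \<open>
  Since the weight of a world depends only on how many atoms of each predicate are true, all
  bookkeeping can be done with counters.  The domain is built up along the linear order: the elements
  are added one by one, and a new element is paired with the earlier ones one at a time.  An element is
  remembered only through its class: its 1-type, the guessed truth values of the quantified subformulas
  at it, and for each of them a counter, capped at the threshold of the quantifier, of the witnesses met so far.
  There are boundedly many classes, so a partial structure is described by polynomially many
  vectors of class sizes, together with the numbers of true atoms (for the cardinality constraints),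
  of undecided atoms, and of elements still to be placed with given unary evidence.  A guess
  that agrees with the counters it produces is the truth, by induction on subformulas; hence every model is
  counted exactly once, and neither Skolemization nor division is needed.

  The steps of this construction are the transitions of a fixed weighted Petri net with inhibitor arcs, and the
  count is the total weight of the runs from the initial marking.  A marking is coded as a number in a base that
  is polynomial in the domain size.  One place counts the steps and is the most significant digit, so
  every transition increases the code, and a single loop over the codes, downwards, computes the
  weights of all markings.
\<close>

section \<open>Execution with time bounds\<close>

text \<open>Real cells admit ring operations only, so cardinalities cannot be recovered by
  interpolation and have to be part of the state. The order makes insertion canonical: the next
  element is always the least of the rest, so a model has exactly one insertion sequence, and an
  element needs no identity beyond its evidence. The number of candidates with that evidence enters
  as a factor. Within a round no partner is distinguished, so the classes are numbered and inhibitor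
  arcs force the least nonempty one. Two variables matter because a quantified subformula has at
  most one free variable and its matrix, at a pair, sees only the atoms over that pair and the
  guesses at its two elements. Formal sizes add up under multiplication. A table entry is a sum of
  products of a transition weight with one later entry, so sizes grow by a fixed amount per row and
  stay polynomial. The base must exceed every counter of a run. Apart from the first and the last
  step, at least one of any two consecutive steps decides an atom, so twice the number of ground
  atoms plus a constant bounds the number of steps.\<close>

lemma bits_le_Suc_iff: "bits x \<le> Suc k \<longleftrightarrow> \<bar>x\<bar> < 2 ^ k"
proof -
  have "bits x \<le> Suc k \<longleftrightarrow> nat \<bar>x\<bar> < 2 ^ k"
    unfolding bits_def by (simp add: floorlog_le_iff)
  also have "\<dots> \<longleftrightarrow> \<bar>x\<bar> < 2 ^ k"
    by (simp add: nat_less_iff)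
  finally show ?thesis .
qed

lemma bits_pos: "1 \<le> bits x"
  by (simp add: bits_def)

lemma bits_le_nat: "bits x \<le> Suc (nat \<bar>x\<bar>)"
proof -
  have "nat \<bar>x\<bar> < 2 ^ nat \<bar>x\<bar>" by (rule less_exp)
  then have "int (nat \<bar>x\<bar>) < int (2 ^ nat \<bar>x\<bar>)" by (simp only: of_nat_less_iff)
  then show ?thesis unfolding bits_le_Suc_iff by simp
qed

lemma abs_div_le: "\<bar>x div y\<bar> \<le> \<bar>x :: int\<bar>"
proof (cases "y = 0")
  case False
  show ?thesis
  proof (cases "x = 0")
    case x: False
    have "\<bar>x div y\<bar> \<le> \<bar>x\<bar>"
    proof -
      have *: "\<bar>a div b\<bar> \<le> \<bar>a\<bar>" if "0 < b" for a b :: int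
      proof (cases "0 \<le> a")
        case True
        then show ?thesis using that
          using zdiv_mono2[of a 1 b] by (simp add: pos_imp_zdiv_nonneg_iff)
      next
        case neg: False
        have "a * 1 \<ge> a * b" using neg that by (intro mult_left_mono_neg) auto
        then have "a * b div b \<le> a div b" using that by (intro zdiv_mono1) auto
        then have "a \<le> a div b" using that by simp
        moreover have "a div b < 0" using neg that by (simp add: neg_imp_zdiv_neg_iff pos_imp_zdiv_neg_iff)
        ultimately show ?thesis by simp
      qed
      show ?thesis
      proof (cases "0 < y")
        case False
        then have "\<bar>(- x) div (- y)\<bar> \<le> \<bar>- x\<bar>" using \<open>y \<noteq> 0\<close> by (intro *) auto
        then show ?thesis by simp
      qed (rule *)
    qed
    then show ?thesis .
  qed simp
qed simp

lemma abs_mod_le: "\<bar>x mod y\<bar> \<le> max \<bar>x\<bar> \<bar>y :: int\<bar>"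
  using abs_mod_less[of y x] by (cases "y = 0") auto

text \<open>With \<open>bits x = k + 1\<close> and \<open>bits y = l + 1\<close> it suffices that
  the result is below \<open>2 ^ (k + l + 1)\<close> in absolute value. Sums are below
  \<open>2 ^ k + 2 ^ l\<close>, products below \<open>2 ^ (k + l)\<close>, and quotients and
  remainders do not exceed the larger operand.\<close>

lemma bits_binop:
  "bits (x + y) \<le> bits x + bits y" "bits (x - y) \<le> bits x + bits y"
  "bits (x * y) \<le> bits x + bits y" "bits (x div y) \<le> bits x + bits y"
  "bits (x mod y) \<le> bits x + bits y"
proof -
  obtain k l where kl: "bits x = Suc k" "bits y = Suc l"
    using bits_pos[of x] bits_pos[of y] by (metis Suc_le_D One_nat_def)
  have x: "\<bar>x\<bar> < 2 ^ k" and y: "\<bar>y\<bar> < 2 ^ l" using kl by (metis bits_le_Suc_iff order_refl)+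
  have p: "(2::int) ^ k \<le> 2 ^ (k + l)" "(2::int) ^ l \<le> 2 ^ (k + l)" by (simp_all add: power_increasing)
  have m: "\<bar>x * y\<bar> < 2 ^ (k + l)"
    unfolding abs_mult power_add using x y by (intro mult_strict_mono') auto
  have q: "z \<le> x' \<Longrightarrow> x' < 2 ^ (k + l) \<Longrightarrow> z < 2 ^ Suc (k + l)" for z x' :: int
    using zero_le_power[of "2 :: int" "k + l"] by (simp del: zero_le_power)
  have *: "bits z \<le> bits x + bits y" if "\<bar>z\<bar> < 2 ^ Suc (k + l)" for z
    using that unfolding kl by (simp add: bits_le_Suc_iff[of z "Suc (k + l)"] del: power_Suc)
  show "bits (x + y) \<le> bits x + bits y" "bits (x - y) \<le> bits x + bits y"
    "bits (x * y) \<le> bits x + bits y"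
    by (rule *; insert x y p m zero_le_power[of "2 :: int" "k + l"]; simp only: power_Suc; linarith)+
  show "bits (x div y) \<le> bits x + bits y"
    by (rule *, rule q[OF abs_div_le less_le_trans[OF x p(1)]])
  show "bits (x mod y) \<le> bits x + bits y"
    by (rule *, rule q[OF abs_mod_le]) (use less_le_trans[OF x p(1)] less_le_trans[OF y p(2)] in simp)
qed

section \<open>Cost of expressions in terms of a bound on the cells\<close>

definition cells_bounded :: "nat \<Rightarrow> state \<Rightarrow> bool" where
  "cells_bounded b s \<longleftrightarrow> 1 \<le> b \<and> (\<forall>i. bits (fst s i) \<le> b)"

lemma cells_bounded_upd: "cells_bounded b s \<Longrightarrow> bits v \<le> b \<Longrightarrow> cells_bounded b ((fst s)(a := v), r)"
  by (auto simp: cells_bounded_def)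

primrec icost_factor :: "iexp \<Rightarrow> nat" where
  "icost_factor (Const x) = bits x"
| "icost_factor (Read a) = Suc (icost_factor a)"
| "icost_factor (Add a b) = 2 * (icost_factor a + icost_factor b)"
| "icost_factor (Sub a b) = 2 * (icost_factor a + icost_factor b)"
| "icost_factor (Mul a b) = 2 * (icost_factor a + icost_factor b)"
| "icost_factor (Div a b) = 2 * (icost_factor a + icost_factor b)"
| "icost_factor (Mod a b) = 2 * (icost_factor a + icost_factor b)"

lemma bits_le_icost: "bits (ival e s) \<le> icost e s"
  by (cases e) auto

text \<open>A value is never longer than the cost already paid for it, so an operation at most
  doubles the cost of its operands; this is the 2 in \<open>icost_factor\<close>. Beyond that, only
  constants and single cells need a bound.\<close>

lemma icost_le:
  assumes "cells_bounded b s"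
  shows "icost e s \<le> icost_factor e * b"
proof -
  have binop: "z + ka + bcost_factor \<le> 2 * (ca + cb) * b"
    if "z \<le> x + y" "x \<le> ka" "y \<le> bcost_factor" "ka \<le> ca * b" "bcost_factor \<le> cb * b" for z x y ka bcost_factor ca cb :: nat
    using that by (simp add: algebra_simps)
  show ?thesis
  proof (induction e)
    case (Const x)
    then show ?case using assms by (simp add: cells_bounded_def)
  next
    case (Read a)
    have "bits (fst s (ival a s)) \<le> b" using assms by (simp add: cells_bounded_def)
    then show ?case using Read by simp
  next
    case (Add a c) show ?case unfolding icost.simps ival.simps icost_factor.simps
      by (rule binop[OF bits_binop(1) bits_le_icost bits_le_icost Add])
  next
    case (Sub a c) show ?case unfolding icost.simps ival.simps icost_factor.simps
      by (rule binop[OF bits_binop(2) bits_le_icost bits_le_icost Sub])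
  next
    case (Mul a c) show ?case unfolding icost.simps ival.simps icost_factor.simps
      by (rule binop[OF bits_binop(3) bits_le_icost bits_le_icost Mul])
  next
    case (Div a c) show ?case unfolding icost.simps ival.simps icost_factor.simps
      by (rule binop[OF bits_binop(4) bits_le_icost bits_le_icost Div])
  next
    case (Mod a c) show ?case unfolding icost.simps ival.simps icost_factor.simps
      by (rule binop[OF bits_binop(5) bits_le_icost bits_le_icost Mod])
  qed
qed

primrec bcost_factor :: "bexp \<Rightarrow> nat" where
  "bcost_factor (Less a b) = Suc (icost_factor a + icost_factor b)"
| "bcost_factor (Not b) = Suc (bcost_factor b)"
| "bcost_factor (And b c) = Suc (bcost_factor b + bcost_factor c)"

lemma bcost_le:
  assumes "cells_bounded b s"
  shows "bcost e s \<le> bcost_factor e * b"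
proof (induction e)
  case (Less a c)
  then show ?case using icost_le[OF assms, of a] icost_le[OF assms, of c] assms
    by (simp add: cells_bounded_def algebra_simps)
qed (use assms in \<open>auto simp: cells_bounded_def algebra_simps\<close>)

primrec rcost_factor :: "rexp \<Rightarrow> nat" where
  "rcost_factor (OfInt a) = 2 * icost_factor a"
| "rcost_factor (RConst i) = 1"
| "rcost_factor (RRead a) = Suc (icost_factor a)"
| "rcost_factor (RAdd a b) = Suc (2 * (rcost_factor a + rcost_factor b))"
| "rcost_factor (RSub a b) = Suc (2 * (rcost_factor a + rcost_factor b))"
| "rcost_factor (RMul a b) = 2 * (rcost_factor a + rcost_factor b)"

lemma rsize_le_rcost: "snd (rval cs e s) \<le> rcost cs e s"
  by (cases e) auto

text \<open>Here \<open>b\<close> bounds the integer cells and \<open>r\<close> the formal sizes. An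
  addition has size one more than the maximum, which explains the additional \<open>Suc\<close> in
  \<open>rcost_factor\<close>.\<close>

lemma rcost_le:
  assumes "cells_bounded b s" "\<And>i. snd (snd s i) \<le> r"
  shows "rcost cs e s \<le> rcost_factor e * (b + r)"
proof -
  have b: "1 \<le> b" using assms by (simp add: cells_bounded_def)
  have i: "icost a s \<le> icost_factor a * (b + r)" for a
    by (rule order_trans[OF icost_le[OF assms(1)]]) simp
  have binop: "z + ka + bcost_factor \<le> Suc (2 * (ca + cb)) * (b + r)"
    if "z \<le> Suc (x + y)" "x \<le> ka" "y \<le> bcost_factor" "ka \<le> ca * (b + r)" "bcost_factor \<le> cb * (b + r)"
    for z x y ka bcost_factor ca cb :: nat
  proof -
    have "z + ka + bcost_factor \<le> 1 + 2 * (ka + bcost_factor)" using that by simp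
    also have "\<dots> \<le> (b + r) + 2 * (ca * (b + r) + cb * (b + r))" using that b by simp
    finally show ?thesis by (simp add: algebra_simps)
  qed
  have binop': "z + ka + bcost_factor \<le> 2 * (ca + cb) * (b + r)"
    if "z \<le> x + y" "x \<le> ka" "y \<le> bcost_factor" "ka \<le> ca * (b + r)" "bcost_factor \<le> cb * (b + r)"
    for z x y ka bcost_factor ca cb :: nat
    using that by (simp add: algebra_simps)
  show ?thesis
  proof (induction e)
    case (OfInt a)
    have "bits (ival a s) + icost a s \<le> 2 * icost a s" using bits_le_icost[of a s] by simp
    also have "\<dots> \<le> 2 * (icost_factor a * (b + r))" using i by simp
    finally show ?case by simp
  next
    case (RRead a)
    have "snd (snd s (ival a s)) \<le> r" by (rule assms)
    then show ?case using i[of a] by simp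
  next
    case (RAdd a c)
    show ?case unfolding rcost.simps rcost_factor.simps
      by (rule binop[OF _ rsize_le_rcost rsize_le_rcost RAdd]) (auto split: prod.splits)
  next
    case (RSub a c)
    show ?case unfolding rcost.simps rcost_factor.simps
      by (rule binop[OF _ rsize_le_rcost rsize_le_rcost RSub]) (auto split: prod.splits)
  next
    case (RMul a c)
    show ?case unfolding rcost.simps rcost_factor.simps
      by (rule binop'[OF _ rsize_le_rcost rsize_le_rcost RMul]) (auto split: prod.splits)
  qed (use b in auto)
qed

section \<open>Hoare rules with time bounds\<close>

text \<open>A total-correctness triple for one initial state. Since \<open>exec\<close> is
  deterministic, the existential quantifier speaks about the only run.\<close>

definition runs :: "real list \<Rightarrow> com \<Rightarrow> state \<Rightarrow> nat \<Rightarrow> (state \<Rightarrow> bool) \<Rightarrow> bool" where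
  "runs cs c s T Q \<longleftrightarrow> (\<exists>t s'. exec cs c s t s' \<and> t \<le> T \<and> Q s')"

lemma runs_mono: "runs cs c s T Q \<Longrightarrow> T \<le> T' \<Longrightarrow> (\<And>s'. Q s' \<Longrightarrow> Q' s') \<Longrightarrow> runs cs c s T' Q'"
  unfolding runs_def by (meson order_trans)

lemma runs_Skip: "Q s \<Longrightarrow> 1 \<le> T \<Longrightarrow> runs cs Skip s T Q"
  unfolding runs_def by (meson exec.Skip)

lemma runs_Store:
  assumes "cells_bounded b s" "Q ((fst s)(ival a s := ival e s), snd s)"
  shows "runs cs (Store a e) s (Suc (icost_factor a + icost_factor e) * b) Q"
proof -
  have "Suc (icost a s + icost e s) \<le> Suc (icost_factor a + icost_factor e) * b"
    using icost_le[OF assms(1), of a] icost_le[OF assms(1), of e] assms(1)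
    by (simp add: cells_bounded_def algebra_simps)
  then show ?thesis unfolding runs_def using assms(2) exec.Store by blast
qed

lemma runs_RStore:
  assumes "cells_bounded b s" "\<And>i. snd (snd s i) \<le> r" "Q (fst s, (snd s)(ival a s := rval cs e s))"
  shows "runs cs (RStore a e) s (Suc (icost_factor a + rcost_factor e) * (b + r)) Q"
proof -
  have "icost a s \<le> icost_factor a * (b + r)"
    by (rule order_trans[OF icost_le[OF assms(1)]]) simp
  moreover have "1 \<le> b + r" using assms(1) by (simp add: cells_bounded_def)
  ultimately have "Suc (icost a s + rcost cs e s) \<le> Suc (icost_factor a + rcost_factor e) * (b + r)"
    using rcost_le[OF assms(1,2), of cs e]
    by (simp add: algebra_simps)
  then show ?thesis unfolding runs_def using assms(3) exec.RStore by blast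
qed

lemma runs_If:
  assumes "cells_bounded b s" "bval g s \<Longrightarrow> runs cs c s T Q" "\<not> bval g s \<Longrightarrow> runs cs d s T Q"
  shows "runs cs (If g c d) s (Suc (bcost_factor g) * b + T) Q"
proof -
  have le: "Suc (bcost g s + t) \<le> Suc (bcost_factor g) * b + T" if "t \<le> T" for t
    using bcost_le[OF assms(1), of g] that assms(1) by (simp add: cells_bounded_def)
  show ?thesis
  proof (cases "bval g s")
    case True
    with assms(2) obtain t s' where "exec cs c s t s'" "t \<le> T" "Q s'" by (auto simp: runs_def)
    then show ?thesis unfolding runs_def using exec.IfTrue[OF True] le by blast
  next
    case False
    with assms(3) obtain t s' where "exec cs d s t s'" "t \<le> T" "Q s'" by (auto simp: runs_def)
    then show ?thesis unfolding runs_def using exec.IfFalse[OF False] le by blast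
  qed
qed

lemma runs_Seq:
  assumes "runs cs c s T Q" "\<And>s'. Q s' \<Longrightarrow> runs cs d s' U Q'"
  shows "runs cs (Seq c d) s (Suc (T + U)) Q'"
proof -
  obtain t s' where 1: "exec cs c s t s'" "t \<le> T" "Q s'" using assms(1) by (auto simp: runs_def)
  obtain v s'' where 2: "exec cs d s' v s''" "v \<le> U" "Q' s''"
    using assms(2)[OF 1(3)] by (auto simp: runs_def)
  show ?thesis unfolding runs_def
    by (intro exI conjI, rule exec.Seq[OF 1(1) 2(1)]) (use 1 2 in auto)
qed

text \<open>The invariant is indexed by the number of completed rounds, which doubles as the
  variant: the loop stops after exactly \<open>K\<close> rounds, having evaluated the guard
  \<open>Suc K\<close> times.\<close>

lemma runs_While:
  assumes cells_bounded: "\<And>k s. I k s \<Longrightarrow> cells_bounded b s"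
    and step: "\<And>k s. k < K \<Longrightarrow> I k s \<Longrightarrow> bval g s \<and> runs cs c s T (I (Suc k))"
    and stop: "\<And>s. I K s \<Longrightarrow> \<not> bval g s"
    and init: "I 0 s"
  shows "runs cs (While g c) s (Suc K * Suc (bcost_factor g * b + T)) (I K)"
proof -
  have "I k s \<Longrightarrow> runs cs (While g c) s (Suc (K - k) * Suc (bcost_factor g * b + T)) (I K)" if "k \<le> K" for k s
    using that
  proof (induction "K - k" arbitrary: k s)
    case 0
    then have k: "k = K" by simp
    have "\<not> bval g s" using stop 0 k by simp
    then have "exec cs (While g c) s (Suc (bcost g s)) s" by (rule exec.WhileFalse)
    moreover have "Suc (bcost g s) \<le> Suc (K - k) * Suc (bcost_factor g * b + T)"
      using bcost_le[OF cells_bounded[OF 0(2)], of g] by simp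
    ultimately show ?case using 0 k unfolding runs_def by blast
  next
    case (Suc j)
    have g: "bval g s" and r: "runs cs c s T (I (Suc k))" using step[of k s] Suc by auto
    obtain t s' where 1: "exec cs c s t s'" "t \<le> T" "I (Suc k) s'" using r by (auto simp: runs_def)
    have "runs cs (While g c) s' (Suc (K - Suc k) * Suc (bcost_factor g * b + T)) (I K)"
      using Suc 1 by (intro Suc.hyps(1)) auto
    then obtain v s'' where 2: "exec cs (While g c) s' v s''"
      "v \<le> Suc (K - Suc k) * Suc (bcost_factor g * b + T)" "I K s''"
      by (auto simp: runs_def)
    have "exec cs (While g c) s (Suc (bcost g s + t + v)) s''"
      by (rule exec.WhileTrue[OF g 1(1) 2(1)])
    moreover have "Suc (bcost g s + t + v) \<le> Suc (bcost_factor g * b + T) + Suc (K - Suc k) * Suc (bcost_factor g * b + T)"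
      using bcost_le[OF cells_bounded[OF Suc(3)], of g] 1 2 by simp
    moreover have "\<dots> = Suc (K - k) * Suc (bcost_factor g * b + T)" using Suc by (simp add: Suc_diff_Suc)
    ultimately show ?case using 2(3) unfolding runs_def by (metis order_trans)
  qed
  from this[of 0 s] init show ?thesis by simp
qed

section \<open>Derived commands and expressions\<close>

primrec seqs :: "com list \<Rightarrow> com" where
  "seqs [] = Skip"
| "seqs (c # cs) = Seq c (seqs cs)"

primrec ipow :: "iexp \<Rightarrow> nat \<Rightarrow> iexp" where
  "ipow e 0 = Const 1"
| "ipow e (Suc k) = Mul e (ipow e k)"

lemma ival_ipow [simp]: "ival (ipow e k) s = ival e s ^ k"
  by (induction k) auto

primrec isum :: "iexp list \<Rightarrow> iexp" where
  "isum [] = Const 0"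
| "isum (e # es) = Add e (isum es)"

lemma ival_isum [simp]: "ival (isum es) s = (\<Sum>e\<leftarrow>es. ival e s)"
  by (induction es) auto

primrec bconj :: "bexp list \<Rightarrow> bexp" where
  "bconj [] = Not (Less (Const 0) (Const 0))"
| "bconj (b # bs) = And b (bconj bs)"

lemma bval_bconj [simp]: "bval (bconj bs) s \<longleftrightarrow> (\<forall>b\<in>set bs. bval b s)"
  by (induction bs) auto

definition beq :: "iexp \<Rightarrow> iexp \<Rightarrow> bexp" where
  "beq a b = And (Not (Less a b)) (Not (Less b a))"

lemma bval_beq [simp]: "bval (beq a b) s \<longleftrightarrow> ival a s = ival b s"
  by (auto simp: beq_def)

definition bimp :: "bexp \<Rightarrow> bexp \<Rightarrow> bexp" where
  "bimp b c = Not (And b (Not c))"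

lemma bval_bimp [simp]: "bval (bimp b c) s \<longleftrightarrow> (bval b s \<longrightarrow> bval c s)"
  by (auto simp: bimp_def)

primrec rprod :: "rexp list \<Rightarrow> rexp" where
  "rprod [] = OfInt (Const 1)"
| "rprod (e # es) = RMul e (rprod es)"

lemma fst_rval_rprod: "fst (rval cs (rprod es) s) = (\<Prod>e\<leftarrow>es. fst (rval cs e s))"
  by (induction es) (auto split: prod.splits)

lemma snd_rval_rprod: "snd (rval cs (rprod es) s) = bits 1 + (\<Sum>e\<leftarrow>es. snd (rval cs e s))"
  by (induction es) (auto split: prod.splits)

text \<open>A polynomial time bound in terms of \<open>B\<close>, valid whenever \<open>B\<close> bounds the bit lengths, the
  formal sizes and the numbers of iterations of the loops.\<close>

primrec time_bound :: "com \<Rightarrow> nat \<Rightarrow> nat" where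
  "time_bound Skip B = 1"
| "time_bound (Store a e) B = Suc (icost_factor a + icost_factor e) * B"
| "time_bound (RStore a e) B = Suc (icost_factor a + rcost_factor e) * (B + B)"
| "time_bound (Seq c d) B = Suc (time_bound c B + time_bound d B)"
| "time_bound (If g c d) B = Suc (bcost_factor g) * B + (time_bound c B + time_bound d B)"
| "time_bound (While g c) B = Suc B * Suc (bcost_factor g * B + time_bound c B)"

section \<open>Polynomial functions and the uniform time bound\<close>

definition polynomial :: "(nat \<Rightarrow> nat) \<Rightarrow> bool" where
  "polynomial f \<longleftrightarrow> (\<exists>p. \<forall>x. f x = poly p x)"

lemma polynomial_const [intro]: "polynomial (\<lambda>_. c)"
  unfolding polynomial_def by (intro exI[of _ "[:c:]"]) simp

lemma polynomial_id [intro]: "polynomial (\<lambda>x. x)"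
  unfolding polynomial_def by (intro exI[of _ "[:0, 1:]"]) simp

lemma polynomial_add [intro]: "polynomial f \<Longrightarrow> polynomial g \<Longrightarrow> polynomial (\<lambda>x. f x + g x)"
  unfolding polynomial_def by (metis poly_add)

lemma polynomial_mult [intro]: "polynomial f \<Longrightarrow> polynomial g \<Longrightarrow> polynomial (\<lambda>x. f x * g x)"
  unfolding polynomial_def by (metis poly_mult)

lemma polynomial_power [intro]: "polynomial f \<Longrightarrow> polynomial (\<lambda>x. f x ^ k)"
  unfolding polynomial_def by (metis poly_power)

lemma polynomial_Suc [intro]: "polynomial f \<Longrightarrow> polynomial (\<lambda>x. Suc (f x))"
  using polynomial_add[OF _ polynomial_const[of 1]] by simp

lemma polynomial_comp: "polynomial f \<Longrightarrow> polynomial g \<Longrightarrow> polynomial (\<lambda>x. f (g x))"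
  unfolding polynomial_def by (metis poly_pcompose)

lemmas polynomial_intros =
  polynomial_Suc polynomial_add polynomial_mult polynomial_power polynomial_const polynomial_id

lemma polynomial_time_bound: "polynomial (time_bound c)"
  by (induction c) (simp_all del: mult_Suc add_Suc add_Suc_right, (intro polynomial_intros | assumption)+)

definition timed :: "real list \<Rightarrow> nat \<Rightarrow> com \<Rightarrow> state \<Rightarrow> (state \<Rightarrow> bool) \<Rightarrow> bool" where
  "timed cs B c s Q \<longleftrightarrow> runs cs c s (time_bound c B) Q"

lemma timed_mono: "timed cs B c s Q \<Longrightarrow> (\<And>s'. Q s' \<Longrightarrow> Q' s') \<Longrightarrow> timed cs B c s Q'"
  unfolding timed_def by (erule runs_mono) auto

lemma timed_Skip: "Q s \<Longrightarrow> timed cs B Skip s Q"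
  unfolding timed_def by (rule runs_Skip) auto

lemma timed_Store: "cells_bounded B s \<Longrightarrow> Q ((fst s)(ival a s := ival e s), snd s) \<Longrightarrow> timed cs B (Store a e) s Q"
  unfolding timed_def time_bound.simps by (rule runs_Store)

lemma timed_RStore:
  "cells_bounded B s \<Longrightarrow> (\<And>i. snd (snd s i) \<le> B) \<Longrightarrow> Q (fst s, (snd s)(ival a s := rval cs e s)) \<Longrightarrow>
    timed cs B (RStore a e) s Q"
  unfolding timed_def time_bound.simps by (rule runs_RStore)

text \<open>\<open>time_bound\<close> adds the bounds of the two branches instead of taking the
  maximum, because sums keep it a polynomial.\<close>

lemma timed_If:
  "cells_bounded B s \<Longrightarrow> (bval g s \<Longrightarrow> timed cs B c s Q) \<Longrightarrow> (\<not> bval g s \<Longrightarrow> timed cs B d s Q) \<Longrightarrow>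
    timed cs B (If g c d) s Q"
  unfolding timed_def time_bound.simps by (rule runs_If) (auto elim: runs_mono)

lemma timed_Seq:
  "timed cs B c s Q \<Longrightarrow> (\<And>s'. Q s' \<Longrightarrow> timed cs B d s' Q') \<Longrightarrow> timed cs B (Seq c d) s Q'"
  unfolding timed_def time_bound.simps by (rule runs_Seq)

lemma timed_While:
  assumes "\<And>k s. I k s \<Longrightarrow> cells_bounded B s"
    and "\<And>k s. k < K \<Longrightarrow> I k s \<Longrightarrow> bval g s \<and> timed cs B c s (I (Suc k))"
    and "\<And>s. I K s \<Longrightarrow> \<not> bval g s"
    and "I 0 s" and "K \<le> B"
  shows "timed cs B (While g c) s (I K)"
proof -
  have "runs cs (While g c) s (Suc K * Suc (bcost_factor g * B + time_bound c B)) (I K)"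
    by (rule runs_While) (use assms in \<open>auto simp: timed_def\<close>)
  then show ?thesis unfolding timed_def time_bound.simps
    by (rule runs_mono[OF _ mult_le_mono1]) (use assms(5) in auto)
qed

text \<open>For straight-line code generated from a list: \<open>J j\<close> is the assertion
  between command \<open>j - 1\<close> and command \<open>j\<close>.\<close>

lemma timed_seqs:
  assumes "\<And>j s. j < length cl \<Longrightarrow> J j s \<Longrightarrow> timed cs B (cl ! j) s (J (Suc j))" "J 0 s"
  shows "timed cs B (seqs cl) s (J (length cl))"
  using assms
proof (induction cl arbitrary: J s)
  case Nil
  then show ?case by (auto intro: timed_Skip)
next
  case (Cons c cl)
  have "timed cs B (seqs cl) s' (J (length (c # cl)))" if "J 1 s'" for s'
    using Cons.IH[of "\<lambda>j. J (Suc j)" s'] Cons.prems(1)[of "Suc _"] that by simp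
  moreover have "timed cs B c s (J 1)" using Cons.prems(1)[of 0 s] Cons.prems(2) by simp
  ultimately show ?case unfolding seqs.simps by (intro timed_Seq[where Q = "J 1"])
qed

section \<open>Weighted Petri nets with inhibitor arcs\<close>

text \<open>\<open>wl\<close> lists indices of real constants to be multiplied. \<open>fac\<close>
  lists places whose current token numbers are multiplied in as well, which accounts for the choice
  of one individual among indistinguishable ones.\<close>

datatype 'p ptrans =
  PTrans (pre: "'p \<Rightarrow> nat") (inh: "'p \<Rightarrow> bool") (post: "'p \<Rightarrow> nat") (wl: "nat list") (fac: "'p list")

definition enabled :: "'p set \<Rightarrow> 'p ptrans \<Rightarrow> ('p \<Rightarrow> nat) \<Rightarrow> bool" where
  "enabled A t m \<longleftrightarrow> (\<forall>q\<in>A. pre t q \<le> m q \<and> (inh t q \<longrightarrow> m q = 0))"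

definition fire :: "'p ptrans \<Rightarrow> ('p \<Rightarrow> nat) \<Rightarrow> 'p \<Rightarrow> nat" where
  "fire t m q = m q - pre t q + post t q"

definition twt :: "real list \<Rightarrow> 'p ptrans \<Rightarrow> ('p \<Rightarrow> nat) \<Rightarrow> real" where
  "twt cs t m = (\<Prod>j\<leftarrow>wl t. cs ! j) * (\<Prod>q\<leftarrow>fac t. real (m q))"

text \<open>Literals count as satisfied here, since they are enforced earlier, when the element that
  they mention is added.\<close>

primrec card_sat :: "(nat \<Rightarrow> nat) \<Rightarrow> constr \<Rightarrow> bool" where
  "card_sat f (Card P c m) \<longleftrightarrow> compare c (f P) m"
| "card_sat f (PosLit P a) \<longleftrightarrow> True"
| "card_sat f (NegLit P a) \<longleftrightarrow> True"

text \<open>The literals $P(a)$ and $\neg P(a)$ have the codes \<open>2 * P\<close> and \<open>2 * P + 1\<close>.\<close>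

primrec is_lit :: "constr \<Rightarrow> nat \<Rightarrow> nat \<Rightarrow> bool" where
  "is_lit (Card P c m) a l \<longleftrightarrow> False"
| "is_lit (PosLit P x) a l \<longleftrightarrow> a = x \<and> l = 2 * P"
| "is_lit (NegLit P x) a l \<longleftrightarrow> a = x \<and> l = 2 * P + 1"

text \<open>Elements with the same set are interchangeable until they are added, so it is enough to
  count them.\<close>

definition evt :: "constr list \<Rightarrow> nat \<Rightarrow> nat set" where
  "evt \<Gamma> a = {l. \<exists>\<kappa>\<in>set \<Gamma>. is_lit \<kappa> a l}"

section \<open>Markings as numbers in positional notation\<close>

definition code :: "nat \<Rightarrow> nat \<Rightarrow> (nat \<Rightarrow> nat) \<Rightarrow> nat" where
  "code N D m = (\<Sum>d<D. m d * N ^ d)"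

lemma code_less: "(\<And>d. d < D \<Longrightarrow> m d < N) \<Longrightarrow> code N D m < N ^ D"
proof (induction D)
  case (Suc D)
  have "code N (Suc D) m < N ^ D + m D * N ^ D" using Suc by (simp add: code_def)
  also have "\<dots> = Suc (m D) * N ^ D" by simp
  also have "\<dots> \<le> N * N ^ D" using Suc.prems[of D] by (intro mult_right_mono) auto
  finally show ?case by simp
qed (simp add: code_def)

lemma code_digit:
  assumes "\<And>d. d < D \<Longrightarrow> m d < N" "d < D"
  shows "code N D m div N ^ d mod N = m d"
  using assms
proof (induction D)
  case (Suc D)
  have N: "0 < N" using Suc.prems(1)[of d] Suc.prems(2) by simp
  have c: "code N (Suc D) m = code N D m + m D * N ^ D" by (simp add: code_def)
  show ?case
  proof (cases "d = D")
    case True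
    have "code N D m < N ^ D" using Suc.prems by (intro code_less) auto
    then have "code N (Suc D) m div N ^ D = m D" unfolding c using N by simp
    then show ?thesis using True Suc.prems(1)[of D] by simp
  next
    case False
    then have d: "d < D" using Suc.prems by simp
    then have "N ^ D = N ^ (D - Suc d) * N * N ^ d"
      by (simp flip: power_Suc power_Suc2 power_add)
    then have "code N (Suc D) m = code N D m + (m D * N ^ (D - Suc d) * N) * N ^ d"
      unfolding c by simp
    then have "code N (Suc D) m div N ^ d = code N D m div N ^ d + m D * N ^ (D - Suc d) * N"
      using N by simp
    then show ?thesis using Suc.IH Suc.prems d by simp
  qed
qed simp

definition delta :: "nat \<Rightarrow> nat \<Rightarrow> nat ptrans \<Rightarrow> int" where
  "delta N D t = (\<Sum>d<D. (int (post t d) - int (pre t d)) * int N ^ d)"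

text \<open>Enabledness makes the truncated subtraction in \<open>fire\<close> exact, so the change
  of the code is independent of the marking. This is an identity of sums and stays valid when a
  digit of the new marking reaches the base.\<close>

lemma code_fire:
  assumes "enabled {..<D} t m"
  shows "int (code N D (fire t m)) = int (code N D m) + delta N D t"
proof -
  have "int (code N D (fire t m)) = (\<Sum>d<D. int (m d - pre t d + post t d) * int N ^ d)"
    by (simp add: code_def fire_def)
  also have "\<dots> = (\<Sum>d<D. int (m d) * int N ^ d + (int (post t d) - int (pre t d)) * int N ^ d)"
  proof (intro sum.cong refl)
    fix d assume "d \<in> {..<D}"
    then have "pre t d \<le> m d" using assms by (simp add: enabled_def)
    then have "int (m d - pre t d + post t d) = int (m d) + (int (post t d) - int (pre t d))"
      by linarith
    then show "int (m d - pre t d + post t d) * int N ^ d =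
        int (m d) * int N ^ d + (int (post t d) - int (pre t d)) * int N ^ d"
      by (simp only: distrib_right)
  qed
  finally show ?thesis by (simp add: sum.distrib code_def delta_def)
qed

text \<open>The top digit gains at least \<open>N ^ (D - 1)\<close>, while the tokens consumed below
  it are part of a number with \<open>D - 1\<close> digits and so weigh less than that.\<close>

lemma delta_pos:
  assumes "enabled {..<D} t m" "\<And>d. d < D \<Longrightarrow> m d < N" "0 < D" "pre t (D - 1) = 0" "0 < post t (D - 1)"
  shows "0 < delta N D t"
proof -
  have D: "{..<D} = insert (D - 1) {..<D - 1}" using assms(3) by auto
  have "int (\<Sum>d<D. pre t d * N ^ d) = int (\<Sum>d<D - 1. pre t d * N ^ d)"
    unfolding D using assms(4) by simp
  also have "(\<Sum>d<D - 1. pre t d * N ^ d) \<le> code N (D - 1) m"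
    unfolding code_def using assms(1) by (intro sum_mono mult_right_mono) (auto simp: enabled_def)
  also have "code N (D - 1) m < N ^ (D - 1)" using assms(2) by (intro code_less) auto
  also have "N ^ (D - 1) \<le> post t (D - 1) * N ^ (D - 1)" using assms(5) by simp
  also have "\<dots> \<le> (\<Sum>d<D. post t d * N ^ d)"
    by (rule member_le_sum) (use assms(3) in auto)
  finally have "int (\<Sum>d<D. pre t d * N ^ d) < int (\<Sum>d<D. post t d * N ^ d)" by simp
  then show ?thesis by (simp add: delta_def left_diff_distrib sum_subtractf)
qed

section \<open>The program\<close>

lemma length_enc_constr: "length (enc_constr \<kappa>) = 3"
  by (cases \<kappa>) auto

lemma length_concat_enc: "length (concat (map enc_constr \<Gamma>)) = 3 * length \<Gamma>"
  by (induction \<Gamma>) (auto simp: length_enc_constr)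

lemma nth_concat_enc:
  "j < length \<Gamma> \<Longrightarrow> i < 3 \<Longrightarrow> concat (map enc_constr \<Gamma>) ! (3 * j + i) = enc_constr (\<Gamma> ! j) ! i"
proof (induction \<Gamma> arbitrary: j)
  case (Cons \<kappa> \<Gamma>)
  then show ?case
    by (cases j) (auto simp: nth_append length_enc_constr)
qed simp

text \<open>The input occupies the cells from 0 on, so the working cells have negative addresses: base of the
  code, current code, loop counter, code of the initial marking, result of the constraint check.  From cell
  $-10$ downwards there is a flag for each pair of an element and a literal.  Real cell \<open>s + 1\<close> is
  for the weight of the marking with code \<open>s\<close>.\<close>

abbreviation "rN \<equiv> Read (Const (-1))"
abbreviation "rS \<equiv> Read (Const (-2))"
abbreviation "rJ \<equiv> Read (Const (-3))"
abbreviation "rI \<equiv> Read (Const (-4))"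
abbreviation "rK \<equiv> Read (Const (-5))"

text \<open>Two cells for \<open>n\<close> and the number of constraints precede the constraints,
  which take three cells each.\<close>

definition constr_field :: "int \<Rightarrow> iexp" where
  "constr_field i = Read (Add (Const (2 + i)) (Mul (Const 3) rJ))"

abbreviation "tagE \<equiv> constr_field 0"
abbreviation "predE \<equiv> constr_field 1"
abbreviation "argE \<equiv> constr_field 2"

abbreviation "incJ \<equiv> Store (Const (-3)) (Add rJ (Const 1))"

definition digit :: "nat \<Rightarrow> iexp" where
  "digit d = Mod (Div rS (ipow rN d)) rN"

text \<open>The tags 5 and 6 of literals satisfy every implication vacuously, in accordance with
  \<open>card_sat\<close>.\<close>

definition cmpE :: "iexp \<Rightarrow> bexp" where
  "cmpE x = bconj
     [bimp (beq tagE (Const 0)) (Less x argE), bimp (beq tagE (Const 1)) (Not (Less argE x)),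
      bimp (beq tagE (Const 2)) (beq x argE), bimp (beq tagE (Const 3)) (Not (Less x argE)),
      bimp (beq tagE (Const 4)) (Less argE x)]"

text \<open>Places are numbers below \<open>D\<close>; the last one only gains tokens and drives the
  code upwards. \<open>dn\<close> marks finished runs, \<open>cp P\<close> counts the true atoms of
  \<open>P\<close>, \<open>evp e\<close> the waiting elements with evidence \<open>e\<close>, and
  \<open>el\<close> enumerates the evidence sets. \<open>u0\<close> and \<open>k0\<close> give the
  rest of the initial marking as monomials in \<open>n\<close>; \<open>C\<close> and
  \<open>K\<close> determine the base.\<close>

locale net =
  fixes D :: nat and ts :: "nat ptrans list" and dn :: nat and cp :: "nat \<Rightarrow> nat" and nv :: nat
    and el :: "nat set list" and evp :: "nat set \<Rightarrow> nat" and u0 k0 :: "nat \<Rightarrow> nat" and C K :: nat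
  assumes el: "distinct el" "set el = Pow {..<2 * nv}"
    and places: "dn < D" "\<And>P. P < nv \<Longrightarrow> cp P < D" "\<And>e. e \<subseteq> {..<2 * nv} \<Longrightarrow> evp e < D"
    and ts: "\<And>t. t \<in> set ts \<Longrightarrow> pre t (D - 1) = 0 \<and> 0 < post t (D - 1) \<and> set (fac t) \<subseteq> {..<D}"
    and C: "2 \<le> C"
begin

definition base :: "nat \<Rightarrow> nat" where
  "base n = C * (n + 2) ^ K"

definition initial :: "nat \<Rightarrow> constr list \<Rightarrow> nat \<Rightarrow> nat" where
  "initial n \<Gamma> d = u0 d * n ^ k0 d + card {a\<in>{1..n}. evp (evt \<Gamma> a) = d}"

definition flagE :: "iexp \<Rightarrow> iexp \<Rightarrow> iexp" where
  "flagE x l = Sub (Const (-10)) (Add (Mul x (Const (2 * int nv))) l)"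

definition set_base :: com where
  "set_base = Store (Const (-1)) (Mul (Const (int C)) (ipow (Add (Read (Const 0)) (Const 2)) K))"

definition set_flags :: com where
  "set_flags = While (Less rJ (Read (Const 1))) (Seq
     (If (Less tagE (Const 5)) Skip
       (Store (flagE argE (Sub (Add (Mul (Const 2) predE) tagE) (Const 5))) (Const 1)))
     incJ)"

definition ematch :: "nat set \<Rightarrow> bexp" where
  "ematch e = bconj (map (\<lambda>l. beq (Read (flagE rJ (Const (int l)))) (Const (if l \<in> e then 1 else 0)))
     [0..<2 * nv])"

definition add_evidence :: com where
  "add_evidence = While (Not (Less (Read (Const 0)) rJ)) (Seq
     (seqs (map (\<lambda>e. If (ematch e) (Store (Const (-4)) (Add rI (ipow rN (evp e)))) Skip) el))
     incJ)"

text \<open>The predicate is read from the input, but \<open>digit\<close> takes an index fixed in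
  the program text, so there is one case for every predicate.\<close>

definition satE :: bexp where
  "satE = bconj (map (\<lambda>P. bimp (beq predE (Const (int P))) (cmpE (digit (cp P)))) [0..<nv])"

definition final_com :: com where
  "final_com = Seq (Store (Const (-5)) (Const 1)) (Seq (Store (Const (-3)) (Const 0)) (Seq
     (While (Less rJ (Read (Const 1))) (Seq (If satE Skip (Store (Const (-5)) (Const 0))) incJ))
     (RStore (Add rS (Const 1)) (OfInt rK))))"

definition guard :: "nat ptrans \<Rightarrow> bexp" where
  "guard t = bconj (map (\<lambda>d. And (Not (Less (digit d) (Const (int (pre t d)))))
     (if inh t d then beq (digit d) (Const 0) else bconj [])) [0..<D])"

definition weightE :: "nat ptrans \<Rightarrow> rexp" where
  "weightE t = rprod (map RConst (wl t) @ map (\<lambda>d. OfInt (digit d)) (fac t))"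

definition targetE :: "nat ptrans \<Rightarrow> iexp" where
  "targetE t = Add (Add rS (Const 1))
     (isum (map (\<lambda>d. Mul (Const (int (post t d) - int (pre t d))) (ipow rN d)) [0..<D]))"

text \<open>Accumulation in place relies on the cell still holding its initial value 0 when the
  first transition is processed.\<close>

definition step :: "nat ptrans \<Rightarrow> com" where
  "step t = If (guard t) (RStore (Add rS (Const 1))
     (RAdd (RRead (Add rS (Const 1))) (RMul (weightE t) (RRead (targetE t))))) Skip"

text \<open>The code is decremented before use, so a start at \<open>base n ^ D\<close> runs through
  exactly the codes below it.\<close>

definition fill_table :: com where
  "fill_table = While (Less (Const 0) rS) (Seq (Store (Const (-2)) (Sub rS (Const 1)))
     (If (Less (Const 0) (digit dn)) final_com (seqs (map step ts))))"

definition prog :: com where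
  "prog = Seq set_base (Seq set_flags
     (Seq (Store (Const (-4)) (isum (map (\<lambda>d. Mul (Mul (Const (int (u0 d)))
        (ipow (Read (Const 0)) (k0 d))) (ipow rN d)) [0..<D])))
     (Seq (Store (Const (-3)) (Const 1)) (Seq add_evidence
     (Seq (Store (Const (-2)) (ipow rN D)) (Seq fill_table
     (RStore (Const 0) (RRead (Add rI (Const 1))))))))))"

end

section \<open>Verification of the program: evidence and the initial code\<close>

lemma evt_subset: "(\<And>\<kappa>. \<kappa> \<in> set \<Gamma> \<Longrightarrow> wf_constr V n \<kappa>) \<Longrightarrow> evt \<Gamma> a \<subseteq> {..<2 * length V}"
proof
  fix l assume wf: "\<And>\<kappa>. \<kappa> \<in> set \<Gamma> \<Longrightarrow> wf_constr V n \<kappa>" and "l \<in> evt \<Gamma> a"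
  then obtain \<kappa> where \<kappa>: "\<kappa> \<in> set \<Gamma>" "is_lit \<kappa> a l" by (auto simp: evt_def)
  show "l \<in> {..<2 * length V}" using wf[OF \<kappa>(1)] \<kappa>(2) by (cases \<kappa>) auto
qed

lemma bits_le_of_abs: "nat \<bar>v\<bar> < B \<Longrightarrow> bits v \<le> B"
  using bits_le_nat[of v] by simp

text \<open>All costs are measured by the single number \<open>B\<close>: \<open>B1\<close> covers
  the input, \<open>B2\<close> loop counters and codes, and \<open>B3\<close> the formal sizes in
  the completed table, which grow linearly with the number of rows.\<close>

locale net_instance = net +
  fixes V :: vocabulary and cs :: "real list" and n :: nat and \<Gamma> :: "constr list" and B :: nat
  assumes nv: "nv = length V"
    and wl: "\<And>t. t \<in> set ts \<Longrightarrow> set (wl t) \<subseteq> {..<length cs}"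
    and wf: "\<And>\<kappa>. \<kappa> \<in> set \<Gamma> \<Longrightarrow> wf_constr V n \<kappa>"
    and n: "1 \<le> n"
    and bounded: "\<And>d. d < D \<Longrightarrow> initial n \<Gamma> d < base n"
    and B1: "\<And>x. x \<in> set (enc_instance (n, \<Gamma>)) \<Longrightarrow> bits x \<le> B"
    and B2: "length \<Gamma> + n + 3 + base n ^ D \<le> B"
    and B3: "1 + Suc (base n ^ D) * ((\<Sum>t\<leftarrow>ts. length (wl t) + length (fac t)) * Suc (base n) + length ts + 3) \<le> B"
begin

abbreviation "N \<equiv> base n"
abbreviation "M \<equiv> base n ^ D"

definition input :: "int \<Rightarrow> int" where
  "input = fst (init (enc_instance (n, \<Gamma>)))"

lemma input_neg: "i < 0 \<Longrightarrow> input i = 0"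
  by (simp add: input_def init_def)

lemma input_0: "input 0 = int n" and input_1: "input 1 = int (length \<Gamma>)"
  by (simp_all add: input_def init_def)

lemma input_field:
  assumes "j < length \<Gamma>" "i < 3"
  shows "input (2 + int i + 3 * int j) = enc_constr (\<Gamma> ! j) ! i"
proof -
  have e: "2 + int i + 3 * int j = int (Suc (Suc (3 * j + i)))" by simp
  have "3 * j + i < 3 * length \<Gamma>" using assms by simp
  then show ?thesis unfolding input_def init_def e
    by (simp add: length_concat_enc nth_concat_enc assms del: of_nat_Suc)
qed

lemma evt_sub: "evt \<Gamma> a \<subseteq> {..<2 * nv}"
  unfolding nv by (rule evt_subset) (rule wf)

lemma B_pos: "3 \<le> B" using B2 by simp

lemma bits_input: "bits (input i) \<le> B"
proof -
  have "input i = 0 \<or> input i \<in> set (enc_instance (n, \<Gamma>))"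
    unfolding input_def init_def by (auto simp del: enc_instance.simps intro!: nth_mem)
  then show ?thesis using B1 B_pos bits_le_of_abs[of 0 B] by auto
qed

lemma N2: "2 \<le> N"
proof -
  have "2 * 1 \<le> C * (n + 2) ^ K" using C by (intro mult_mono) auto
  then show ?thesis by (simp add: base_def)
qed

lemma N_le_M: "N \<le> M"
  using places(1) N2 by (metis gr_implies_not0 less_one linorder_not_le power_increasing power_one_right order_trans one_le_numeral)

text \<open>What every command after the computation of the base preserves.\<close>

definition env :: "state \<Rightarrow> bool" where
  "env s \<longleftrightarrow> cells_bounded B s \<and> (\<forall>i\<ge>0. fst s i = input i) \<and> fst s (-1) = int N"

lemma env_upd: "env s \<Longrightarrow> a < -1 \<Longrightarrow> bits v \<le> B \<Longrightarrow> env ((fst s)(a := v), r)"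
  by (auto simp: env_def cells_bounded_def)

lemma env_snd: "env s \<Longrightarrow> env (fst s, r)"
  by (auto simp: env_def cells_bounded_def)

lemma env_bnd: "env s \<Longrightarrow> cells_bounded B s" by (simp add: env_def)

lemma env_input: "env s \<Longrightarrow> fst s 0 = int n" "env s \<Longrightarrow> fst s 1 = int (length \<Gamma>)" "env s \<Longrightarrow> fst s (-1) = int N"
  using input_0 input_1 by (simp_all add: env_def)

lemma constr_field:
  assumes "env s" "fst s (-3) = int j" "j < length \<Gamma>"
  shows "ival tagE s = enc_constr (\<Gamma> ! j) ! 0" "ival predE s = enc_constr (\<Gamma> ! j) ! 1"
    "ival argE s = enc_constr (\<Gamma> ! j) ! 2"
proof -
  have e: "fst s i = input i" if "0 \<le> i" for i using assms(1) that by (simp add: env_def)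
  show "ival tagE s = enc_constr (\<Gamma> ! j) ! 0" "ival predE s = enc_constr (\<Gamma> ! j) ! 1"
    "ival argE s = enc_constr (\<Gamma> ! j) ! 2"
    using input_field[OF assms(3), of 0] input_field[OF assms(3), of 1] input_field[OF assms(3), of 2] assms(2)
    by (simp_all add: constr_field_def e)
qed

definition flag :: "nat \<Rightarrow> nat \<Rightarrow> int" where
  "flag a l = - 10 - (int a * (2 * int nv) + int l)"

lemma flag_le: "flag a l \<le> -10"
proof -
  have "0 \<le> int a * (2 * int nv)" by simp
  then show ?thesis unfolding flag_def by linarith
qed

lemma flag_ne [simp]: "flag a l \<noteq> -1" "flag a l \<noteq> -2" "flag a l \<noteq> -3" "flag a l \<noteq> -4" "flag a l \<noteq> -5"
  using flag_le[of a l] by auto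

lemma flag_inj:
  assumes "l < 2 * nv" "l' < 2 * nv"
  shows "flag a l = flag a' l' \<longleftrightarrow> a = a' \<and> l = l'"
proof
  assume "flag a l = flag a' l'"
  then have "int (a * (2 * nv) + l) = int (a' * (2 * nv) + l')" by (simp add: flag_def)
  then have eq: "a * (2 * nv) + l = a' * (2 * nv) + l'" by (simp only: of_nat_eq_iff)
  then have "(a * (2 * nv) + l) div (2 * nv) = (a' * (2 * nv) + l') div (2 * nv)" by (simp only:)
  then have "a = a'" using assms by simp
  then show "a = a' \<and> l = l'" using eq by simp
qed simp

definition flags :: "nat \<Rightarrow> state \<Rightarrow> bool" where
  "flags j s \<longleftrightarrow>
     (\<forall>a l. l < 2 * nv \<longrightarrow> fst s (flag a l) = (if \<exists>i<j. is_lit (\<Gamma> ! i) a l then 1 else 0))"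

lemma flags_upd: "flags j s \<Longrightarrow> -10 < a \<Longrightarrow> flags j ((fst s)(a := v), r)"
proof -
  assume "flags j s" "-10 < a"
  moreover have "flag a' l \<noteq> a" for a' l using flag_le[of a' l] \<open>-10 < a\<close> by auto
  ultimately show ?thesis by (simp add: flags_def)
qed

lemma flags_evt: "flags (length \<Gamma>) s \<Longrightarrow> l < 2 * nv \<Longrightarrow> fst s (flag a l) = (if l \<in> evt \<Gamma> a then 1 else 0)"
  unfolding flags_def evt_def by (simp, metis in_set_conv_nth)

lemma set_base:
  assumes "s = init (enc_instance (n, \<Gamma>))"
  shows "timed cs B set_base s (\<lambda>s. env s \<and> fst s (-3) = 0 \<and> flags 0 s \<and> snd s = (\<lambda>_. (0, 1)))"
proof -
  have s: "fst s = input" "snd s = (\<lambda>_. (0, 1))" using assms by (simp_all add: input_def init_def)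
  have b: "cells_bounded B s" using bits_input B_pos s by (simp add: cells_bounded_def)
  have v: "int C * (int n + 2) ^ K = int N" by (simp add: base_def add.commute)
  have "N < B" using B2 N_le_M by simp
  then have "bits (int N) \<le> B" by (intro bits_le_of_abs) simp
  then have "cells_bounded B ((fst s)(-1 := int N), snd s)" by (intro cells_bounded_upd b)
  moreover have "input (flag a l) = 0" for a l using flag_le[of a l] by (intro input_neg) simp
  ultimately show ?thesis unfolding set_base_def
    by (intro timed_Store b) (simp add: v s input_0 input_neg env_def flags_def)
qed

lemma incJ:
  assumes "env s" "fst s (-3) = int j" "j < B - 1" "Q ((fst s)(-3 := int (Suc j)), snd s)"
  shows "timed cs B incJ s Q"
  by (intro timed_Store env_bnd assms) (use assms in \<open>simp add: add.commute\<close>)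

lemma set_flags:
  assumes "env s" "fst s (-3) = 0" "flags 0 s" "snd s = (\<lambda>_. (0, 1))"
  shows "timed cs B set_flags s (\<lambda>s. env s \<and> flags (length \<Gamma>) s \<and> snd s = (\<lambda>_. (0, 1)))"
proof -
  define I where "I j s \<longleftrightarrow> env s \<and> fst s (-3) = int j \<and> flags j s \<and> snd s = (\<lambda>_. (0, 1))" for j and s :: state
  have "timed cs B set_flags s (I (length \<Gamma>))" unfolding set_flags_def
  proof (rule timed_While)
    fix j s assume j: "j < length \<Gamma>" and I: "I j s"
    let ?\<kappa> = "\<Gamma> ! j"
    have \<kappa>: "wf_constr V n ?\<kappa>" using j wf by simp
    have env: "env s" and J: "fst s (-3) = int j" using I by (auto simp: I_def)
    note f = constr_field[OF env J j]
    define I' where "I' s \<longleftrightarrow> env s \<and> fst s (-3) = int j \<and> flags (Suc j) s \<and> snd s = (\<lambda>_. (0, 1))" for s :: state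
    have skip: "flags (Suc j) s" if "\<And>a l. \<not> is_lit ?\<kappa> a l"
      using I that unfolding I_def flags_def by (metis less_Suc_eq)
    have set: "I' ((fst s)(flag x l := 1), snd s)"
      if l: "l < 2 * nv" "\<And>a l'. is_lit ?\<kappa> a l' \<longleftrightarrow> a = x \<and> l' = l" for x l
    proof -
      have "bits 1 \<le> B" using B_pos by (intro bits_le_of_abs) simp
      then have "env ((fst s)(flag x l := 1), snd s)"
        using flag_le[of x l] by (intro env_upd env) auto
      moreover have "flags (Suc j) ((fst s)(flag x l := 1), snd s)"
        using I l flag_inj[OF _ l(1)] unfolding I_def flags_def by (auto simp: less_Suc_eq)
      ultimately show ?thesis using I flag_ne(3)[of x l] by (auto simp: I'_def I_def)
    qed
    have "timed cs B (If (Less tagE (Const 5)) Skip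
       (Store (flagE argE (Sub (Add (Mul (Const 2) predE) tagE) (Const 5))) (Const 1))) s I'"
    proof (rule timed_If[OF env_bnd[OF env]])
      assume "bval (Less tagE (Const 5)) s"
      then have "\<And>a l. \<not> is_lit ?\<kappa> a l" using f by (cases ?\<kappa>) auto
      then show "timed cs B Skip s I'" using I skip by (intro timed_Skip) (auto simp: I'_def I_def)
    next
      assume n5: "\<not> bval (Less tagE (Const 5)) s"
      \<comment> \<open>The tag minus 5 is the parity bit of the literal code
        \<open>2 * P + i\<close>, so a single store serves both signs.\<close>
      obtain P x i where c: "P < nv" "i < 2" "enc_constr ?\<kappa> = [5 + int i, int P, int x]"
        "\<And>a l'. is_lit ?\<kappa> a l' \<longleftrightarrow> a = x \<and> l' = 2 * P + i"
      proof (cases ?\<kappa>)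
        case (Card P c m)
        then show ?thesis using n5 f by (cases c) auto
      next
        case (PosLit P x)
        then show ?thesis using that[of P 0 x] \<kappa> nv by auto
      next
        case (NegLit P x)
        then show ?thesis using that[of P 1 x] \<kappa> nv by auto
      qed
      have "ival (flagE argE (Sub (Add (Mul (Const 2) predE) tagE) (Const 5))) s = flag x (2 * P + i)"
        using f c by (simp add: flagE_def flag_def)
      then show "timed cs B (Store (flagE argE (Sub (Add (Mul (Const 2) predE) tagE) (Const 5))) (Const 1)) s I'"
        using set[of "2 * P + i" x] c by (intro timed_Store env_bnd[OF env]) auto
    qed
    then have "timed cs B (Seq (If (Less tagE (Const 5)) Skip
       (Store (flagE argE (Sub (Add (Mul (Const 2) predE) tagE) (Const 5))) (Const 1))) incJ) s (I (Suc j))"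
    proof (rule timed_Seq)
      fix s assume I': "I' s"
      have "bits (int (Suc j)) \<le> B" using j B2 by (intro bits_le_of_abs) auto
      then show "timed cs B incJ s (I (Suc j))"
        using I' j B2 unfolding I'_def I_def
        by (intro incJ[of s j]) (auto simp: intro!: env_upd flags_upd)
    qed
    moreover have "bval (Less rJ (Read (Const 1))) s" using env_input[OF env] J j by simp
    ultimately show "bval (Less rJ (Read (Const 1))) s \<and> timed cs B (Seq (If (Less tagE (Const 5)) Skip
       (Store (flagE argE (Sub (Add (Mul (Const 2) predE) tagE) (Const 5))) (Const 1))) incJ) s (I (Suc j))"
      by blast
  next
    show "\<not> bval (Less rJ (Read (Const 1))) s" if "I (length \<Gamma>) s" for s
      using that env_input by (auto simp: I_def)
  qed (use assms B2 env_bnd in \<open>auto simp: I_def\<close>)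
  then show ?thesis by (rule timed_mono) (simp add: I_def)
qed

text \<open>The program adds one power of the base per element, while \<open>initial\<close> counts
  elements per place; grouping the elements by the place of their evidence identifies the
  two.\<close>

lemma code_initial:
  "int (code N D (initial n \<Gamma>)) =
     (\<Sum>d<D. int (u0 d) * int n ^ k0 d * int N ^ d) + (\<Sum>a\<in>{1..n}. int N ^ evp (evt \<Gamma> a))"
proof -
  have sub: "(\<lambda>a. evp (evt \<Gamma> a)) ` {1..n} \<subseteq> {..<D}"
    using evt_sub by (auto intro!: places(3))
  have "(\<Sum>d<D. int (card {a\<in>{1..n}. evp (evt \<Gamma> a) = d}) * int N ^ d) =
      (\<Sum>d<D. \<Sum>a\<in>{a\<in>{1..n}. evp (evt \<Gamma> a) = d}. int N ^ evp (evt \<Gamma> a))"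
    by (intro sum.cong refl) simp
  also have "\<dots> = (\<Sum>a\<in>{1..n}. int N ^ evp (evt \<Gamma> a))"
    by (intro sum.group) (use sub in auto)
  finally show ?thesis by (simp add: code_def initial_def distrib_right sum.distrib)
qed

lemma code_initial_less: "code N D (initial n \<Gamma>) < M"
  by (intro code_less bounded)

definition start :: "nat \<Rightarrow> int" where
  "start i = (\<Sum>d<D. int (u0 d) * int n ^ k0 d * int N ^ d) + (\<Sum>a\<in>{1..i}. int N ^ evp (evt \<Gamma> a))"

lemma start_nonneg: "0 \<le> start i"
  by (auto simp: start_def intro!: add_nonneg_nonneg sum_nonneg)

lemma start_n: "start n = int (code N D (initial n \<Gamma>))"
  by (simp add: code_initial start_def)

lemma bits_start: "i \<le> n \<Longrightarrow> bits (start i) \<le> B"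
proof -
  assume "i \<le> n"
  then have "start i \<le> start n"
    unfolding start_def by (intro add_left_mono sum_mono2) auto
  then have "start i < int M" using code_initial_less by (simp add: start_n del: of_nat_power)
  then have "nat (start i) < M" using start_nonneg[of i] by (simp add: nat_less_iff)
  then show ?thesis using start_nonneg[of i] B2 by (intro bits_le_of_abs) auto
qed

lemma ematch:
  assumes "env s" "fst s (-3) = int a" "flags (length \<Gamma>) s" "e \<subseteq> {..<2 * nv}"
  shows "bval (ematch e) s \<longleftrightarrow> e = evt \<Gamma> a"
proof -
  have "bval (ematch e) s \<longleftrightarrow> (\<forall>l<2 * nv. fst s (flag a l) = (if l \<in> e then 1 else 0))"
    by (auto simp: ematch_def flagE_def flag_def assms(2))
  also have "\<dots> \<longleftrightarrow> (\<forall>l<2 * nv. l \<in> evt \<Gamma> a \<longleftrightarrow> l \<in> e)"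
    by (auto simp: flags_evt[OF assms(3)] split: if_splits)
  also have "\<dots> \<longleftrightarrow> e = evt \<Gamma> a"
    using assms(4) evt_sub[of a] by (auto simp: subset_iff)
  finally show ?thesis .
qed

lemma add_evidence:
  assumes "env s" "fst s (-3) = 1" "flags (length \<Gamma>) s" "fst s (-4) = start 0" "snd s = (\<lambda>_. (0, 1))"
  shows "timed cs B add_evidence s (\<lambda>s. env s \<and> fst s (-4) = start n \<and> snd s = (\<lambda>_. (0, 1)))"
proof -
  define I where "I i s \<longleftrightarrow> env s \<and> fst s (-3) = int (Suc i) \<and> flags (length \<Gamma>) s \<and>
    fst s (-4) = start i \<and> snd s = (\<lambda>_. (0, 1))" for i and s :: state
  have "timed cs B add_evidence s (I n)" unfolding add_evidence_def
  proof (rule timed_While)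
    fix i s assume i: "i < n" and I: "I i s"
    let ?body = "\<lambda>e. If (ematch e) (Store (Const (-4)) (Add rI (ipow rN (evp e)))) Skip"
    \<comment> \<open>The contribution of the current element appears once its evidence set has been
      passed in the enumeration \<open>el\<close>.\<close>
    define J where "J j s \<longleftrightarrow> env s \<and> fst s (-3) = int (Suc i) \<and> flags (length \<Gamma>) s \<and>
      fst s (-4) = (if evt \<Gamma> (Suc i) \<in> set (take j el) then start (Suc i) else start i) \<and>
      snd s = (\<lambda>_. (0, 1))" for j and s :: state
    have "timed cs B (seqs (map ?body el)) s (J (length (map ?body el)))"
    proof (rule timed_seqs)
      fix j s assume j: "j < length (map ?body el)" and J: "J j s"
      let ?e = "el ! j"
      have env: "env s" using J by (simp add: J_def)
      have e: "?e \<subseteq> {..<2 * nv}" using el(2) j nth_mem[of j el] by auto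
      have m: "bval (ematch ?e) s \<longleftrightarrow> ?e = evt \<Gamma> (Suc i)"
        by (rule ematch[OF env _ _ e]) (use J in \<open>auto simp: J_def\<close>)
      have t: "set (take (Suc j) el) = insert ?e (set (take j el))"
        using j by (simp add: take_Suc_conv_app_nth)
      have "timed cs B (?body ?e) s (J (Suc j))"
      proof (rule timed_If[OF env_bnd[OF env]])
        assume "bval (ematch ?e) s"
        then have e: "?e = evt \<Gamma> (Suc i)" using m by simp
        \<comment> \<open>Distinctness of \<open>el\<close> ensures that the element is not counted
          twice.\<close>
        have "?e \<notin> set (take j el)"
          using el(1) j by (auto simp: in_set_conv_nth nth_eq_iff_index_eq)
        then have "fst s (-4) = start i" using J e by (simp add: J_def)
        then have v: "ival (Add rI (ipow rN (evp ?e))) s = start (Suc i)"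
          using env_input[OF env] e by (simp add: start_def)
        have "J (Suc j) ((fst s)(-4 := start (Suc i)), snd s)"
          using J bits_start[of "Suc i"] i unfolding J_def t e
          by (auto intro!: env_upd flags_upd)
        then show "timed cs B (Store (Const (-4)) (Add rI (ipow rN (evp ?e)))) s (J (Suc j))"
          by (intro timed_Store env_bnd[OF env]) (simp only: v ival.simps(1))
      next
        assume "\<not> bval (ematch ?e) s"
        then show "timed cs B Skip s (J (Suc j))"
          using J m unfolding J_def t by (intro timed_Skip) auto
      qed
      then show "timed cs B (map ?body el ! j) s (J (Suc j))" using j by simp
    next
      show "J 0 s" using I by (simp add: J_def I_def)
    qed
    moreover have "timed cs B incJ s (I (Suc i))" if "J (length (map ?body el)) s" for s
    proof -
      have "evt \<Gamma> (Suc i) \<in> set el" using el(2) evt_sub by auto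
      moreover have "bits (int (Suc (Suc i))) \<le> B" using i B2 by (intro bits_le_of_abs) auto
      ultimately show ?thesis using that i B2 unfolding J_def I_def
        by (intro incJ[of s "Suc i"]) (auto intro!: env_upd flags_upd)
    qed
    ultimately have "timed cs B (Seq (seqs (map ?body el)) incJ) s (I (Suc i))"
      by (rule timed_Seq)
    moreover have "bval (Not (Less (Read (Const 0)) rJ)) s" using I env_input i by (simp add: I_def)
    ultimately show "bval (Not (Less (Read (Const 0)) rJ)) s \<and>
        timed cs B (Seq (seqs (map ?body el)) incJ) s (I (Suc i))" by blast
  next
    show "\<not> bval (Not (Less (Read (Const 0)) rJ)) s" if "I n s" for s
      using that env_input by (simp add: I_def)
  qed (use assms B2 env_bnd in \<open>auto simp: I_def\<close>)
  then show ?thesis by (rule timed_mono) (simp add: I_def)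
qed

end

section \<open>Verification of the program: the table of weights\<close>

context net_instance begin

definition fin :: "(nat \<Rightarrow> nat) \<Rightarrow> bool" where
  "fin f \<longleftrightarrow> (\<forall>\<kappa>\<in>set \<Gamma>. card_sat (\<lambda>P. f (cp P)) \<kappa>)"

definition digit_of :: "nat \<Rightarrow> nat \<Rightarrow> nat" where
  "digit_of S d = S div N ^ d mod N"

lemma digit_of_less: "digit_of S d < N"
  using N2 by (simp add: digit_of_def)

lemma digit: "env s \<Longrightarrow> fst s (-2) = int S \<Longrightarrow> ival (digit d) s = int (digit_of S d)"
  using env_input(3)[of s] by (simp add: digit_def digit_of_def zdiv_int zmod_int)

lemma bits_digit: "bits (int (digit_of S d)) \<le> Suc N"
  using digit_of_less[of S d] by (intro bits_le_of_abs) simp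

definition env_at :: "nat \<Rightarrow> state \<Rightarrow> bool" where
  "env_at S s \<longleftrightarrow> env s \<and> fst s (-4) = start n \<and> fst s (-2) = int S"

lemma env_at_env: "env_at S s \<Longrightarrow> env s" by (simp add: env_at_def)

lemma satE:
  assumes "env_at S s" "fst s (-3) = int j" "j < length \<Gamma>"
  shows "bval satE s \<longleftrightarrow> card_sat (\<lambda>P. digit_of S (cp P)) (\<Gamma> ! j)"
proof -
  have env: "env s" "fst s (-2) = int S" using assms by (auto simp: env_at_def)
  have \<kappa>: "wf_constr V n (\<Gamma> ! j)" using assms wf by simp
  note f = constr_field[OF env(1) assms(2,3)]
  show ?thesis
  proof (cases "\<Gamma> ! j")
    case (Card P c m)
    then have "P < nv" using \<kappa> nv by simp
    then have "bval satE s \<longleftrightarrow> bval (cmpE (digit (cp P))) s"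
      using f Card by (auto simp: satE_def)
    also have "\<dots> \<longleftrightarrow> compare c (digit_of S (cp P)) m"
      using f Card by (cases c) (auto simp: cmpE_def digit[OF env])
    finally show ?thesis using Card by simp
  next
    case (PosLit P a)
    then show ?thesis using f by (simp add: satE_def cmpE_def)
  next
    case (NegLit P a)
    then show ?thesis using f by (simp add: satE_def cmpE_def)
  qed
qed

lemma final_com:
  assumes "env_at S s" "\<And>i. snd (snd s i) \<le> B"
  shows "timed cs B final_com s
    (\<lambda>s'. env_at S s' \<and> snd s' = (snd s)(int S + 1 := (if fin (digit_of S) then 1 else 0, bits (if fin (digit_of S) then 1 else 0))))"
proof -
  define r where "r = snd s"
  define I where "I j s \<longleftrightarrow> env_at S s \<and> fst s (-3) = int j \<and> snd s = r \<and>
    fst s (-5) = (if \<forall>i<j. card_sat (\<lambda>P. digit_of S (cp P)) (\<Gamma> ! i) then 1 else 0)" for j and s :: state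
  have b: "bits v \<le> B" if "v = 0 \<or> v = 1" for v :: int
    using that B_pos by (intro bits_le_of_abs) auto
  have upd: "env_at S ((fst s)(a := v), r')" if "env_at S s" "a \<in> {-3, -5}" "bits v \<le> B" for s a v r'
    using that by (auto simp: env_at_def intro!: env_upd)
  have loop: "timed cs B (While (Less rJ (Read (Const 1))) (Seq (If satE Skip (Store (Const (-5)) (Const 0))) incJ)) s
      (I (length \<Gamma>))" if "I 0 s" for s
  proof (rule timed_While)
    fix j s assume j: "j < length \<Gamma>" and I: "I j s"
    have env_at: "env_at S s" and J: "fst s (-3) = int j" using I by (auto simp: I_def)
    define I' where "I' s \<longleftrightarrow> env_at S s \<and> fst s (-3) = int j \<and> snd s = r \<and>
      fst s (-5) = (if \<forall>i<Suc j. card_sat (\<lambda>P. digit_of S (cp P)) (\<Gamma> ! i) then 1 else 0)" for s :: state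
    have "timed cs B (If satE Skip (Store (Const (-5)) (Const 0))) s I'"
    proof (rule timed_If[OF env_bnd[OF env_at_env[OF env_at]]])
      assume "bval satE s"
      then show "timed cs B Skip s I'"
        using I satE[OF env_at J j] by (intro timed_Skip) (auto simp: I'_def I_def less_Suc_eq)
    next
      assume "\<not> bval satE s"
      then have "\<exists>i<Suc j. \<not> card_sat (\<lambda>P. digit_of S (cp P)) (\<Gamma> ! i)" using satE[OF env_at J j] by blast
      then show "timed cs B (Store (Const (-5)) (Const 0)) s I'"
        using I b[of 0] by (intro timed_Store env_bnd[OF env_at_env[OF env_at]]) (auto simp: I'_def I_def intro!: upd)
    qed
    then have "timed cs B (Seq (If satE Skip (Store (Const (-5)) (Const 0))) incJ) s (I (Suc j))"
    proof (rule timed_Seq)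
      fix s assume I': "I' s"
      have "bits (int (Suc j)) \<le> B" using j B2 by (intro bits_le_of_abs) auto
      then show "timed cs B incJ s (I (Suc j))"
        using I' j B2 unfolding I'_def I_def
        by (intro incJ[of s j]) (auto simp: env_at_env intro!: upd)
    qed
    then show "bval (Less rJ (Read (Const 1))) s \<and>
        timed cs B (Seq (If satE Skip (Store (Const (-5)) (Const 0))) incJ) s (I (Suc j))"
      using env_input(2)[OF env_at_env[OF env_at]] J j by simp
  next
    show "\<not> bval (Less rJ (Read (Const 1))) s" if "I (length \<Gamma>) s" for s
      using that env_input(2)[of s] by (auto simp: I_def env_at_def)
  qed (use that B2 env_bnd env_at_env in \<open>auto simp: I_def\<close>)
  have all: "(\<forall>i<length \<Gamma>. card_sat (\<lambda>P. digit_of S (cp P)) (\<Gamma> ! i)) \<longleftrightarrow> fin (digit_of S)"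
    unfolding fin_def by (metis in_set_conv_nth)
  let ?Q = "\<lambda>s. env_at S s \<and> snd s = r"
  have 1: "timed cs B (Store (Const (-5)) (Const 1)) s (\<lambda>s. ?Q s \<and> fst s (-5) = 1)"
    using assms b[of 1] by (intro timed_Store env_bnd[OF env_at_env]) (auto intro!: upd simp: r_def)
  have 2: "timed cs B (Store (Const (-3)) (Const 0)) s (I 0)" if "?Q s \<and> fst s (-5) = 1" for s
    using that b[of 0] by (intro timed_Store env_bnd[OF env_at_env]) (auto simp: I_def intro!: upd)
  have 3: "timed cs B (RStore (Add rS (Const 1)) (OfInt rK)) s (\<lambda>s'. env_at S s' \<and>
      snd s' = r(int S + 1 := (if fin (digit_of S) then 1 else 0, bits (if fin (digit_of S) then 1 else 0))))"
    if "I (length \<Gamma>) s" for s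
  proof -
    have "env_at S s" "snd s = r" "fst s (-5) = (if fin (digit_of S) then 1 else 0)"
      using that by (auto simp: I_def all)
    then show ?thesis by (intro timed_RStore env_bnd[OF env_at_env])
      (use assms(2) in \<open>auto simp: env_at_def r_def intro: env_snd\<close>)
  qed
  show ?thesis unfolding final_com_def r_def[symmetric]
    by (rule timed_Seq[OF 1], rule timed_Seq[OF 2], assumption, rule timed_Seq[OF loop], assumption, rule 3)
qed

definition entry :: "(int \<Rightarrow> real \<times> nat) \<Rightarrow> nat \<Rightarrow> nat ptrans \<Rightarrow> real" where
  "entry r S t = (if enabled {..<D} t (digit_of S) then twt cs t (digit_of S) * fst (r (int S + 1 + delta N D t)) else 0)"

definition rhs :: "(int \<Rightarrow> real \<times> nat) \<Rightarrow> nat \<Rightarrow> real" where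
  "rhs r S = (if 0 < digit_of S dn then (if fin (digit_of S) then 1 else 0) else (\<Sum>t\<leftarrow>ts. entry r S t))"

lemma D_pos: "0 < D" using places(1) by simp

lemma delta_pos': "t \<in> set ts \<Longrightarrow> enabled {..<D} t (digit_of S) \<Longrightarrow> 0 < delta N D t"
  using ts digit_of_less D_pos by (intro delta_pos) auto

text \<open>By \<open>delta_pos'\<close> every enabled transition reads a cell strictly above the
  one being computed; this is what makes the downward sweep a correct evaluation order.\<close>

lemma rhs_cong:
  assumes "\<And>i. int S + 1 < i \<Longrightarrow> r i = r' i"
  shows "rhs r S = rhs r' S"
proof -
  have "entry r S t = entry r' S t" if "t \<in> set ts" for t
    using delta_pos'[OF that, of S] assms unfolding entry_def by auto
  then have "map (entry r S) ts = map (entry r' S) ts" by simp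
  then show ?thesis unfolding rhs_def by (simp only:)
qed

text \<open>A constant has formal size 1, and a digit below \<open>N\<close> has at most
  \<open>Suc N\<close> bits.\<close>

definition wb :: nat where
  "wb = (\<Sum>t\<leftarrow>ts. length (wl t) + length (fac t)) * Suc N"

text \<open>One product adds at most \<open>wb + 2\<close> to the size of the later entry, and each
  of the additions adds 1; the remaining 1 is slack for the start of the accumulation.\<close>

definition inc_size :: nat where
  "inc_size = wb + length ts + 3"

lemma guard:
  assumes "env_at S s"
  shows "bval (guard t) s \<longleftrightarrow> enabled {..<D} t (digit_of S)"
proof -
  have env: "env s" "fst s (-2) = int S" using assms by (auto simp: env_at_def)
  show ?thesis unfolding enabled_def
    by (auto simp: guard_def digit[OF env] not_less atLeast0LessThan split: if_splits)
qed

lemma targetE: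
  assumes "env_at S s"
  shows "ival (targetE t) s = int S + 1 + delta N D t"
proof -
  have env: "env s" "fst s (-2) = int S" using assms by (auto simp: env_at_def)
  show ?thesis using env_input(3)[OF env(1)] env(2)
    by (simp add: targetE_def delta_def comp_def interv_sum_list_conv_sum_set_nat atLeast0LessThan)
qed

lemma weightE_val:
  assumes "env_at S s" "t \<in> set ts"
  shows "fst (rval cs (weightE t) s) = twt cs t (digit_of S)"
proof -
  have env: "env s" "fst s (-2) = int S" using assms by (auto simp: env_at_def)
  have "map (\<lambda>i. fst (rval cs (RConst i) s)) (wl t) = map ((!) cs) (wl t)"
    using wl[OF assms(2)] by auto
  moreover have "fst (rval cs (weightE t) s) =
      (\<Prod>i\<leftarrow>wl t. fst (rval cs (RConst i) s)) * (\<Prod>d\<leftarrow>fac t. real (digit_of S d))"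
    by (simp add: weightE_def fst_rval_rprod comp_def digit[OF env])
  ultimately show ?thesis by (simp only: twt_def)
qed

lemma weightE_size:
  assumes "env_at S s" "t \<in> set ts"
  shows "snd (rval cs (weightE t) s) \<le> 2 + wb"
proof -
  have env: "env s" "fst s (-2) = int S" using assms by (auto simp: env_at_def)
  have "(\<Sum>d\<leftarrow>fac t. bits (int (digit_of S d))) \<le> (\<Sum>d\<leftarrow>fac t. Suc N)"
    by (intro sum_list_mono bits_digit)
  then have "(\<Sum>d\<leftarrow>fac t. bits (int (digit_of S d))) \<le> length (fac t) * Suc N"
    by (simp only: sum_list_triv of_nat_id)
  moreover have "bits 1 \<le> 2" using bits_le_Suc_iff[of 1 1] by simp
  moreover have "length (wl t) \<le> length (wl t) * Suc N" by simp
  moreover have "snd (rval cs (weightE t) s) =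
      bits 1 + (length (wl t) + (\<Sum>d\<leftarrow>fac t. bits (int (digit_of S d))))"
    by (simp add: weightE_def snd_rval_rprod comp_def digit[OF env] sum_list_triv)
  ultimately have "snd (rval cs (weightE t) s) \<le> 2 + (length (wl t) + length (fac t)) * Suc N"
    unfolding distrib_right by linarith
  also have "(length (wl t) + length (fac t)) * Suc N \<le> wb"
    unfolding wb_def by (intro mult_right_mono member_le_sum_list) (use assms(2) in auto)
  finally show ?thesis by simp
qed

text \<open>The size of the sum is one more than the maximum of the sizes, and the product stays
  below \<open>b + wb + 3\<close>. Hence the accumulator grows by 1 per transition, not by the size
  of the summand.\<close>

lemma step:
  assumes env_at: "env_at S s" and t: "t \<in> set ts" and s: "snd s = r(int S + 1 := (x, k))"
    and B: "\<And>i. snd (r i) \<le> b" "k \<le> b + wb + 3 + j" "b + wb + 3 + j \<le> B"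
  shows "timed cs B (step t) s (\<lambda>s'. env_at S s' \<and>
    (\<exists>k'. snd s' = r(int S + 1 := (x + entry r S t, k')) \<and> k' \<le> b + wb + 3 + Suc j))"
proof -
  note env = env_bnd[OF env_at_env[OF env_at]]
  have S: "fst s (-2) = int S" using env_at by (simp add: env_at_def)
  have sz: "snd (snd s i) \<le> B" for i
    using B(1)[of i] B(2,3) by (auto simp: s)
  show ?thesis unfolding step_def
  proof (rule timed_If[OF env])
    assume "bval (guard t) s"
    then have en: "enabled {..<D} t (digit_of S)" using guard[OF env_at] by simp
    have d: "0 < delta N D t" by (rule delta_pos'[OF t en])
    obtain y l where y: "r (int S + 1 + delta N D t) = (y, l)" by fastforce
    obtain z w where w: "rval cs (weightE t) s = (z, w)" by fastforce
    have z: "z = twt cs t (digit_of S)" "w \<le> 2 + wb"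
      using weightE_val[OF env_at t] weightE_size[OF env_at t] w by auto
    have l: "l \<le> b" using B(1)[of "int S + 1 + delta N D t"] y by simp
    have "rval cs (RAdd (RRead (Add rS (Const 1))) (RMul (weightE t) (RRead (targetE t)))) s =
        (x + entry r S t, Suc (max k (w + l)))"
      using d by (simp add: S s targetE[OF env_at] y w z entry_def en)
    moreover have "Suc (max k (w + l)) \<le> b + wb + 3 + Suc j" using z l B(2) by simp
    ultimately show "timed cs B (RStore (Add rS (Const 1))
        (RAdd (RRead (Add rS (Const 1))) (RMul (weightE t) (RRead (targetE t))))) s (\<lambda>s'. env_at S s' \<and>
        (\<exists>k'. snd s' = r(int S + 1 := (x + entry r S t, k')) \<and> k' \<le> b + wb + 3 + Suc j))"
      using env_at by (intro timed_RStore env sz) (auto simp: env_at_def S s intro: env_snd)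
  next
    assume "\<not> bval (guard t) s"
    then have "entry r S t = 0" using guard[OF env_at] by (simp add: entry_def)
    then show "timed cs B Skip s (\<lambda>s'. env_at S s' \<and>
        (\<exists>k'. snd s' = r(int S + 1 := (x + entry r S t, k')) \<and> k' \<le> b + wb + 3 + Suc j))"
      using env_at s B(2) by (intro timed_Skip) auto
  qed
qed

text \<open>Code \<open>S\<close> has cell \<open>S + 1\<close>, since cell 0 is reserved for the
  output. Rows are filled from the top, so cells up to \<open>M - k\<close> are untouched; a target
  code of \<open>M\<close> or more reads the 0 above the table.\<close>

definition table :: "nat \<Rightarrow> (int \<Rightarrow> real \<times> nat) \<Rightarrow> bool" where
  "table k r \<longleftrightarrow> (\<forall>i. snd (r i) \<le> 1 + k * inc_size) \<and>
     (\<forall>i. i \<le> int (M - k) \<or> int M < i \<longrightarrow> r i = (0, 1)) \<and>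
     (\<forall>S. M - k \<le> S \<and> S < M \<longrightarrow> fst (r (int S + 1)) = rhs r S)"

lemma table_Suc:
  assumes "table k r" "k < M" "S = M - Suc k" "x = rhs r S" "l \<le> 1 + Suc k * inc_size"
  shows "table (Suc k) (r(int S + 1 := (x, l)))"
proof -
  have S: "S < M" "M - k = Suc S" "M - Suc k = S" using assms(2,3) by auto
  have "fst ((r(int S + 1 := (x, l))) (int S' + 1)) = rhs (r(int S + 1 := (x, l))) S'"
    if S': "S \<le> S'" "S' < M" for S'
  proof -
    have "rhs (r(int S + 1 := (x, l))) S' = rhs r S'" by (rule rhs_cong) (use S' in auto)
    moreover have "fst (r (int S' + 1)) = rhs r S'" if "S' \<noteq> S"
      using assms(1) S' S that unfolding table_def by auto
    ultimately show ?thesis using assms(4) by auto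
  qed
  moreover have "snd (r i) \<le> 1 + Suc k * inc_size" for i
    using assms(1) unfolding table_def by (metis add_left_mono le_add2 mult_Suc order_trans)
  moreover have "r i = (0, 1)" if "i \<le> int S \<or> int M < i" for i
    using assms(1) that S unfolding table_def by auto
  ultimately show ?thesis unfolding table_def S using S assms(5) by auto
qed

lemma fill_table:
  assumes "env s" "fst s (-4) = start n" "fst s (-2) = int M" "snd s = (\<lambda>_. (0, 1))"
  shows "timed cs B fill_table s (\<lambda>s. env s \<and> fst s (-4) = start n \<and> table M (snd s))"
proof -
  define I where "I k s \<longleftrightarrow> env_at (M - k) s \<and> table k (snd s)" for k and s :: state
  have Bk: "1 + Suc k * inc_size \<le> B" if "k < M" for k
  proof -
    have "Suc k * inc_size \<le> Suc M * inc_size" using that by (intro mult_right_mono) auto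
    then show ?thesis using B3 unfolding inc_size_def wb_def by linarith
  qed
  have "timed cs B fill_table s (I M)" unfolding fill_table_def
  proof (rule timed_While)
    fix k s assume k: "k < M" and I: "I k s"
    define S where "S = M - Suc k"
    define r where "r = snd s"
    have r: "table k r" using I by (simp add: I_def r_def)
    have rsz: "snd (r i) \<le> 1 + k * inc_size" for i using r by (simp add: table_def)
    have szB: "1 + k * inc_size + inc_size \<le> B" using Bk[OF k] by simp
    have env: "env s" and s2: "fst s (-2) = int (M - k)" using I by (auto simp: I_def env_at_def)
    have Sk: "int (M - k) - 1 = int S" using k by (simp add: S_def)
    have g: "bval (Less (Const 0) rS) s" using s2 k by simp
    have "timed cs B (Store (Const (-2)) (Sub rS (Const 1))) s (\<lambda>s. env_at S s \<and> snd s = r)"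
    proof (intro timed_Store env_bnd[OF env])
      have "S < B" using k B2 by (simp add: S_def)
      then have "bits (int S) \<le> B" by (intro bits_le_of_abs) (simp only: abs_of_nat nat_int)
      then have "env_at S ((fst s)(-2 := int S), r)" using I env by (auto simp: I_def env_at_def intro!: env_upd)
      then show "env_at S ((fst s)(ival (Const (-2)) s := ival (Sub rS (Const 1)) s), snd s) \<and>
          snd ((fst s)(ival (Const (-2)) s := ival (Sub rS (Const 1)) s), snd s) = r"
        by (simp add: s2 Sk r_def del: of_nat_diff)
    qed
    then have "timed cs B (Seq (Store (Const (-2)) (Sub rS (Const 1)))
      (If (Less (Const 0) (digit dn)) final_com (seqs (map step ts)))) s (I (Suc k))"
    proof (rule timed_Seq)
      fix s assume s: "env_at S s \<and> snd s = r"
      have env: "env s" "fst s (-2) = int S" using s by (auto simp: env_at_def)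
      have r0: "r (int S + 1) = (0, 1)"
        using r k unfolding table_def S_def by (auto simp: of_nat_diff)
      show "timed cs B (If (Less (Const 0) (digit dn)) final_com (seqs (map step ts))) s (I (Suc k))"
      proof (rule timed_If[OF env_bnd[OF env(1)]])
        assume "bval (Less (Const 0) (digit dn)) s"
        then have dn: "0 < digit_of S dn" by (simp add: digit[OF env])
        have "snd (snd s i) \<le> B" for i using rsz[of i] szB s by simp
        then have "timed cs B final_com s (\<lambda>s'. env_at S s' \<and> snd s' =
            (snd s)(int S + 1 := (if fin (digit_of S) then 1 else 0, bits (if fin (digit_of S) then 1 else 0))))"
          using s by (intro final_com) auto
        then show "timed cs B final_com s (I (Suc k))"
        proof (rule timed_mono)
          fix s' assume s': "env_at S s' \<and> snd s' =
            (snd s)(int S + 1 := (if fin (digit_of S) then 1 else 0, bits (if fin (digit_of S) then 1 else 0)))"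
          have "bits (if fin (digit_of S) then 1 else 0) \<le> Suc 1" unfolding bits_le_Suc_iff by simp
          then have "table (Suc k) (r(int S + 1 := (if fin (digit_of S) then 1 else 0, bits (if fin (digit_of S) then 1 else 0))))"
            by (intro table_Suc[OF r k S_def]) (auto simp: rhs_def dn inc_size_def)
          then show "I (Suc k) s'" using s s' by (simp add: I_def S_def)
        qed
      next
        assume "\<not> bval (Less (Const 0) (digit dn)) s"
        then have dn: "\<not> 0 < digit_of S dn" by (simp add: digit[OF env])
        define b where "b = 1 + k * inc_size"
        define J where "J j s \<longleftrightarrow> env_at S s \<and> (\<exists>l. snd s = r(int S + 1 := (\<Sum>t\<leftarrow>take j ts. entry r S t, l)) \<and>
          l \<le> b + wb + 3 + j)" for j and s :: state
        have "timed cs B (seqs (map step ts)) s (J (length (map step ts)))"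
        proof (rule timed_seqs)
          show "J 0 s" unfolding J_def using s r0 by (intro conjI exI[of _ 1]) (auto simp: fun_eq_iff b_def)
        next
          fix j s assume j: "j < length (map step ts)" and J: "J j s"
          then obtain l where l: "snd s = r(int S + 1 := (\<Sum>t\<leftarrow>take j ts. entry r S t, l))"
            "l \<le> b + wb + 3 + j" and env_at: "env_at S s" by (auto simp: J_def)
          have "timed cs B (step (ts ! j)) s (\<lambda>s'. env_at S s' \<and>
            (\<exists>k'. snd s' = r(int S + 1 := ((\<Sum>t\<leftarrow>take j ts. entry r S t) + entry r S (ts ! j), k')) \<and>
              k' \<le> b + wb + 3 + Suc j))"
            by (rule step[OF env_at _ l(1) _ l(2)]) (use j rsz szB in \<open>auto simp: b_def inc_size_def\<close>)
          then have "timed cs B (step (ts ! j)) s (J (Suc j))"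
            by (rule timed_mono) (use j in \<open>auto simp: J_def take_Suc_conv_app_nth\<close>)
          then show "timed cs B (map step ts ! j) s (J (Suc j))" using j by simp
        qed
        then show "timed cs B (seqs (map step ts)) s (I (Suc k))"
        proof (rule timed_mono)
          fix s' assume "J (length (map step ts)) s'"
          then obtain l where l: "snd s' = r(int S + 1 := (\<Sum>t\<leftarrow>ts. entry r S t, l))"
            "l \<le> b + wb + 3 + length ts" and env_at: "env_at S s'" by (auto simp: J_def)
          have "table (Suc k) (snd s')" unfolding l(1)
            by (intro table_Suc[OF r k S_def]) (use l(2) dn in \<open>auto simp: rhs_def inc_size_def b_def\<close>)
          then show "I (Suc k) s'" using env_at by (simp add: I_def S_def)
        qed
      qed
    qed
    then show "bval (Less (Const 0) rS) s \<and> timed cs B (Seq (Store (Const (-2)) (Sub rS (Const 1)))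
      (If (Less (Const 0) (digit dn)) final_com (seqs (map step ts)))) s (I (Suc k))" using g by simp
  next
    show "\<not> bval (Less (Const 0) rS) s" if "I M s" for s
      using that by (simp add: I_def env_at_def)
  next
    show "I 0 s" using assms by (auto simp: I_def env_at_def table_def)
  qed (use B2 env_bnd env_at_env in \<open>auto simp: I_def\<close>)
  then show ?thesis by (rule timed_mono) (simp add: I_def env_at_def)
qed

lemma prog:
  "timed cs B prog (init (enc_instance (n, \<Gamma>))) (\<lambda>s. \<exists>r. table M r \<and> result_of s = fst (r (start n + 1)))"
proof -
  let ?start = "isum (map (\<lambda>d. Mul (Mul (Const (int (u0 d))) (ipow (Read (Const 0)) (k0 d))) (ipow rN d)) [0..<D])"
  define Q where "Q s \<longleftrightarrow> env s \<and> flags (length \<Gamma>) s \<and> snd s = (\<lambda>_. (0, 1))" for s :: state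
  define Q' where "Q' s \<longleftrightarrow> env s \<and> fst s (-4) = start n \<and> snd s = (\<lambda>_. (0, 1))" for s :: state
  have 2: "timed cs B set_flags s Q" if "env s \<and> fst s (-3) = 0 \<and> flags 0 s \<and> snd s = (\<lambda>_. (0, 1))" for s
    unfolding Q_def[abs_def] using that by (intro set_flags) auto
  have 3: "timed cs B (Store (Const (-4)) ?start) s (\<lambda>s. Q s \<and> fst s (-4) = start 0)" if "Q s" for s
  proof -
    have "ival ?start s = start 0"
      using env_input[of s] that
      by (simp add: Q_def start_def comp_def interv_sum_list_conv_sum_set_nat atLeast0LessThan)
    then show ?thesis by (intro timed_Store env_bnd)
      (use that bits_start[of 0] in \<open>auto simp only: Q_def ival.simps(1) fst_conv snd_conv fun_upd_same intro!: env_upd flags_upd\<close>)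
  qed
  have 4: "timed cs B (Store (Const (-3)) (Const 1)) s (\<lambda>s. Q s \<and> fst s (-4) = start 0 \<and> fst s (-3) = 1)"
    if "Q s \<and> fst s (-4) = start 0" for s
    using that B_pos unfolding Q_def by (intro timed_Store env_bnd) (auto intro!: env_upd flags_upd bits_le_of_abs)
  have 5: "timed cs B add_evidence s Q'" if "Q s \<and> fst s (-4) = start 0 \<and> fst s (-3) = 1" for s
    unfolding Q'_def[abs_def] using that by (intro add_evidence) (auto simp: Q_def)
  have 6: "timed cs B (Store (Const (-2)) (ipow rN D)) s (\<lambda>s. Q' s \<and> fst s (-2) = int M)" if "Q' s" for s
  proof -
    have M: "ival (ipow rN D) s = int M" using that env_input(3)[of s] by (simp add: Q'_def)
    have "M < B" using B2 by simp
    then have "bits (int M) \<le> B" by (intro bits_le_of_abs) (simp only: abs_of_nat nat_int)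
    then show ?thesis by (intro timed_Store env_bnd)
      (use that in \<open>auto simp only: Q'_def M ival.simps(1) fst_conv snd_conv fun_upd_same fun_upd_other intro!: env_upd\<close>)
  qed
  have 7: "timed cs B fill_table s (\<lambda>s. env s \<and> fst s (-4) = start n \<and> table M (snd s))" if "Q' s \<and> fst s (-2) = int M" for s
    using that by (intro fill_table) (auto simp: Q'_def)
  have 8: "timed cs B (RStore (Const 0) (RRead (Add rI (Const 1)))) s
      (\<lambda>s. \<exists>r. table M r \<and> result_of s = fst (r (start n + 1)))"
    if s: "env s \<and> fst s (-4) = start n \<and> table M (snd s)" for s
  proof -
    have "1 + M * inc_size \<le> B" using B3 unfolding inc_size_def wb_def by simp
    then have "snd (snd s i) \<le> B" for i using s unfolding table_def by (meson order_trans)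
    then show ?thesis using s by (intro timed_RStore env_bnd) (auto simp: result_of_def)
  qed
  show ?thesis unfolding prog_def
    by (rule timed_Seq[OF set_base[OF refl]], rule timed_Seq[OF 2], assumption, rule timed_Seq[OF 3], assumption,
        rule timed_Seq[OF 4], assumption, rule timed_Seq[OF 5], assumption, rule timed_Seq[OF 6], assumption,
        rule timed_Seq[OF 7], assumption, rule 8)
qed

lemma digit_of_code:
  assumes "\<And>d. d < D \<Longrightarrow> m d < N" "d < D"
  shows "digit_of (code N D m) d = m d"
  unfolding digit_of_def by (rule code_digit) (use assms in auto)

text \<open>Only the digits of \<open>m\<close> have to lie below the base. The recursive calls are
  addressed through \<open>code_fire\<close>, which is insensitive to overflow in the fired
  marking.\<close>

lemma table_recursion:
  assumes r: "table M r" and m: "\<And>d. d < D \<Longrightarrow> m d < N"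
  shows "fst (r (int (code N D m) + 1)) =
    (if 0 < m dn then (if fin m then 1 else 0)
     else (\<Sum>t\<leftarrow>ts. if enabled {..<D} t m
       then twt cs t m * fst (r (int (code N D (fire t m)) + 1)) else 0))"
proof -
  let ?S = "code N D m"
  have digit_of: "digit_of ?S d = m d" if "d < D" for d
    by (rule digit_of_code) (use m that in auto)
  have "card_sat (\<lambda>P. digit_of ?S (cp P)) \<kappa> = card_sat (\<lambda>P. m (cp P)) \<kappa>" if "\<kappa> \<in> set \<Gamma>" for \<kappa>
    using wf[OF that] places(2) nv by (cases \<kappa>) (auto simp: digit_of)
  then have f: "fin (digit_of ?S) = fin m" by (auto simp: fin_def)
  have e: "entry r ?S t = (if enabled {..<D} t m
      then twt cs t m * fst (r (int (code N D (fire t m)) + 1)) else 0)" if "t \<in> set ts" for t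
  proof -
    have "enabled {..<D} t (digit_of ?S) = enabled {..<D} t m" by (simp add: enabled_def digit_of)
    moreover have "map (\<lambda>q. real (digit_of ?S q)) (fac t) = map (\<lambda>q. real (m q)) (fac t)"
      using ts[OF that] digit_of by auto
    then have "twt cs t (digit_of ?S) = twt cs t m" unfolding twt_def by (simp only:)
    ultimately show ?thesis by (simp add: entry_def code_fire algebra_simps)
  qed
  have "?S < M" by (rule code_less) (rule m)
  then have "fst (r (int ?S + 1)) = rhs r ?S" using r by (simp add: table_def)
  also have "\<dots> = (if 0 < m dn then (if fin m then 1 else 0) else (\<Sum>t\<leftarrow>ts. entry r ?S t))"
    unfolding rhs_def f digit_of[OF places(1)] by simp
  also have "map (entry r ?S) ts = map (\<lambda>t. if enabled {..<D} t m
      then twt cs t m * fst (r (int (code N D (fire t m)) + 1)) else 0) ts"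
    using e by simp
  finally show ?thesis .
qed

text \<open>The table is abstracted to a function \<open>F\<close> on markings, so that the
  correctness of a concrete net can be argued without codes.\<close>

lemma prog_exec:
  "\<exists>t s F. exec cs prog (init (enc_instance (n, \<Gamma>))) t s \<and> t \<le> time_bound prog B \<and>
     result_of s = F (initial n \<Gamma>) \<and>
     (\<forall>m. (\<forall>d<D. m d < N) \<longrightarrow> F m = (if 0 < m dn then (if fin m then 1 else 0)
        else (\<Sum>t\<leftarrow>ts. if enabled {..<D} t m then twt cs t m * F (fire t m) else 0)))"
proof -
  obtain t s r where "exec cs prog (init (enc_instance (n, \<Gamma>))) t s" "t \<le> time_bound prog B"
    "table M r" "result_of s = fst (r (start n + 1))"
    using prog unfolding timed_def runs_def by blast
  then show ?thesis using table_recursion[of r]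
    by (intro exI[of _ t] exI[of _ s] exI[of _ "\<lambda>m. fst (r (int (code N D m) + 1))"])
      (auto simp only: start_n)
qed

end

section \<open>Polynomial running time\<close>

context net begin

theorem net_polytime:
  assumes nv: "nv = length V"
    and wl: "\<And>t. t \<in> set ts \<Longrightarrow> set (wl t) \<subseteq> {..<length cs}"
    and bounded: "\<And>n \<Gamma> d. (n, \<Gamma>) \<in> wf_instances V \<Longrightarrow> d < D \<Longrightarrow> initial n \<Gamma> d < base n"
  shows "\<exists>c. \<exists>p :: nat poly. \<forall>n \<Gamma>. (n, \<Gamma>) \<in> wf_instances V \<longrightarrow>
    (\<exists>t s F. exec cs c (init (enc_instance (n, \<Gamma>))) t s \<and> t \<le> poly p (instance_size (n, \<Gamma>)) \<and>
     result_of s = F (initial n \<Gamma>) \<and>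
     (\<forall>m. (\<forall>d<D. m d < base n) \<longrightarrow> F m =
        (if 0 < m dn then (if \<forall>\<kappa>\<in>set \<Gamma>. card_sat (\<lambda>P. m (cp P)) \<kappa> then 1 else 0)
         else (\<Sum>t\<leftarrow>ts. if enabled {..<D} t m then twt cs t m * F (fire t m) else 0))))"
proof -
  define wc where "wc = (\<Sum>t\<leftarrow>ts. length (wl t) + length (fac t))"
  \<comment> \<open>The sum of the quantities required by \<open>B1\<close>, \<open>B2\<close> and
    \<open>B3\<close>, with the instance size in place of \<open>n\<close>, the number of
    constraints and the bit lengths of the input.\<close>
  define Bf where "Bf x = (x + x + 3 + base x ^ D) +
    Suc (Suc (base x ^ D) * (wc * Suc (base x) + (length ts + 3)))" for x
  have "polynomial base" unfolding base_def by (intro polynomial_intros)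
  then have "polynomial Bf" unfolding Bf_def by (intro polynomial_intros)
  then have "polynomial (\<lambda>x. time_bound prog (Bf x))" by (rule polynomial_comp[OF polynomial_time_bound])
  then obtain p where p: "\<And>x. time_bound prog (Bf x) = poly p x" unfolding polynomial_def by blast
  have mono: "base x \<le> base y" if "x \<le> y" for x y
    unfolding base_def using that by (intro mult_left_mono power_mono) auto
  show ?thesis
  proof (intro exI[of _ prog] exI[of _ p] allI impI)
    fix n \<Gamma> assume inst: "(n, \<Gamma>) \<in> wf_instances V"
    define sz where "sz = instance_size (n, \<Gamma>)"
    have sz: "sz = n + (\<Sum>x\<leftarrow>enc_instance (n, \<Gamma>). bits x)" by (simp add: sz_def)
    have len: "length xs \<le> (\<Sum>x\<leftarrow>xs. bits x)" for xs
    proof (induction xs)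
      case (Cons x xs)
      then show ?case using bits_pos[of x] by simp
    qed simp
    have "length \<Gamma> \<le> length (enc_instance (n, \<Gamma>))" using length_concat_enc[of \<Gamma>] by simp
    then have L: "length \<Gamma> \<le> sz" using len[of "enc_instance (n, \<Gamma>)"] unfolding sz by linarith
    have n: "n \<le> sz" by (simp add: sz)
    have b: "base n ^ D \<le> base sz ^ D" using mono[OF n] by (rule power_mono) simp
    interpret net_instance D ts dn cp nv el evp u0 k0 C K V cs n \<Gamma> "Bf sz"
    proof (unfold_locales, goal_cases)
      case (6 x)
      then have "bits x \<le> (\<Sum>x\<leftarrow>enc_instance (n, \<Gamma>). bits x)" by (intro member_le_sum_list) auto
      then show ?case unfolding Bf_def sz by linarith
    next
      case 7
      then show ?case using L n b by (simp add: Bf_def)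
    next
      case 8
      have "Suc (base n ^ D) * (wc * Suc (base n) + (length ts + 3)) \<le>
          Suc (base sz ^ D) * (wc * Suc (base sz) + (length ts + 3))"
        using b mono[OF n] by (intro mult_mono add_mono) auto
      then show ?case unfolding Bf_def wc_def[symmetric] by (simp only: add.assoc)
    qed (use nv wl bounded inst in \<open>auto simp: wf_instances_def\<close>)
    show "\<exists>t s F. exec cs prog (init (enc_instance (n, \<Gamma>))) t s \<and> t \<le> poly p (instance_size (n, \<Gamma>)) \<and>
     result_of s = F (initial n \<Gamma>) \<and>
     (\<forall>m. (\<forall>d<D. m d < base n) \<longrightarrow> F m =
        (if 0 < m dn then (if \<forall>\<kappa>\<in>set \<Gamma>. card_sat (\<lambda>P. m (cp P)) \<kappa> then 1 else 0)
         else (\<Sum>t\<leftarrow>ts. if enabled {..<D} t m then twt cs t m * F (fire t m) else 0)))"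
      using prog_exec unfolding fin_def sz_def[symmetric] p .
  qed
qed

end

section \<open>Evaluating formulas relative to guessed truth values\<close>

text \<open>Only the quantifier \<open>ExistsGe\<close> survives, so that every quantified
  subformula is decided by comparing one count with one threshold, and a counter may be capped
  there.\<close>

primrec nf :: "fm \<Rightarrow> fm" where
  "nf (Atom P vs) = Atom P vs"
| "nf (Equal x y) = Equal x y"
| "nf (Neg \<phi>) = Neg (nf \<phi>)"
| "nf (Conj \<phi> \<psi>) = Conj (nf \<phi>) (nf \<psi>)"
| "nf (Disj \<phi> \<psi>) = Neg (Conj (Neg (nf \<phi>)) (Neg (nf \<psi>)))"
| "nf (Forall x \<phi>) = Neg (ExistsGe 1 x (Neg (nf \<phi>)))"
| "nf (Exists x \<phi>) = ExistsGe 1 x (nf \<phi>)"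
| "nf (ExistsEq k x \<phi>) = Conj (ExistsGe k x (nf \<phi>)) (Neg (ExistsGe (Suc k) x (nf \<phi>)))"
| "nf (ExistsLe k x \<phi>) = Neg (ExistsGe (Suc k) x (nf \<phi>))"
| "nf (ExistsGe k x \<phi>) = ExistsGe k x (nf \<phi>)"

lemma one_le_card_iff: "finite A \<Longrightarrow> 1 \<le> card {a\<in>A. P a} \<longleftrightarrow> (\<exists>a\<in>A. P a)"
  by (auto simp: Suc_le_eq card_gt_0_iff)

lemma sat_nf: "sat n \<omega> e (nf \<phi>) = sat n \<omega> e \<phi>"
proof (induction \<phi> arbitrary: e)
  case (Forall x \<phi>)
  show ?case unfolding nf.simps sat.simps Forall one_le_card_iff[OF finite_atLeastAtMost] by blast
next
  case (Exists x \<phi>)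
  show ?case unfolding nf.simps sat.simps Exists one_le_card_iff[OF finite_atLeastAtMost] by blast
qed auto

lemma wf_nf: "wf_fm V (nf \<phi>) = wf_fm V \<phi>"
  by (induction \<phi>) auto

lemma fv_nf: "fv (nf \<phi>) = fv \<phi>"
  by (induction \<phi>) auto

primrec is_nf :: "fm \<Rightarrow> bool" where
  "is_nf (Atom P vs) = True"
| "is_nf (Equal x y) = True"
| "is_nf (Neg \<phi>) = is_nf \<phi>"
| "is_nf (Conj \<phi> \<psi>) = (is_nf \<phi> \<and> is_nf \<psi>)"
| "is_nf (Disj \<phi> \<psi>) = False"
| "is_nf (Forall x \<phi>) = False"
| "is_nf (Exists x \<phi>) = False"
| "is_nf (ExistsEq k x \<phi>) = False"
| "is_nf (ExistsLe k x \<phi>) = False"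
| "is_nf (ExistsGe k x \<phi>) = is_nf \<phi>"

lemma is_nf_nf: "is_nf (nf \<phi>)"
  by (induction \<phi>) auto

primrec other :: "var \<Rightarrow> var" where
  "other X = Y"
| "other Y = X"

lemma var_cases: "z = x \<or> z = other x"
  by (cases x; cases z) auto

lemma UNIV_var: "UNIV = {X, Y}"
  using var.exhaust by auto

text \<open>A quantified subformula is not evaluated but looked up in the guess \<open>g\<close>, at the value of its
  only free variable.\<close>

primrec ev :: "(nat \<times> 'a list) set \<Rightarrow> ('a \<Rightarrow> fm set) \<Rightarrow> (var \<Rightarrow> 'a) \<Rightarrow> fm \<Rightarrow> bool" where
  "ev \<omega> g e (Atom P vs) \<longleftrightarrow> (P, map e vs) \<in> \<omega>"
| "ev \<omega> g e (Equal x y) \<longleftrightarrow> e x = e y"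
| "ev \<omega> g e (Neg \<phi>) \<longleftrightarrow> \<not> ev \<omega> g e \<phi>"
| "ev \<omega> g e (Conj \<phi> \<psi>) \<longleftrightarrow> ev \<omega> g e \<phi> \<and> ev \<omega> g e \<psi>"
| "ev \<omega> g e (Disj \<phi> \<psi>) \<longleftrightarrow> False"
| "ev \<omega> g e (Forall x \<phi>) \<longleftrightarrow> False"
| "ev \<omega> g e (Exists x \<phi>) \<longleftrightarrow> False"
| "ev \<omega> g e (ExistsEq k x \<phi>) \<longleftrightarrow> False"
| "ev \<omega> g e (ExistsLe k x \<phi>) \<longleftrightarrow> False"
| "ev \<omega> g e (ExistsGe k x \<phi>) \<longleftrightarrow> ExistsGe k x \<phi> \<in> g (e (other x))"

primrec qs :: "fm \<Rightarrow> fm set" where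
  "qs (Atom P vs) = {}"
| "qs (Equal x y) = {}"
| "qs (Neg \<phi>) = qs \<phi>"
| "qs (Conj \<phi> \<psi>) = qs \<phi> \<union> qs \<psi>"
| "qs (Disj \<phi> \<psi>) = {}"
| "qs (Forall x \<phi>) = {}"
| "qs (Exists x \<phi>) = {}"
| "qs (ExistsEq k x \<phi>) = {}"
| "qs (ExistsLe k x \<phi>) = {}"
| "qs (ExistsGe k x \<phi>) = insert (ExistsGe k x \<phi>) (qs \<phi>)"

lemma finite_qs: "finite (qs \<phi>)"
  by (induction \<phi>) auto

lemma qs_wf: "wf_fm V \<phi> \<Longrightarrow> \<theta> \<in> qs \<phi> \<Longrightarrow> wf_fm V \<theta>"
  by (induction \<phi>) auto

lemma qs_ExistsGe: "\<theta> \<in> qs \<phi> \<Longrightarrow> \<exists>k x \<psi>. \<theta> = ExistsGe k x \<psi>"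
  by (induction \<phi>) auto

fun threshold :: "fm \<Rightarrow> nat" where
  "threshold (ExistsGe k x \<psi>) = k"
| "threshold _ = 0"

text \<open>The contribution of \<open>b\<close> to the count that decides a quantified formula at \<open>a\<close>.\<close>

fun contrib :: "(nat \<times> 'a list) set \<Rightarrow> ('a \<Rightarrow> fm set) \<Rightarrow> 'a \<Rightarrow> 'a \<Rightarrow> fm \<Rightarrow> nat" where
  "contrib \<omega> g a b (ExistsGe k x \<psi>) = (if ev \<omega> g (\<lambda>z. if z = x then b else a) \<psi> then 1 else 0)"
| "contrib \<omega> g a b _ = 0"

text \<open>With quantified subformulas looked up, evaluation sees only the atoms over the range of
  the assignment, which has at most two elements, and the guesses there; so it is invariant under
  isomorphisms of that small part.\<close>

lemma ev_map:
  assumes "wf_fm V \<phi>" "inj_on f (range e)"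
    and "\<And>P as. P < length V \<Longrightarrow> length as = V ! P \<Longrightarrow> set as \<subseteq> range e \<Longrightarrow>
      (P, as) \<in> \<omega> \<longleftrightarrow> (P, map f as) \<in> \<omega>'"
    and "\<And>v. g (e v) = g' (f (e v))"
  shows "ev \<omega> g e \<phi> \<longleftrightarrow> ev \<omega>' g' (\<lambda>v. f (e v)) \<phi>"
  using assms(1)
proof (induction \<phi>)
  case (Atom P vs)
  then show ?case using assms(3)[of P "map e vs"] by (auto simp: comp_def)
next
  case (Equal x y)
  then show ?case using assms(2) by (auto simp: inj_on_def)
qed (use assms(4) in auto)

lemma contrib_map:
  assumes "wf_fm V \<theta>" "inj_on f {a, b}"
    and at: "\<And>P as. P < length V \<Longrightarrow> length as = V ! P \<Longrightarrow> set as \<subseteq> {a, b} \<Longrightarrow>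
      (P, as) \<in> \<omega> \<longleftrightarrow> (P, map f as) \<in> \<omega>'"
    and "g a = g' (f a)" "g b = g' (f b)"
  shows "contrib \<omega> g a b \<theta> = contrib \<omega>' g' (f a) (f b) \<theta>"
proof (cases \<theta>)
  case (ExistsGe k x \<psi>)
  let ?e = "\<lambda>z. if z = x then b else a"
  have "ev \<omega> g ?e \<psi> \<longleftrightarrow> ev \<omega>' g' (\<lambda>z. f (?e z)) \<psi>"
  proof (rule ev_map)
    show "inj_on f (range ?e)" using assms(2) by (rule inj_on_subset) auto
    show "(P, as) \<in> \<omega> \<longleftrightarrow> (P, map f as) \<in> \<omega>'"
      if "P < length V" "length as = V ! P" "set as \<subseteq> range ?e" for P as
      using that by (intro at) auto
  qed (use assms ExistsGe in auto)
  moreover have "(\<lambda>z. f (?e z)) = (\<lambda>z. if z = x then f b else f a)" by auto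
  ultimately show ?thesis using ExistsGe by simp
qed auto

text \<open>The constant assignment is adequate because a formula that begins with a quantifier has
  at most one free variable.\<close>

definition truths :: "fm set \<Rightarrow> nat \<Rightarrow> world \<Rightarrow> nat \<Rightarrow> fm set" where
  "truths \<Theta> n \<omega> a = {\<theta>\<in>\<Theta>. sat n \<omega> (\<lambda>_. a) \<theta>}"

lemma ev_truths:
  assumes "is_nf \<phi>" "qs \<phi> \<subseteq> \<Theta>" "\<And>v. g (e v) = truths \<Theta> n \<omega> (e v)"
  shows "ev \<omega> g e \<phi> \<longleftrightarrow> sat n \<omega> e \<phi>"
  using assms(1,2)
proof (induction \<phi>)
  case (ExistsGe k x \<phi>)
  have "sat n \<omega> (\<lambda>_. e (other x)) (ExistsGe k x \<phi>) \<longleftrightarrow> sat n \<omega> e (ExistsGe k x \<phi>)"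
    by (rule sat_cong_fv) (use var_cases[of _ x] in auto)
  then show ?case using assms(3) ExistsGe.prems(2) by (auto simp: truths_def simp del: sat.simps)
qed auto

lemma sum_contrib:
  "finite A \<Longrightarrow> (\<Sum>b\<in>A. contrib \<omega> g a b (ExistsGe k x \<psi>)) =
    card {b\<in>A. ev \<omega> g (\<lambda>z. if z = x then b else a) \<psi>}"
  by (simp add: sum.If_cases Int_def)

text \<open>If the guess agrees with the counts that it induces, then it is the truth.\<close>

lemma ev_consistent:
  assumes "is_nf \<phi>" "qs \<phi> \<subseteq> \<Theta>" "\<And>v. e v \<in> {1..n}"
    and cons: "\<And>a \<theta>. a \<in> {1..n} \<Longrightarrow> \<theta> \<in> \<Theta> \<Longrightarrow>
      \<theta> \<in> g a \<longleftrightarrow> threshold \<theta> \<le> (\<Sum>b\<in>{1..n}. contrib \<omega> g a b \<theta>)"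
  shows "ev \<omega> g e \<phi> \<longleftrightarrow> sat n \<omega> e \<phi>"
  using assms(1-3)
proof (induction \<phi> arbitrary: e)
  case (ExistsGe k x \<phi>)
  \<comment> \<open>With two variables, an assignment is determined by its values at
    \<open>x\<close> and \<open>other x\<close>.\<close>
  have e: "(\<lambda>z. if z = x then b else e (other x)) = e(x := b)" for b
    using var_cases[of _ x] by (auto simp: fun_eq_iff)
  have "ev \<omega> g (e(x := b)) \<phi> \<longleftrightarrow> sat n \<omega> (e(x := b)) \<phi>" if "b \<in> {1..n}" for b
    by (rule ExistsGe.IH) (use ExistsGe.prems that in auto)
  then have "{b\<in>{1..n}. ev \<omega> g (e(x := b)) \<phi>} = {b\<in>{1..n}. sat n \<omega> (e(x := b)) \<phi>}" by blast
  moreover have "ev \<omega> g e (ExistsGe k x \<phi>) \<longleftrightarrow>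
      k \<le> (\<Sum>b\<in>{1..n}. contrib \<omega> g (e (other x)) b (ExistsGe k x \<phi>))"
    using cons[of "e (other x)" "ExistsGe k x \<phi>"] ExistsGe.prems by simp
  ultimately show ?case by (simp add: sum_contrib e del: contrib.simps fun_upd_apply One_nat_def)
qed auto

text \<open>The converse of \<open>ev_consistent\<close>: the true guess passes the test, so no
  model is lost, while \<open>ev_consistent\<close> ensures that no other guess passes.\<close>

lemma truths_consistent:
  assumes "\<theta> \<in> qs \<phi>" "is_nf \<phi>" "qs \<phi> \<subseteq> \<Theta>" "a \<in> {1..n}"
    and "\<And>b. b \<in> {1..n} \<Longrightarrow> g b = truths \<Theta> n \<omega> b"
  shows "\<theta> \<in> g a \<longleftrightarrow> threshold \<theta> \<le> (\<Sum>b\<in>{1..n}. contrib \<omega> g a b \<theta>)"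
  using assms(1-3)
proof (induction \<phi>)
  case (ExistsGe k x \<phi>)
  show ?case
  proof (cases "\<theta> = ExistsGe k x \<phi>")
    case True
    have "ev \<omega> g (\<lambda>z. if z = x then b else a) \<phi> \<longleftrightarrow> sat n \<omega> (\<lambda>z. if z = x then b else a) \<phi>"
      if "b \<in> {1..n}" for b
      by (rule ev_truths) (use ExistsGe.prems assms(4,5) that in auto)
    then have "{b\<in>{1..n}. ev \<omega> g (\<lambda>z. if z = x then b else a) \<phi>} =
        {b\<in>{1..n}. sat n \<omega> ((\<lambda>_. a)(x := b)) \<phi>}" by (auto simp: fun_upd_def)
    then show ?thesis using True assms(4,5) ExistsGe.prems(3)
      by (simp add: sum_contrib truths_def del: contrib.simps fun_upd_apply One_nat_def)
  qed (use ExistsGe in auto)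
qed auto

section \<open>The net that counts models\<close>

type_synonym cls = "(nat \<times> var list) set \<times> fm set \<times> (fm \<Rightarrow> nat)"

text \<open>
  A class consists of the 1-type (in the variable \<open>X\<close>), the guess and the capped counters of an element.

  While the net runs, \<open>Free P\<close> counts the undecided and \<open>Crd P\<close> the true atoms of \<open>P\<close>, and \<open>Ev e\<close> the
  elements with evidence \<open>e\<close> that are still to be added.  The places \<open>El p c\<close> count the elements of
  class \<open>c\<close>; when an element is being added, pairing it with an earlier one moves a token from parity \<open>p\<close>
  to \<open>\<not> p\<close>, and the next round uses \<open>\<not> p\<close>, so that no token has to be moved back.  The
  argument \<open>\<sigma>\<close> of \<open>Idle\<close> is the set of true atoms of arity 0.
\<close>

datatype place =
    Time | Start | Done
  | Idle "(nat \<times> var list) set" bool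
  | Adding bool cls
  | El bool cls
  | Crd nat
  | Free nat
  | Ev "nat set"

datatype lab =
    LNull "(nat \<times> var list) set"
  | LNew "(nat \<times> var list) set" bool "nat set" "(nat \<times> var list) set" "fm set"
  | LPair bool cls cls "(nat \<times> var list) set"
  | LFin bool cls
  | LRest "(nat \<times> var list) set" bool nat bool
  | LDone "(nat \<times> var list) set" bool

text \<open>In the markings that occur, exactly one control place carries a token, and every
  transition consumes it; so runs are sequential.\<close>

primrec is_ctl :: "place \<Rightarrow> bool" where
  "is_ctl Time = False"
| "is_ctl Start = True"
| "is_ctl Done = True"
| "is_ctl (Idle \<sigma> p) = True"
| "is_ctl (Adding p c) = True"
| "is_ctl (El p c) = False"
| "is_ctl (Crd P) = False"
| "is_ctl (Free P) = False"
| "is_ctl (Ev e) = False"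

text \<open>The transition that decides the atoms with pattern in \<open>Q\<close>, those in \<open>\<xi>\<close> positively.\<close>

definition decide_tr :: "nat \<Rightarrow> place \<Rightarrow> place \<Rightarrow> place set \<Rightarrow> place set \<Rightarrow> (place \<Rightarrow> bool) \<Rightarrow>
    (nat \<times> var list) set \<Rightarrow> (nat \<times> var list) set \<Rightarrow> place list \<Rightarrow> place ptrans" where
  "decide_tr nv ctl ctl' extra extra' inhs Q \<xi> fc = PTrans
     (\<lambda>q. (if q = ctl \<or> q \<in> extra then 1 else 0) + (case q of Free P \<Rightarrow> card {x\<in>Q. fst x = P} | _ \<Rightarrow> 0))
     inhs
     (\<lambda>q. (if q = ctl' \<or> q = Time \<or> q \<in> extra' then 1 else 0) +
        (case q of Crd P \<Rightarrow> card {x\<in>\<xi>. fst x = P} | _ \<Rightarrow> 0))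
     (map (\<lambda>x. if x \<in> \<xi> then fst x else nv + fst x) (SOME xs. distinct xs \<and> set xs = Q))
     fc"

definition toY :: "(nat \<times> var list) set \<Rightarrow> (nat \<times> var list) set" where
  "toY t = (\<lambda>x. (fst x, map (\<lambda>_. Y) (snd x))) ` t"

text \<open>A structure on the two points \<open>X\<close> and \<open>Y\<close>, assembled from the
  1-type of the first, that of the second, and the atoms that mention both.\<close>

definition pair_world :: "(nat \<times> var list) set \<Rightarrow> (nat \<times> var list) set \<Rightarrow> (nat \<times> var list) set \<Rightarrow>
    (nat \<times> var list) set" where
  "pair_world s t \<tau> = s \<union> toY t \<union> \<tau>"

locale sentence =
  fixes V :: vocabulary and R :: nat and \<phi> :: fm
  assumes wf_phi: "wf_fm V \<phi>" and nf_phi: "is_nf \<phi>" and fv_phi: "fv \<phi> = {}"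
    and R: "R < length V" "V ! R = 2"
begin

definition \<Theta> :: "fm set" where "\<Theta> = qs \<phi>"

definition PX :: "(nat \<times> var list) set" where
  "PX = (\<lambda>P. (P, replicate (V ! P) X)) ` {..<length V}"

definition P0 :: "(nat \<times> var list) set" where "P0 = {x\<in>PX. snd x = []}"
definition P1 :: "(nat \<times> var list) set" where "P1 = {x\<in>PX. snd x \<noteq> []}"

text \<open>The patterns of atoms over exactly two elements, of any arity: repeated arguments are
  allowed as long as both variables occur.\<close>

definition P2 :: "(nat \<times> var list) set" where
  "P2 = {x. fst x < length V \<and> length (snd x) = V ! fst x \<and> set (snd x) = {X, Y}}"

definition classes :: "cls set" where
  "classes = Pow PX \<times> Pow \<Theta> \<times> {f. \<forall>\<theta>. (\<theta> \<in> \<Theta> \<longrightarrow> f \<theta> \<in> {..threshold \<theta>}) \<and> (\<theta> \<notin> \<Theta> \<longrightarrow> f \<theta> = 0)}"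

definition lit_sets :: "nat set set" where "lit_sets = Pow {..<2 * length V}"

text \<open>The order in which the earlier elements are paired with a new one.\<close>

definition num :: "cls \<Rightarrow> nat" where "num = (SOME f. inj_on f classes)"

text \<open>Saturating addition of a contribution to the counters.\<close>

definition bump :: "(fm \<Rightarrow> nat) \<Rightarrow> (fm \<Rightarrow> nat) \<Rightarrow> fm \<Rightarrow> nat" where
  "bump f d \<theta> = (if \<theta> \<in> \<Theta> then min (threshold \<theta>) (f \<theta> + d \<theta>) else 0)"

text \<open>A new element is its own first potential witness, so the counters start with the pair of
  the element with itself.\<close>

definition new_cls :: "(nat \<times> var list) set \<Rightarrow> fm set \<Rightarrow> cls" where
  "new_cls t \<gamma> = (t, \<gamma>, bump (\<lambda>_. 0) (contrib t (\<lambda>_. \<gamma>) X X))"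

definition upd_new :: "cls \<Rightarrow> cls \<Rightarrow> (nat \<times> var list) set \<Rightarrow> cls" where
  "upd_new c d \<tau> = (fst c, fst (snd c), bump (snd (snd c))
     (contrib (pair_world (fst c) (fst d) \<tau>) (case_var (fst (snd c)) (fst (snd d))) X Y))"

definition upd_old :: "cls \<Rightarrow> cls \<Rightarrow> (nat \<times> var list) set \<Rightarrow> cls" where
  "upd_old c d \<tau> = (fst d, fst (snd d), bump (snd (snd d))
     (contrib (pair_world (fst c) (fst d) \<tau>) (case_var (fst (snd c)) (fst (snd d))) Y X))"

text \<open>The guess agrees with the capped counters, and the sentence evaluates to true under it.
  The sentence is closed, so it can be tested at any element.\<close>

definition good :: "cls \<Rightarrow> bool" where
  "good c \<longleftrightarrow> (\<forall>\<theta>\<in>\<Theta>. \<theta> \<in> fst (snd c) \<longleftrightarrow> snd (snd c) \<theta> = threshold \<theta>) \<and>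
     ev (fst c) (\<lambda>_. fst (snd c)) (\<lambda>_. X) \<phi>"

definition compat :: "nat set \<Rightarrow> (nat \<times> var list) set \<Rightarrow> bool" where
  "compat e t \<longleftrightarrow> (\<forall>P<length V. V ! P = 1 \<longrightarrow>
     (2 * P \<in> e \<longrightarrow> (P, [X]) \<in> t) \<and> (2 * P + 1 \<in> e \<longrightarrow> (P, [X]) \<notin> t))"

text \<open>The factor \<open>Ev e\<close> in \<open>LNew\<close> chooses which waiting element is
  added. The inhibitors of \<open>LPair\<close> and \<open>LRest\<close> fix the order of classes
  and of predicates, so that one model is not counted along several runs. \<open>LFin\<close>
  recovers the nullary atoms from the 1-type of the new element.\<close>

primrec transition :: "lab \<Rightarrow> place ptrans" where
  "transition (LNull \<sigma>) = decide_tr (length V) Start (Idle \<sigma> False) {} {} (\<lambda>_. False) P0 \<sigma> []"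
| "transition (LNew \<sigma> p e t \<gamma>) = decide_tr (length V) (Idle \<sigma> p) (Adding p (new_cls (t \<union> \<sigma>) \<gamma>))
     {Ev e} {} (\<lambda>_. False) P1 t [Ev e]"
| "transition (LPair p c d \<tau>) = decide_tr (length V) (Adding p c) (Adding p (upd_new c d \<tau>))
     {El p d} {El (\<not> p) (upd_old c d \<tau>)} (\<lambda>q. \<exists>d'\<in>classes. q = El p d' \<and> num d' < num d) P2 \<tau> []"
| "transition (LFin p c) = decide_tr (length V) (Adding p c) (Idle {x\<in>fst c. snd x = []} (\<not> p))
     {} {El (\<not> p) c} (\<lambda>q. \<exists>d\<in>classes. q = El p d) {} {} []"
| "transition (LRest \<sigma> p P b) = decide_tr (length V) (Idle \<sigma> p) (Idle \<sigma> p) {} {}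
     (\<lambda>q. (\<exists>e\<in>lit_sets. q = Ev e) \<or> (\<exists>P'<P. q = Free P')) {(P, [])} (if b then {(P, [])} else {}) []"
| "transition (LDone \<sigma> p) = decide_tr (length V) (Idle \<sigma> p) Done {} {}
     (\<lambda>q. (\<exists>e\<in>lit_sets. q = Ev e) \<or> (\<exists>P. q = Free P) \<or> (\<exists>d. \<not> good d \<and> q = El p d)) {} {} []"

text \<open>The order axiom is built in here: \<open>R\<close> is reflexive at each new element, and
  in a pair the earlier element \<open>Y\<close> precedes the new element \<open>X\<close> but not
  conversely. Transitivity follows from insertion along the order.\<close>

definition labels :: "lab set" where
  "labels = LNull ` Pow P0 \<union>
     (\<lambda>(\<sigma>, p, e, t, \<gamma>). LNew \<sigma> p e t \<gamma>) ` (Pow P0 \<times> UNIV \<times>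
       {(e, t, \<gamma>). e \<in> lit_sets \<and> t \<subseteq> P1 \<and> \<gamma> \<subseteq> \<Theta> \<and> (R, [X, X]) \<in> t \<and> compat e t}) \<union>
     (\<lambda>(p, c, d, \<tau>). LPair p c d \<tau>) ` (UNIV \<times> classes \<times> classes \<times>
       {\<tau>. \<tau> \<subseteq> P2 \<and> (R, [Y, X]) \<in> \<tau> \<and> (R, [X, Y]) \<notin> \<tau>}) \<union>
     (\<lambda>(p, c). LFin p c) ` (UNIV \<times> classes) \<union>
     (\<lambda>(\<sigma>, p, P, b). LRest \<sigma> p P b) ` (Pow P0 \<times> UNIV \<times> {..<length V} \<times> UNIV) \<union>
     (\<lambda>(\<sigma>, p). LDone \<sigma> p) ` (Pow P0 \<times> UNIV)"

definition net_places :: "place set" where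
  "net_places = {Start, Done} \<union> (\<lambda>(\<sigma>, p). Idle \<sigma> p) ` (Pow P0 \<times> UNIV) \<union>
     (\<lambda>(p, c). Adding p c) ` (UNIV \<times> classes) \<union> (\<lambda>(p, c). El p c) ` (UNIV \<times> classes) \<union>
     Crd ` {..<length V} \<union> Free ` {..<length V} \<union> Ev ` lit_sets \<union> {Time}"

lemma finite_PX: "finite PX" by (simp add: PX_def)

lemma finite_P0: "finite P0" and finite_P1: "finite P1"
  using finite_PX by (simp_all add: P0_def P1_def)

lemma finite_P2: "finite P2"
proof -
  have "P2 \<subseteq> (\<Union>P<length V. Pair P ` {vs. set vs \<subseteq> {X, Y} \<and> length vs = V ! P})"
    by (auto simp: P2_def)
  then show ?thesis by (rule finite_subset) (auto intro: finite_lists_length_eq)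
qed

lemma finite_Theta: "finite \<Theta>" by (simp add: \<Theta>_def finite_qs)

lemma finite_classes: "finite classes"
proof -
  \<comment> \<open>The thresholds vary with the formula, whereas the finiteness of a set of
    finitely supported functions is available for a common range.\<close>
  let ?m = "Max (insert 0 (threshold ` \<Theta>))"
  have "{f. \<forall>\<theta>. (\<theta> \<in> \<Theta> \<longrightarrow> f \<theta> \<in> {..threshold \<theta>}) \<and> (\<theta> \<notin> \<Theta> \<longrightarrow> f \<theta> = 0)} \<subseteq>
      {f. \<forall>\<theta>. (\<theta> \<in> \<Theta> \<longrightarrow> f \<theta> \<in> {..?m}) \<and> (\<theta> \<notin> \<Theta> \<longrightarrow> f \<theta> = 0)}"
  proof -
    have "threshold \<theta> \<le> ?m" if "\<theta> \<in> \<Theta>" for \<theta>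
      using finite_Theta that by (intro Max_ge) auto
    then show ?thesis by (fastforce intro: order_trans)
  qed
  moreover have "finite \<dots>" by (rule finite_set_of_finite_funs) (auto simp: finite_Theta)
  ultimately have "finite {f. \<forall>\<theta>. (\<theta> \<in> \<Theta> \<longrightarrow> f \<theta> \<in> {..threshold \<theta>}) \<and> (\<theta> \<notin> \<Theta> \<longrightarrow> f \<theta> = 0)}"
    by (rule finite_subset)
  then show ?thesis unfolding classes_def using finite_PX finite_Theta by (intro finite_cartesian_product) auto
qed

lemma finite_lit_sets: "finite lit_sets" by (simp add: lit_sets_def)

lemma num: "inj_on num classes"
proof -
  have "\<exists>f :: cls \<Rightarrow> nat. inj_on f classes" using finite_imp_inj_to_nat_seg[OF finite_classes] by blast
  then show ?thesis unfolding num_def by (rule someI_ex)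
qed

lemma finite_labels: "finite labels"
proof -
  have "finite (lit_sets \<times> Pow P1 \<times> Pow \<Theta>)" using finite_lit_sets finite_P1 finite_Theta by auto
  then have "finite {(e, t, \<gamma>). e \<in> lit_sets \<and> t \<subseteq> P1 \<and> \<gamma> \<subseteq> \<Theta> \<and> (R, [X, X]) \<in> t \<and> compat e t}"
    by (rule finite_subset[rotated]) auto
  moreover have "finite {\<tau>. \<tau> \<subseteq> P2 \<and> (R, [Y, X]) \<in> \<tau> \<and> (R, [X, Y]) \<notin> \<tau>}"
    by (rule finite_subset[of _ "Pow P2"]) (auto simp: finite_P2)
  ultimately show ?thesis unfolding labels_def using finite_P0 finite_classes by auto
qed

lemma finite_net_places: "finite net_places"
  unfolding net_places_def using finite_P0 finite_classes finite_lit_sets by auto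

lemma fst_P: "x \<in> P0 \<Longrightarrow> fst x < length V" "x \<in> P1 \<Longrightarrow> fst x < length V" "x \<in> P2 \<Longrightarrow> fst x < length V"
  by (auto simp: P0_def P1_def P2_def PX_def)

end

section \<open>Weighted sums over the completions of a partial world\<close>

definition wt :: "(nat \<Rightarrow> real) \<Rightarrow> (nat \<Rightarrow> real) \<Rightarrow> (nat \<times> 'a) set \<Rightarrow> (nat \<times> 'a) set \<Rightarrow> real" where
  "wt w w' S \<xi> = (\<Prod>x\<in>S. if x \<in> \<xi> then w (fst x) else w' (fst x))"

lemma wt_image:
  assumes "inj_on \<iota> Q" "\<And>x. fst (\<iota> x) = fst x" "\<xi> \<subseteq> Q"
  shows "wt w w' (\<iota> ` Q) (\<iota> ` \<xi>) = wt w w' Q \<xi>"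
  unfolding wt_def prod.reindex[OF assms(1)] comp_def
  using assms by (intro prod.cong refl) (simp add: inj_on_image_mem_iff)

lemma wt_cong: "(\<And>x. x \<in> S \<Longrightarrow> x \<in> \<xi> \<longleftrightarrow> x \<in> \<xi>') \<Longrightarrow> wt w w' S \<xi> = wt w w' S \<xi>'"
  unfolding wt_def by (intro prod.cong) auto

definition inst1 :: "nat \<Rightarrow> nat \<times> var list \<Rightarrow> atom" where
  "inst1 a x = (fst x, map (\<lambda>_. a) (snd x))"

definition inst2 :: "nat \<Rightarrow> nat \<Rightarrow> nat \<times> var list \<Rightarrow> atom" where
  "inst2 a b x = (fst x, map (case_var a b) (snd x))"

lemma fst_inst [simp]: "fst (inst1 a x) = fst x" "fst (inst2 a b x) = fst x"
  by (simp_all add: inst1_def inst2_def)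

lemma inj_inst2:
  assumes "a \<noteq> b"
  shows "inj (inst2 a b)"
proof -
  have "inj (case_var a b)" using assms by (auto simp: inj_def split: var.splits)
  then show ?thesis by (auto simp: inj_def inst2_def prod_eq_iff)
qed

text \<open>The atoms in \<open>A\<close> are decided as in \<open>\<omega>0\<close>, and their
  weight is left out, so that deciding further atoms splits off a factor.\<close>

definition completions :: "atom set \<Rightarrow> (nat \<Rightarrow> real) \<Rightarrow> (nat \<Rightarrow> real) \<Rightarrow> atom set \<Rightarrow> world \<Rightarrow>
    (world \<Rightarrow> bool) \<Rightarrow> real" where
  "completions U w w' A \<omega>0 C = (\<Sum>\<omega> | \<omega> \<subseteq> U \<and> \<omega> \<inter> A = \<omega>0 \<and> C \<omega>. wt w w' (U - A) \<omega>)"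

lemma completions_cong:
  "(\<And>\<omega>. \<omega> \<subseteq> U \<Longrightarrow> \<omega> \<inter> A = \<omega>0 \<Longrightarrow> C \<omega> \<longleftrightarrow> C' \<omega>) \<Longrightarrow>
    completions U w w' A \<omega>0 C = completions U w w' A \<omega>0 C'"
  unfolding completions_def by (rule sum.cong) auto

lemma completions_False:
  "(\<And>\<omega>. \<omega> \<subseteq> U \<Longrightarrow> \<omega> \<inter> A = \<omega>0 \<Longrightarrow> \<not> C \<omega>) \<Longrightarrow> completions U w w' A \<omega>0 C = 0"
  unfolding completions_def by (rule sum.neutral) auto

text \<open>One branching step: the worlds are grouped by the truth values of the instances of
  \<open>Q\<close>. Weights depend only on the predicate, so the factor can be read off the
  patterns.\<close>

lemma completions_decide:
  assumes "finite U" "A \<subseteq> U" "\<omega>0 \<subseteq> A"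
    and "inj_on \<iota> Q" "\<And>x. fst (\<iota> x) = fst x" "\<iota> ` Q \<subseteq> U - A"
  shows "completions U w w' A \<omega>0 C =
    (\<Sum>\<xi>\<in>Pow Q. wt w w' Q \<xi> * completions U w w' (A \<union> \<iota> ` Q) (\<omega>0 \<union> \<iota> ` \<xi>) C)"
proof -
  let ?X = "\<iota> ` Q"
  let ?S = "{\<omega>. \<omega> \<subseteq> U \<and> \<omega> \<inter> A = \<omega>0 \<and> C \<omega>}"
  have finS: "finite ?S" using assms(1) by (auto intro: finite_subset[of _ "Pow U"])
  have finX: "finite ?X" using assms(1,6) by (auto intro: finite_subset)
  have part: "(\<Sum>\<omega>\<in>{\<omega>\<in>?S. \<omega> \<inter> ?X = \<xi>}. wt w w' (U - A) \<omega>) =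
      wt w w' ?X \<xi> * completions U w w' (A \<union> ?X) (\<omega>0 \<union> \<xi>) C" if "\<xi> \<in> Pow ?X" for \<xi>
  proof -
    have 1: "wt w w' (U - A) \<omega> = wt w w' ?X \<xi> * wt w w' (U - (A \<union> ?X)) \<omega>" if "\<omega> \<inter> ?X = \<xi>" for \<omega>
    proof -
      have "U - A = ?X \<union> (U - (A \<union> ?X))" using assms(6) by blast
      then have "wt w w' (U - A) \<omega> = wt w w' (?X \<union> (U - (A \<union> ?X))) \<omega>" by simp
      also have "\<dots> = wt w w' ?X \<omega> * wt w w' (U - (A \<union> ?X)) \<omega>"
        unfolding wt_def by (rule prod.union_disjoint) (use assms(1) finX in auto)
      also have "wt w w' ?X \<omega> = wt w w' ?X \<xi>" by (rule wt_cong) (use that in blast)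
      finally show ?thesis .
    qed
    have 2: "{\<omega>\<in>?S. \<omega> \<inter> ?X = \<xi>} = {\<omega>. \<omega> \<subseteq> U \<and> \<omega> \<inter> (A \<union> ?X) = \<omega>0 \<union> \<xi> \<and> C \<omega>}"
    proof -
      have "\<omega> \<inter> (A \<union> ?X) = \<omega>0 \<union> \<xi> \<longleftrightarrow> \<omega> \<inter> A = \<omega>0 \<and> \<omega> \<inter> ?X = \<xi>" for \<omega>
        using assms(3,6) that by blast
      then show ?thesis by auto
    qed
    have "(\<Sum>\<omega>\<in>{\<omega>\<in>?S. \<omega> \<inter> ?X = \<xi>}. wt w w' (U - A) \<omega>) =
        (\<Sum>\<omega>\<in>{\<omega>\<in>?S. \<omega> \<inter> ?X = \<xi>}. wt w w' ?X \<xi> * wt w w' (U - (A \<union> ?X)) \<omega>)"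
      using 1 by (intro sum.cong refl) blast
    then show ?thesis unfolding 2 completions_def sum_distrib_left .
  qed
  have "completions U w w' A \<omega>0 C =
      (\<Sum>\<xi>\<in>Pow ?X. \<Sum>\<omega>\<in>{\<omega>\<in>?S. \<omega> \<inter> ?X = \<xi>}. wt w w' (U - A) \<omega>)"
    unfolding completions_def by (rule sum.group[symmetric]) (use finS finX in auto)
  also have "\<dots> = (\<Sum>\<xi>\<in>Pow ?X. wt w w' ?X \<xi> * completions U w w' (A \<union> ?X) (\<omega>0 \<union> \<xi>) C)"
    by (intro sum.cong refl part)
  also have "\<dots> = (\<Sum>\<xi>\<in>Pow Q. wt w w' ?X (\<iota> ` \<xi>) * completions U w w' (A \<union> ?X) (\<omega>0 \<union> \<iota> ` \<xi>) C)"
  proof -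
    have "bij_betw (image \<iota>) (Pow Q) (Pow ?X)" using assms(4) by (simp add: bij_betw_Pow inj_on_imp_bij_betw)
    then show ?thesis by (rule sum.reindex_bij_betw[symmetric])
  qed
  also have "\<dots> = (\<Sum>\<xi>\<in>Pow Q. wt w w' Q \<xi> * completions U w w' (A \<union> ?X) (\<omega>0 \<union> \<iota> ` \<xi>) C)"
    by (intro sum.cong refl) (simp add: wt_image assms)
  finally show ?thesis .
qed

lemma completions_split:
  assumes "finite U" "finite I" "\<And>\<omega>. \<omega> \<subseteq> U \<Longrightarrow> \<omega> \<inter> A = \<omega>0 \<Longrightarrow> C \<omega> \<Longrightarrow> \<exists>!i. i \<in> I \<and> D i \<omega>"
  shows "completions U w w' A \<omega>0 C = (\<Sum>i\<in>I. completions U w w' A \<omega>0 (\<lambda>\<omega>. C \<omega> \<and> D i \<omega>))"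
proof -
  let ?S = "{\<omega>. \<omega> \<subseteq> U \<and> \<omega> \<inter> A = \<omega>0 \<and> C \<omega>}"
  have finS: "finite ?S" using assms(1) by (auto intro: finite_subset[of _ "Pow U"])
  define f where "f \<omega> = (THE i. i \<in> I \<and> D i \<omega>)" for \<omega>
  have f: "f \<omega> \<in> I" "i \<in> I \<Longrightarrow> D i \<omega> \<longleftrightarrow> f \<omega> = i" if "\<omega> \<in> ?S" for \<omega> i
  proof -
    have ex: "\<exists>!i. i \<in> I \<and> D i \<omega>" using assms(3) that by auto
    have "f \<omega> \<in> I \<and> D (f \<omega>) \<omega>" unfolding f_def by (rule theI'[OF ex])
    then show "f \<omega> \<in> I" "i \<in> I \<Longrightarrow> D i \<omega> \<longleftrightarrow> f \<omega> = i" using ex by auto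
  qed
  have "completions U w w' A \<omega>0 C = (\<Sum>i\<in>I. \<Sum>\<omega>\<in>{\<omega>\<in>?S. f \<omega> = i}. wt w w' (U - A) \<omega>)"
    unfolding completions_def by (rule sum.group[symmetric]) (use finS assms(2) f(1) in auto)
  also have "\<dots> = (\<Sum>i\<in>I. completions U w w' A \<omega>0 (\<lambda>\<omega>. C \<omega> \<and> D i \<omega>))"
    unfolding completions_def using f(2) by (intro sum.cong refl) auto
  finally show ?thesis .
qed

lemma decide_tr_sel: "pre (decide_tr nv c c' x x' h Q \<xi> fc) =
     (\<lambda>q. (if q = c \<or> q \<in> x then 1 else 0) + (case q of Free P \<Rightarrow> card {x\<in>Q. fst x = P} | _ \<Rightarrow> 0))"
  "inh (decide_tr nv c c' x x' h Q \<xi> fc) = h"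
  "post (decide_tr nv c c' x x' h Q \<xi> fc) = (\<lambda>q. (if q = c' \<or> q = Time \<or> q \<in> x' then 1 else 0) +
        (case q of Crd P \<Rightarrow> card {x\<in>\<xi>. fst x = P} | _ \<Rightarrow> 0))"
  "fac (decide_tr nv c c' x x' h Q \<xi> fc) = fc"
  by (simp_all add: decide_tr_def)

text \<open>\<open>decide_tr\<close> lists \<open>Q\<close> in an arbitrary order; by commutativity
  the product is the weight of the decision.\<close>

lemma twt_decide_tr:
  assumes "finite Q" "\<And>x. x \<in> Q \<Longrightarrow> fst x < nv"
  shows "twt (map w [0..<nv] @ map w' [0..<nv]) (decide_tr nv c c' x x' h Q \<xi> fc) m =
    wt w w' Q \<xi> * (\<Prod>q\<leftarrow>fc. real (m q))"
proof -
  define xs where "xs = (SOME xs. distinct xs \<and> set xs = Q)"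
  have "distinct xs \<and> set xs = Q" unfolding xs_def
    by (rule someI_ex) (use finite_distinct_list[OF assms(1)] in blast)
  then have xs: "distinct xs" "set xs = Q" by auto
  have "map (\<lambda>x. (map w [0..<nv] @ map w' [0..<nv]) ! (if x \<in> \<xi> then fst x else nv + fst x)) xs =
      map (\<lambda>x. if x \<in> \<xi> then w (fst x) else w' (fst x)) xs"
    using assms(2) xs(2) by (auto simp: nth_append)
  then have "(\<Prod>j\<leftarrow>map (\<lambda>x. if x \<in> \<xi> then fst x else nv + fst x) xs. (map w [0..<nv] @ map w' [0..<nv]) ! j) =
      (\<Prod>x\<leftarrow>xs. if x \<in> \<xi> then w (fst x) else w' (fst x))"
    by (simp only: map_map comp_def)
  also have "\<dots> = wt w w' Q \<xi>"
    unfolding wt_def xs(2)[symmetric] prod.distinct_set_conv_list[OF xs(1)] ..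
  finally show ?thesis by (simp add: twt_def decide_tr_def xs_def[symmetric])
qed

section \<open>Types and classes of elements\<close>

context sentence begin

lemma in_PX: "(P, vs) \<in> PX \<longleftrightarrow> P < length V \<and> vs = replicate (V ! P) X"
  by (auto simp: PX_def)

lemma inj_inst1: "inj_on (inst1 a) PX"
  by (auto simp: inj_on_def inst1_def PX_def)

definition one_type :: "world \<Rightarrow> nat \<Rightarrow> (nat \<times> var list) set" where
  "one_type \<omega> a = {x\<in>PX. inst1 a x \<in> \<omega>}"

definition two_type :: "world \<Rightarrow> nat \<Rightarrow> nat \<Rightarrow> (nat \<times> var list) set" where
  "two_type \<omega> a b = {x\<in>P2. inst2 a b x \<in> \<omega>}"

lemma in_one_type:
  "(P, vs) \<in> one_type \<omega> a \<longleftrightarrow> P < length V \<and> vs = replicate (V ! P) X \<and> (P, replicate (V ! P) a) \<in> \<omega>"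
  by (auto simp: one_type_def in_PX inst1_def)

lemma in_toY_one_type:
  "(P, vs) \<in> toY (one_type \<omega> a) \<longleftrightarrow> P < length V \<and> vs = replicate (V ! P) Y \<and> (P, replicate (V ! P) a) \<in> \<omega>"
  by (auto simp: toY_def in_one_type image_iff Bex_def)

lemma in_two_type: "(P, vs) \<in> two_type \<omega> a b \<longleftrightarrow>
    P < length V \<and> length vs = V ! P \<and> set vs = {X, Y} \<and> (P, map (case_var a b) vs) \<in> \<omega>"
  by (auto simp: two_type_def P2_def inst2_def)

text \<open>The arguments of an atom over a pair are all \<open>X\<close>, all \<open>Y\<close>, or
  both variables occur. Nullary atoms belong to both 1-types, which agree on them since both come
  from \<open>\<omega>\<close>.\<close>

lemma in_pair_world:
  assumes "P < length V" "length vs = V ! P"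
  shows "(P, vs) \<in> pair_world (one_type \<omega> a) (one_type \<omega> b) (two_type \<omega> a b) \<longleftrightarrow> (P, map (case_var a b) vs) \<in> \<omega>"
proof -
  have "set vs \<subseteq> {X, Y}" using UNIV_var by blast
  then consider "set vs \<subseteq> {X}" | "set vs \<subseteq> {Y}" | "set vs = {X, Y}" by blast
  then show ?thesis
  proof cases
    case 1
    then have "vs = replicate (V ! P) X" using assms(2) by (intro replicate_eqI) auto
    then show ?thesis using assms
      by (cases "V ! P") (auto simp: pair_world_def in_one_type in_toY_one_type in_two_type)
  next
    case 2
    then have "vs = replicate (V ! P) Y" using assms(2) by (intro replicate_eqI) auto
    then show ?thesis using assms
      by (cases "V ! P") (auto simp: pair_world_def in_one_type in_toY_one_type in_two_type)
  next
    case 3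
    then have "vs \<noteq> replicate (V ! P) X" "vs \<noteq> replicate (V ! P) Y"
      by (auto simp: set_replicate_conv_if split: if_splits)
    then show ?thesis using assms 3 by (auto simp: pair_world_def in_one_type in_toY_one_type in_two_type)
  qed
qed

lemma wf_Theta: "\<theta> \<in> \<Theta> \<Longrightarrow> wf_fm V \<theta>"
  unfolding \<Theta>_def by (rule qs_wf[OF wf_phi])

lemma in_one_type_map:
  assumes "P < length V" "length vs = V ! P" "set vs \<subseteq> {X}"
  shows "(P, vs) \<in> one_type \<omega> a \<longleftrightarrow> (P, map (\<lambda>_. a) vs) \<in> \<omega>"
proof -
  have "vs = replicate (V ! P) X" using assms by (intro replicate_eqI) auto
  then show ?thesis using assms(1) by (simp add: in_one_type)
qed

lemma contrib_one_type:
  assumes "\<theta> \<in> \<Theta>"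
  shows "contrib (one_type \<omega> a) (\<lambda>_. g a) X X \<theta> = contrib \<omega> g a a \<theta>"
  using contrib_map[OF wf_Theta[OF assms], of "\<lambda>_. a" X X "one_type \<omega> a" \<omega> "\<lambda>_. g a" g] in_one_type_map by simp

lemma ev_one_type: "ev (one_type \<omega> a) (\<lambda>_. g a) (\<lambda>_. X) \<phi> = ev \<omega> g (\<lambda>_. a) \<phi>"
  using ev_map[OF wf_phi, of "\<lambda>_. a" "\<lambda>_. X" "one_type \<omega> a" \<omega> "\<lambda>_. g a" g] in_one_type_map by simp

text \<open>For distinct elements \<open>case_var a b\<close> is an isomorphism onto the part of
  \<open>\<omega>\<close> over the pair. Hence two classes and a 2-type determine how the counters
  change, without knowledge of the elements.\<close>

lemma contrib_pair:
  assumes "\<theta> \<in> \<Theta>" "a \<noteq> b"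
  shows "contrib (pair_world (one_type \<omega> a) (one_type \<omega> b) (two_type \<omega> a b)) (case_var (g a) (g b)) X Y \<theta> =
      contrib \<omega> g a b \<theta>"
    and "contrib (pair_world (one_type \<omega> a) (one_type \<omega> b) (two_type \<omega> a b)) (case_var (g a) (g b)) Y X \<theta> =
      contrib \<omega> g b a \<theta>"
proof -
  let ?\<omega> = "pair_world (one_type \<omega> a) (one_type \<omega> b) (two_type \<omega> a b)"
  have "contrib ?\<omega> (case_var (g a) (g b)) u v \<theta> = contrib \<omega> g (case_var a b u) (case_var a b v) \<theta>" for u v
    by (rule contrib_map[OF wf_Theta[OF assms(1)]])
      (use assms(2) in \<open>auto simp: in_pair_world inj_on_def split: var.splits\<close>)
  from this[of X Y] this[of Y X]
  show "contrib ?\<omega> (case_var (g a) (g b)) X Y \<theta> = contrib \<omega> g a b \<theta>"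
    "contrib ?\<omega> (case_var (g a) (g b)) Y X \<theta> = contrib \<omega> g b a \<theta>" by simp_all
qed

text \<open>\<open>B\<close> is the set of elements, including \<open>a\<close> itself, with which
  \<open>a\<close> has been compared so far.\<close>

definition cls :: "world \<Rightarrow> (nat \<Rightarrow> fm set) \<Rightarrow> nat set \<Rightarrow> nat \<Rightarrow> cls" where
  "cls \<omega> g B a = (one_type \<omega> a, g a, \<lambda>\<theta>. if \<theta> \<in> \<Theta> then min (threshold \<theta>) (\<Sum>b\<in>B. contrib \<omega> g a b \<theta>) else 0)"

lemma new_cls: "new_cls (one_type \<omega> a) (g a) = cls \<omega> g {a} a"
  by (auto simp: new_cls_def cls_def bump_def contrib_one_type)

text \<open>Capping commutes with later additions:
  \<open>min k (min k s + d) = min k (s + d)\<close> for natural numbers.\<close>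

lemma upd_new:
  assumes "finite B" "b \<notin> B" "a \<noteq> b"
  shows "upd_new (cls \<omega> g B a) (cls \<omega> g B' b) (two_type \<omega> a b) = cls \<omega> g (insert b B) a"
  using assms by (auto simp: upd_new_def cls_def bump_def contrib_pair fun_eq_iff)

lemma upd_old:
  assumes "finite B'" "a \<notin> B'" "a \<noteq> b"
  shows "upd_old (cls \<omega> g B a) (cls \<omega> g B' b) (two_type \<omega> a b) = cls \<omega> g (insert a B') b"
  using assms by (auto simp: upd_old_def cls_def bump_def contrib_pair fun_eq_iff)

lemma cls_in_classes: "g a \<subseteq> \<Theta> \<Longrightarrow> cls \<omega> g B a \<in> classes"
  by (auto simp: cls_def classes_def one_type_def)

text \<open>The counters look at pairs that contain \<open>a\<close> only, so atoms over other pairs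
  or over larger sets may change freely.\<close>

lemma cls_cong:
  assumes "\<And>x P as. x \<in> insert a B \<Longrightarrow> set as \<subseteq> {a, x} \<Longrightarrow> (P, as) \<in> \<omega> \<longleftrightarrow> (P, as) \<in> \<omega>'"
    and "\<And>x. x \<in> insert a B \<Longrightarrow> g x = g' x"
  shows "cls \<omega> g B a = cls \<omega>' g' B a"
proof -
  have "contrib \<omega> g a b \<theta> = contrib \<omega>' g' a b \<theta>" if "b \<in> B" "\<theta> \<in> \<Theta>" for b \<theta>
  proof -
    have "contrib \<omega> g a b \<theta> = contrib \<omega>' g' ((\<lambda>x. x) a) ((\<lambda>x. x) b) \<theta>"
      by (rule contrib_map[OF wf_Theta[OF that(2)]]) (use assms(1)[of b] assms(2) that(1) in auto)
    then show ?thesis by simp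
  qed
  moreover have "one_type \<omega> a = one_type \<omega>' a"
  proof -
    have "set (replicate k a) \<subseteq> {a}" for k by (auto simp: set_replicate_conv_if)
    then show ?thesis unfolding one_type_def inst1_def using assms(1)[of a] by (auto simp: PX_def)
  qed
  ultimately show ?thesis using assms(2)[of a] by (auto simp: cls_def intro!: sum.cong)
qed

end

section \<open>Correctness of the net\<close>

text \<open>\<open>F\<close> is any function with the recursion of the table, assumed only where no
  place overflows. The bound on \<open>N\<close> leaves room for twice as many steps as there are
  ground atoms, plus a constant.\<close>

locale counting = sentence +
  fixes n :: nat and \<Gamma> :: "constr list" and w w' :: "nat \<Rightarrow> real" and N :: nat
    and F :: "(place \<Rightarrow> nat) \<Rightarrow> real"
  assumes n: "1 \<le> n"
    and wf: "\<And>\<kappa>. \<kappa> \<in> set \<Gamma> \<Longrightarrow> wf_constr V n \<kappa>"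
    and N: "2 * card (ground_atoms V n) + 5 < N"
    and rec: "\<And>m. (\<And>q. q \<in> net_places \<Longrightarrow> m q < N) \<Longrightarrow> F m =
       (if 0 < m Done then (if \<forall>\<kappa>\<in>set \<Gamma>. card_sat (\<lambda>P. m (Crd P)) \<kappa> then 1 else 0)
        else (\<Sum>l\<in>labels. if enabled net_places (transition l) m
          then twt (map w [0..<length V] @ map w' [0..<length V]) (transition l) m * F (fire (transition l) m) else 0))"
begin

abbreviation "U \<equiv> ground_atoms V n"
abbreviation "weight m l \<equiv> twt (map w [0..<length V] @ map w' [0..<length V]) (transition l) m"
abbreviation "cpl A \<omega> C \<equiv> completions U w w' A \<omega> C"

lemma in_U: "x \<in> U \<longleftrightarrow> fst x < length V \<and> length (snd x) = V ! fst x \<and> set (snd x) \<subseteq> {1..n}"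
  by (cases x) (simp add: ground_atoms_def)

lemma finite_U: "finite U" by (rule finite_ground_atoms)

lemma R_in_U: "a \<in> {1..n} \<Longrightarrow> b \<in> {1..n} \<Longrightarrow> (R, [a, b]) \<in> U"
  using R by (simp add: in_U)

text \<open>The atoms \<open>R(a, a)\<close> alone suffice. Hence a bound by the number of ground
  atoms also covers numbers of elements.\<close>

lemma n_le_U: "n \<le> card U"
proof -
  have "card ((\<lambda>a. (R, [a, a])) ` {1..n}) \<le> card U"
    by (rule card_mono[OF finite_U]) (auto intro!: R_in_U)
  moreover have "card ((\<lambda>a. (R, [a, a])) ` {1..n}) = n"
    by (subst card_image) (auto simp: inj_on_def)
  ultimately show ?thesis by simp
qed

lemma inst1_P0: "inst1 a ` P0 = {x\<in>U. snd x = []}"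
proof -
  have "(P, []) \<in> inst1 a ` P0" if "P < length V" "V ! P = 0" for P
    using that by (intro image_eqI[of _ _ "(P, [])"]) (auto simp: inst1_def P0_def in_PX)
  then show ?thesis by (auto simp: P0_def PX_def inst1_def in_U)
qed

lemma inst1_P1:
  assumes "a \<in> {1..n}"
  shows "inst1 a ` P1 = {x\<in>U. set (snd x) = {a}}"
proof
  show "inst1 a ` P1 \<subseteq> {x\<in>U. set (snd x) = {a}}" using assms by (auto simp: P1_def PX_def inst1_def in_U)
  show "{x\<in>U. set (snd x) = {a}} \<subseteq> inst1 a ` P1"
  proof
    fix x assume "x \<in> {x\<in>U. set (snd x) = {a}}"
    then have x: "fst x < length V" "length (snd x) = V ! fst x" "set (snd x) = {a}" by (auto simp: in_U)
    have "snd x = replicate (V ! fst x) a" using x by (intro replicate_eqI) auto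
    moreover have "V ! fst x \<noteq> 0" using x by (cases "snd x") auto
    ultimately show "x \<in> inst1 a ` P1" using x
      by (intro image_eqI[of _ _ "(fst x, replicate (V ! fst x) X)"]) (auto simp: inst1_def P1_def in_PX prod_eq_iff)
  qed
qed

lemma inst2_P2:
  assumes "a \<in> {1..n}" "b \<in> {1..n}" "a \<noteq> b"
  shows "inst2 a b ` P2 = {x\<in>U. set (snd x) = {a, b}}"
proof
  show "inst2 a b ` P2 \<subseteq> {x\<in>U. set (snd x) = {a, b}}" using assms by (auto simp: P2_def inst2_def in_U)
  show "{x\<in>U. set (snd x) = {a, b}} \<subseteq> inst2 a b ` P2"
  proof
    fix x assume "x \<in> {x\<in>U. set (snd x) = {a, b}}"
    then have x: "fst x < length V" "length (snd x) = V ! fst x" "set (snd x) = {a, b}" by (auto simp: in_U)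
    let ?vs = "map (\<lambda>z. if z = a then X else Y) (snd x)"
    have "map (case_var a b) ?vs = map (\<lambda>z. z) (snd x)"
      unfolding map_map by (rule map_cong) (use x(3) in auto)
    moreover have "set ?vs = {X, Y}" using x(3) assms(3) by auto
    ultimately show "x \<in> inst2 a b ` P2" using x
      by (intro image_eqI[of _ _ "(fst x, ?vs)"]) (auto simp: inst2_def P2_def prod_eq_iff)
  qed
qed

definition marking :: "place \<Rightarrow> atom set \<Rightarrow> world \<Rightarrow> nat set \<Rightarrow> (bool \<Rightarrow> cls \<Rightarrow> nat) \<Rightarrow> nat \<Rightarrow> place \<Rightarrow> nat" where
  "marking ctl A \<omega> B el \<tau> q = (case q of Time \<Rightarrow> \<tau> | El p c \<Rightarrow> el p c | Crd P \<Rightarrow> card {x\<in>\<omega>. fst x = P}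
     | Free P \<Rightarrow> card {x\<in>U - A. fst x = P} | Ev e \<Rightarrow> card {a\<in>B. evt \<Gamma> a = e} | _ \<Rightarrow> if q = ctl then 1 else 0)"

lemma marking_bounded:
  assumes "A \<subseteq> U" "\<omega> \<subseteq> A" "B \<subseteq> {1..n}" "\<And>p c. el p c \<le> n" "\<tau> < N"
  shows "marking ctl A \<omega> B el \<tau> q < N"
proof -
  have 1: "card {x\<in>\<omega>. fst x = P} < N" for P
    using card_mono[OF finite_U, of "{x\<in>\<omega>. fst x = P}"] assms(1,2) N by fastforce
  have 2: "card {x\<in>U - A. fst x = P} < N" for P
    using card_mono[OF finite_U, of "{x\<in>U - A. fst x = P}"] N by fastforce
  have "card {a\<in>B. evt \<Gamma> a = e} \<le> n" for e
    using card_mono[of "{1..n}" "{a\<in>B. evt \<Gamma> a = e}"] assms(3) by fastforce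
  have 3: "card {a\<in>B. evt \<Gamma> a = e} < N" for e using n_le_U N \<open>card {a\<in>B. evt \<Gamma> a = e} \<le> n\<close> by linarith
  have 4: "el p c < N" for p c
    using n_le_U N assms(4)[of p c] by linarith
  show ?thesis using 1 2 3 4 assms(5) N by (auto simp: marking_def split: place.splits)
qed

text \<open>One computation for all kinds of transitions: the instances of \<open>Q\<close> are
  distinct undecided atoms, so the numbers read off the patterns are the true changes of
  \<open>Free\<close> and \<open>Crd\<close>. The hypotheses \<open>B\<close> and \<open>el\<close>
  leave the bookkeeping of elements to the individual steps.\<close>

lemma fire_marking:
  assumes ctl: "is_ctl ctl" "is_ctl ctl'"
    and x: "\<And>q. q \<in> x \<union> x' \<Longrightarrow> (\<exists>p c. q = El p c) \<or> (\<exists>e. q = Ev e)"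
    and Q: "finite Q" "inj_on \<iota> Q" "\<And>y. fst (\<iota> y) = fst y" "\<iota> ` Q \<subseteq> U - A" "\<xi> \<subseteq> Q" "\<omega> \<subseteq> A"
    and \<omega>: "finite \<omega>"
    and B: "\<And>e. card {a\<in>B'. evt \<Gamma> a = e} =
      card {a\<in>B. evt \<Gamma> a = e} - (if Ev e \<in> x then 1 else 0) + (if Ev e \<in> x' then 1 else 0)"
    and el: "\<And>p c. el' p c = el p c - (if El p c \<in> x then 1 else 0) + (if El p c \<in> x' then 1 else 0)"
  shows "fire (decide_tr nv ctl ctl' x x' h Q \<xi> fc) (marking ctl A \<omega> B el \<tau>) =
    marking ctl' (A \<union> \<iota> ` Q) (\<omega> \<union> \<iota> ` \<xi>) B' el' (Suc \<tau>)"
proof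
  have im: "card {y\<in>\<iota> ` S. fst y = P} = card {y\<in>S. fst y = P}" if "S \<subseteq> Q" for S P
  proof -
    have "{y\<in>\<iota> ` S. fst y = P} = \<iota> ` {y\<in>S. fst y = P}" using Q(3) by auto
    moreover have "inj_on \<iota> {y\<in>S. fst y = P}" by (rule inj_on_subset[OF Q(2)]) (use that in auto)
    ultimately show ?thesis by (simp add: card_image)
  qed
  have free: "card {y\<in>U - (A \<union> \<iota> ` Q). fst y = P} = card {y\<in>U - A. fst y = P} - card {y\<in>Q. fst y = P}" for P
  proof -
    have "{y\<in>U - (A \<union> \<iota> ` Q). fst y = P} = {y\<in>U - A. fst y = P} - {y\<in>\<iota> ` Q. fst y = P}" by auto
    then show ?thesis using Q finite_U im[of Q P] by (simp add: card_Diff_subset subset_iff image_iff)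
  qed
  have crd: "card {y\<in>\<omega> \<union> \<iota> ` \<xi>. fst y = P} = card {y\<in>\<omega>. fst y = P} + card {y\<in>\<xi>. fst y = P}" for P
  proof -
    have "{y\<in>\<omega> \<union> \<iota> ` \<xi>. fst y = P} = {y\<in>\<omega>. fst y = P} \<union> {y\<in>\<iota> ` \<xi>. fst y = P}" by auto
    moreover have "finite \<xi>" using Q(1,5) finite_subset by blast
    moreover have "{y\<in>\<omega>. fst y = P} \<inter> {y\<in>\<iota> ` \<xi>. fst y = P} = {}" using Q(4,5,6) by blast
    ultimately show ?thesis using \<omega> im[OF Q(5), of P] by (simp add: card_Un_disjoint)
  qed
  fix q
  have nx: "is_ctl q \<or> q = Time \<or> (\<exists>P. q = Crd P) \<or> (\<exists>P. q = Free P) \<Longrightarrow> q \<notin> x \<and> q \<notin> x'"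
    using x[of q] by (cases q) auto
  show "fire (decide_tr nv ctl ctl' x x' h Q \<xi> fc) (marking ctl A \<omega> B el \<tau>) q =
    marking ctl' (A \<union> \<iota> ` Q) (\<omega> \<union> \<iota> ` \<xi>) B' el' (Suc \<tau>) q"
    using ctl nx
    by (cases q) (simp_all only: fire_def decide_tr_sel marking_def free crd B el place.simps, auto)
qed

lemma F_restrict:
  assumes "\<And>q. q \<in> net_places \<Longrightarrow> m q < N" "m Done = 0" "L \<subseteq> labels"
    and "\<And>l. l \<in> labels \<Longrightarrow> enabled net_places (transition l) m \<Longrightarrow> l \<in> L"
  shows "F m = (\<Sum>l\<in>L. if enabled net_places (transition l) m then weight m l * F (fire (transition l) m) else 0)"
proof -
  have "F m = (\<Sum>l\<in>labels. if enabled net_places (transition l) m then weight m l * F (fire (transition l) m) else 0)"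
    using rec[OF assms(1)] assms(2) by simp
  also have "\<dots> = (\<Sum>l\<in>L. if enabled net_places (transition l) m then weight m l * F (fire (transition l) m) else 0)"
    by (rule sum.mono_neutral_right) (use finite_labels assms(3,4) in auto)
  finally show ?thesis .
qed

end

lemma qs_sub: "\<theta> \<in> qs \<psi> \<Longrightarrow> is_nf \<psi> \<Longrightarrow> is_nf \<theta> \<and> qs \<theta> \<subseteq> qs \<psi>"
  by (induction \<psi>) auto

primrec src :: "lab \<Rightarrow> place" where
  "src (LNull \<sigma>) = Start"
| "src (LNew \<sigma> p e t \<gamma>) = Idle \<sigma> p"
| "src (LPair p c d \<tau>) = Adding p c"
| "src (LFin p c) = Adding p c"
| "src (LRest \<sigma> p P b) = Idle \<sigma> p"
| "src (LDone \<sigma> p) = Idle \<sigma> p"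

lemma (in sentence) in_labels:
  "LNull \<sigma> \<in> labels \<longleftrightarrow> \<sigma> \<subseteq> P0"
  "LNew \<sigma> p e t \<gamma> \<in> labels \<longleftrightarrow>
     \<sigma> \<subseteq> P0 \<and> e \<in> lit_sets \<and> t \<subseteq> P1 \<and> \<gamma> \<subseteq> \<Theta> \<and> (R, [X, X]) \<in> t \<and> compat e t"
  "LPair p c d \<tau> \<in> labels \<longleftrightarrow>
     c \<in> classes \<and> d \<in> classes \<and> \<tau> \<subseteq> P2 \<and> (R, [Y, X]) \<in> \<tau> \<and> (R, [X, Y]) \<notin> \<tau>"
  "LFin p c \<in> labels \<longleftrightarrow> c \<in> classes"
  "LRest \<sigma> p P b \<in> labels \<longleftrightarrow> \<sigma> \<subseteq> P0 \<and> P < length V"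
  "LDone \<sigma> p \<in> labels \<longleftrightarrow> \<sigma> \<subseteq> P0"
  by (cases c; cases d; auto simp: labels_def image_iff Bex_def split_paired_Ex)+

section \<open>The order axiom, invariants and markings\<close>

context counting begin

abbreviation "r \<omega> a b \<equiv> (R, [a, b]) \<in> \<omega>"

text \<open>Stated relative to a set, so that it can be asked of the processed part of a partial
  world.\<close>

definition lo :: "world \<Rightarrow> nat set \<Rightarrow> bool" where
  "lo \<omega> A \<longleftrightarrow> (\<forall>x\<in>A. r \<omega> x x) \<and> (\<forall>x\<in>A. \<forall>y\<in>A. x \<noteq> y \<longrightarrow> (r \<omega> x y \<longleftrightarrow> \<not> r \<omega> y x)) \<and>
     (\<forall>x\<in>A. \<forall>y\<in>A. \<forall>z\<in>A. r \<omega> x y \<longrightarrow> r \<omega> y z \<longrightarrow> r \<omega> x z)"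

lemma LO_lo:
  assumes "\<omega> \<subseteq> U"
  shows "LO R n \<omega> \<longleftrightarrow> lo \<omega> {1..n}"
proof -
  have sub: "digraph_of R \<omega> \<subseteq> {1..n} \<times> {1..n}"
    using assms by (auto simp: digraph_of_def subset_iff in_U)
  have r: "(x, y) \<in> digraph_of R \<omega> \<longleftrightarrow> r \<omega> x y" for x y by (simp add: digraph_of_def)
  have "linear_order_on {1..n} (digraph_of R \<omega>) \<longleftrightarrow> lo \<omega> {1..n}"
  proof
    assume "linear_order_on {1..n} (digraph_of R \<omega>)"
    then have l: "refl_on {1..n} (digraph_of R \<omega>)" "trans (digraph_of R \<omega>)" "antisym (digraph_of R \<omega>)"
      "total_on {1..n} (digraph_of R \<omega>)"
      by (auto simp: linear_order_on_def partial_order_on_def preorder_on_def)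
    have "r \<omega> x x" if "x \<in> {1..n}" for x using refl_onD[OF l(1) that] r by simp
    moreover have "r \<omega> x y \<longleftrightarrow> \<not> r \<omega> y x" if "x \<in> {1..n}" "y \<in> {1..n}" "x \<noteq> y" for x y
      using l(3,4) that unfolding antisym_def total_on_def r by blast
    moreover have "r \<omega> x z" if "r \<omega> x y" "r \<omega> y z" for x y z
      using l(2) that unfolding trans_def r by blast
    ultimately show "lo \<omega> {1..n}" unfolding lo_def by blast
  next
    assume lo: "lo \<omega> {1..n}"
    have dom: "x \<in> {1..n} \<and> y \<in> {1..n}" if "r \<omega> x y" for x y using sub that r by blast
    have "refl_on {1..n} (digraph_of R \<omega>)" using lo sub unfolding refl_on_def r lo_def by blast
    moreover have "trans (digraph_of R \<omega>)"
      using lo dom unfolding trans_def r lo_def by metis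
    moreover have "antisym (digraph_of R \<omega>)"
      using lo dom unfolding antisym_def r lo_def by blast
    moreover have "total_on {1..n} (digraph_of R \<omega>)"
      using lo unfolding total_on_def r lo_def by blast
    ultimately show "linear_order_on {1..n} (digraph_of R \<omega>)"
      using sub by (simp add: linear_order_on_def partial_order_on_def preorder_on_def)
  qed
  then show ?thesis by (simp add: LO_iff_linear_order)
qed

text \<open>Applied to the elements still to be placed, this yields the unique next element and
  hence the unique insertion order of a model.\<close>

lemma lo_min:
  assumes "lo \<omega> A" "finite B" "B \<noteq> {}" "B \<subseteq> A"
  shows "\<exists>!a. a \<in> B \<and> (\<forall>y\<in>B. r \<omega> a y)"
proof -
  have refl: "r \<omega> x x" if "x \<in> A" for x using assms(1) that unfolding lo_def by blast
  have tot: "r \<omega> x y \<longleftrightarrow> \<not> r \<omega> y x" if "x \<in> A" "y \<in> A" "x \<noteq> y" for x y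
    using assms(1) that unfolding lo_def by blast
  have trn: "r \<omega> x z" if "r \<omega> x y" "r \<omega> y z" "x \<in> A" "y \<in> A" "z \<in> A" for x y z
    using assms(1) that unfolding lo_def by blast
  have "\<exists>a\<in>B. \<forall>y\<in>B. r \<omega> a y"
    using assms(2-4)
  proof (induction B rule: finite_ne_induct)
    case (singleton x)
    then show ?case using refl by auto
  next
    case (insert x B)
    then obtain a where a: "a \<in> B" "\<forall>y\<in>B. r \<omega> a y" by auto
    have A: "a \<in> A" "x \<in> A" "B \<subseteq> A" using insert a by auto
    show ?case
    proof (cases "r \<omega> a x")
      case True
      then show ?thesis using a by auto
    next
      case False
      then have "a \<noteq> x" using refl[OF A(1)] by auto
      then have "r \<omega> x a" using tot[OF A(1,2)] False by simp
      then have "r \<omega> x y" if "y \<in> B" for y using trn[of x a y] A a(2) that by auto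
      then show ?thesis using refl[OF A(2)] by auto
    qed
  qed
  moreover have "a = b" if "a \<in> B" "b \<in> B" "r \<omega> a b" "r \<omega> b a" for a b
    using tot[of a b] assms(4) that by auto
  ultimately show ?thesis by blast
qed

definition admissible :: "world \<Rightarrow> bool" where
  "admissible \<omega> \<longleftrightarrow> sat n \<omega> (\<lambda>_. 1) \<phi> \<and> sat_constrs \<omega> \<Gamma> \<and> LO R n \<omega>"

text \<open>Requiring that the guesses are the truth makes the completions for different guesses
  disjoint, which is what prevents overcounting.\<close>

definition cond_idle :: "nat set \<Rightarrow> (nat \<Rightarrow> fm set) \<Rightarrow> world \<Rightarrow> bool" where
  "cond_idle A g \<omega> \<longleftrightarrow> admissible \<omega> \<and> (\<forall>x\<in>A. \<forall>y\<in>{1..n} - A. r \<omega> x y) \<and> (\<forall>b\<in>A. truths \<Theta> n \<omega> b = g b)"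

definition cond_adding :: "nat set \<Rightarrow> nat \<Rightarrow> (nat \<Rightarrow> fm set) \<Rightarrow> world \<Rightarrow> bool" where
  "cond_adding A a g \<omega> \<longleftrightarrow> cond_idle A g \<omega> \<and> (\<forall>y\<in>{1..n} - A. r \<omega> a y) \<and> truths \<Theta> n \<omega> a = g a"

text \<open>The element 1 is a dummy, as patterns in \<open>P0\<close> have no arguments.\<close>

definition nullary :: "world \<Rightarrow> (nat \<times> var list) set" where
  "nullary \<omega> = {x\<in>P0. inst1 1 x \<in> \<omega>}"

text \<open>The processed elements \<open>A\<close> are an initial segment of the order, with classes given by the guess \<open>g\<close>.
  In the second invariant the element \<open>a\<close> is being added and has been paired with the elements of \<open>S\<close>.
  Atoms with three or more elements are never mentioned: they may be decided at any time.\<close>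

definition inv_idle :: "nat set \<Rightarrow> atom set \<Rightarrow> world \<Rightarrow> (nat \<Rightarrow> fm set) \<Rightarrow> bool" where
  "inv_idle A D \<omega> g \<longleftrightarrow> A \<subseteq> {1..n} \<and> D \<subseteq> U \<and> \<omega> \<subseteq> D \<and>
     (\<forall>x\<in>U. card (set (snd x)) \<le> 2 \<longrightarrow> (x \<in> D \<longleftrightarrow> set (snd x) \<subseteq> A)) \<and>
     (\<forall>b\<in>A. g b \<subseteq> \<Theta> \<and> compat (evt \<Gamma> b) (one_type \<omega> b)) \<and> lo \<omega> A"

definition inv_adding :: "nat set \<Rightarrow> nat \<Rightarrow> nat set \<Rightarrow> atom set \<Rightarrow> world \<Rightarrow> (nat \<Rightarrow> fm set) \<Rightarrow> bool" where
  "inv_adding A a S D \<omega> g \<longleftrightarrow> A \<subseteq> {1..n} \<and> a \<in> {1..n} - A \<and> S \<subseteq> A \<and> D \<subseteq> U \<and> \<omega> \<subseteq> D \<and>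
     (\<forall>x\<in>U. card (set (snd x)) \<le> 2 \<longrightarrow> (x \<in> D \<longleftrightarrow>
        set (snd x) \<subseteq> A \<or> set (snd x) = {a} \<or> (\<exists>b\<in>S. set (snd x) = {a, b}))) \<and>
     (\<forall>b\<in>insert a A. g b \<subseteq> \<Theta> \<and> compat (evt \<Gamma> b) (one_type \<omega> b)) \<and> lo \<omega> A \<and>
     r \<omega> a a \<and> (\<forall>b\<in>S. r \<omega> b a \<and> \<not> r \<omega> a b)"

definition idle_marking :: "nat set \<Rightarrow> atom set \<Rightarrow> world \<Rightarrow> (nat \<Rightarrow> fm set) \<Rightarrow> bool \<Rightarrow> nat \<Rightarrow> place \<Rightarrow> nat" where
  "idle_marking A D \<omega> g p = marking (Idle (nullary \<omega>) p) D \<omega> ({1..n} - A)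
     (\<lambda>q c. if q = p then card {b\<in>A. cls \<omega> g A b = c} else 0)"

text \<open>Elements of \<open>A - S\<close> still have parity \<open>p\<close> and counters without
  \<open>a\<close>; those of \<open>S\<close> have the other parity and counters that include
  \<open>a\<close>.\<close>

definition adding_marking :: "nat set \<Rightarrow> nat \<Rightarrow> nat set \<Rightarrow> atom set \<Rightarrow> world \<Rightarrow> (nat \<Rightarrow> fm set) \<Rightarrow> bool \<Rightarrow> nat \<Rightarrow>
    place \<Rightarrow> nat" where
  "adding_marking A a S D \<omega> g p = marking (Adding p (cls \<omega> g (insert a S) a)) D \<omega> ({1..n} - insert a A)
     (\<lambda>q c. if q = p then card {b\<in>A - S. cls \<omega> g A b = c}
        else card {b\<in>S. cls \<omega> g (insert a A) b = c})"

lemma nullary_sub: "nullary \<omega> \<subseteq> P0" by (auto simp: nullary_def)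

lemma one_type_cong:
  assumes "\<And>P as. set as \<subseteq> {a} \<Longrightarrow> (P, as) \<in> \<omega> \<longleftrightarrow> (P, as) \<in> \<omega>'"
  shows "one_type \<omega> a = one_type \<omega>' a"
proof -
  have "set (replicate k a) \<subseteq> {a}" for k by (auto simp: set_replicate_conv_if)
  then show ?thesis unfolding one_type_def inst1_def using assms by (auto simp: PX_def)
qed

lemma nullary_cong: "(\<And>P. (P, []) \<in> \<omega> \<longleftrightarrow> (P, []) \<in> \<omega>') \<Longrightarrow> nullary \<omega> = nullary \<omega>'"
  unfolding nullary_def by (auto simp: P0_def inst1_def)

lemma nullary_loc: "{x\<in>one_type \<omega> a. snd x = []} = nullary \<omega>"
  by (auto simp: one_type_def nullary_def P0_def inst1_def)

lemma PX_split: "PX = P0 \<union> P1" "P0 \<inter> P1 = {}" by (auto simp: P0_def P1_def)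

lemma double_ne: "2 * P \<noteq> Suc (2 * Q)" "Suc (2 * Q) \<noteq> 2 * P"
  by presburger+

lemma evt_lit:
  "2 * P \<in> evt \<Gamma> a \<longleftrightarrow> PosLit P a \<in> set \<Gamma>" "2 * P + 1 \<in> evt \<Gamma> a \<longleftrightarrow> NegLit P a \<in> set \<Gamma>"
proof -
  have *: "is_lit \<kappa> a (2 * P) \<longleftrightarrow> \<kappa> = PosLit P a" "is_lit \<kappa> a (2 * P + 1) \<longleftrightarrow> \<kappa> = NegLit P a" for \<kappa>
    using double_ne by (cases \<kappa>; auto)+
  show "2 * P \<in> evt \<Gamma> a \<longleftrightarrow> PosLit P a \<in> set \<Gamma>" "2 * P + 1 \<in> evt \<Gamma> a \<longleftrightarrow> NegLit P a \<in> set \<Gamma>"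
    unfolding evt_def mem_Collect_eq * by auto
qed

lemma in_one_type_unary: "P < length V \<Longrightarrow> V ! P = 1 \<Longrightarrow> (P, [X]) \<in> one_type \<omega> a \<longleftrightarrow> (P, [a]) \<in> \<omega>"
  by (simp add: in_one_type)

text \<open>The constraints split into conditions on counts, checked at the end of a run, and
  conditions on single 1-types, checked on insertion.\<close>

lemma sat_constrs_iff:
  "sat_constrs \<omega> \<Gamma> \<longleftrightarrow> (\<forall>\<kappa>\<in>set \<Gamma>. card_sat (\<lambda>P. card {x\<in>\<omega>. fst x = P}) \<kappa>) \<and>
     (\<forall>a\<in>{1..n}. compat (evt \<Gamma> a) (one_type \<omega> a))"
proof -
  have "(\<forall>a\<in>{1..n}. compat (evt \<Gamma> a) (one_type \<omega> a)) \<longleftrightarrow>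
      (\<forall>P a. (PosLit P a \<in> set \<Gamma> \<longrightarrow> (P, [a]) \<in> \<omega>) \<and> (NegLit P a \<in> set \<Gamma> \<longrightarrow> (P, [a]) \<notin> \<omega>))"
    (is "?l \<longleftrightarrow> ?r")
  proof
    assume l: ?l
    show ?r
    proof (intro allI conjI impI)
      fix P a assume "PosLit P a \<in> set \<Gamma>"
      moreover from wf[OF this] have "P < length V" "V ! P = 1" "a \<in> {1..n}" by auto
      ultimately show "(P, [a]) \<in> \<omega>" using l in_one_type_unary unfolding compat_def evt_lit by blast
    next
      fix P a assume "NegLit P a \<in> set \<Gamma>"
      moreover from wf[OF this] have "P < length V" "V ! P = 1" "a \<in> {1..n}" by auto
      ultimately show "(P, [a]) \<notin> \<omega>" using l in_one_type_unary unfolding compat_def evt_lit by blast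
    qed
  next
    assume r: ?r
    show ?l unfolding compat_def evt_lit using r in_one_type_unary by auto
  qed
  moreover have "sat_constrs \<omega> \<Gamma> \<longleftrightarrow> (\<forall>\<kappa>\<in>set \<Gamma>. card_sat (\<lambda>P. card {x\<in>\<omega>. fst x = P}) \<kappa>) \<and>
      (\<forall>P a. (PosLit P a \<in> set \<Gamma> \<longrightarrow> (P, [a]) \<in> \<omega>) \<and> (NegLit P a \<in> set \<Gamma> \<longrightarrow> (P, [a]) \<notin> \<omega>))"
  proof -
    have "sat_constr \<omega> \<kappa> \<longleftrightarrow> card_sat (\<lambda>P. card {x\<in>\<omega>. fst x = P}) \<kappa> \<and>
        (\<forall>P a. (\<kappa> = PosLit P a \<longrightarrow> (P, [a]) \<in> \<omega>) \<and> (\<kappa> = NegLit P a \<longrightarrow> (P, [a]) \<notin> \<omega>))" for \<kappa>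
      by (cases \<kappa>) auto
    then show ?thesis unfolding sat_constrs_def by blast
  qed
  ultimately show ?thesis by blast
qed

lemma evt_in_lit_sets: "evt \<Gamma> a \<in> lit_sets"
  unfolding lit_sets_def using evt_subset[of \<Gamma> V n a] wf by auto

lemma idle_marking_bounded:
  assumes "inv_idle A D \<omega> g" "\<tau> < N"
  shows "idle_marking A D \<omega> g p \<tau> q < N"
  unfolding idle_marking_def
proof (rule marking_bounded)
  fix p' c
  have "A \<subseteq> {1..n}" using assms by (simp add: inv_idle_def)
  then have "card {b\<in>A. cls \<omega> g A b = c} \<le> card {1..n}" by (intro card_mono) auto
  then show "(if p' = p then card {b\<in>A. cls \<omega> g A b = c} else 0) \<le> n" by simp
qed (use assms in \<open>auto simp: inv_idle_def\<close>)

lemma adding_marking_bounded: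
  assumes "inv_adding A a S D \<omega> g" "\<tau> < N"
  shows "adding_marking A a S D \<omega> g p \<tau> q < N"
  unfolding adding_marking_def
proof (rule marking_bounded)
  fix p' c
  have A: "A \<subseteq> {1..n}" "S \<subseteq> {1..n}" using assms by (auto simp: inv_adding_def)
  have "card {b\<in>A - S. cls \<omega> g A b = c} \<le> card {1..n}" by (rule card_mono) (use A in auto)
  moreover have "card {b\<in>S. cls \<omega> g (insert a A) b = c} \<le> card {1..n}" by (rule card_mono) (use A in auto)
  ultimately show "(if p' = p then card {b\<in>A - S. cls \<omega> g A b = c}
      else card {b\<in>S. cls \<omega> g (insert a A) b = c}) \<le> n" by simp
qed (use assms in \<open>auto simp: inv_adding_def\<close>)

lemma card_fst_le:
  assumes "inj_on \<iota> Q" "\<And>y. fst (\<iota> y) = fst y" "\<iota> ` Q \<subseteq> U - D"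
  shows "card {x\<in>Q. fst x = P} \<le> card {x\<in>U - D. fst x = P}"
  by (rule card_inj_on_le[of \<iota>]) (use assms finite_U in \<open>auto intro: inj_on_subset\<close>)

text \<open>There are enough \<open>Free\<close> tokens because \<open>\<iota>\<close> embeds the
  patterns into the undecided atoms, and \<open>marking\<close> provides the control token.\<close>

lemma enabled_marking:
  assumes "is_ctl c" "inj_on \<iota> Q" "\<And>y. fst (\<iota> y) = fst y" "\<iota> ` Q \<subseteq> U - D"
    and "\<And>q. q \<in> x \<Longrightarrow> (\<exists>p c. q = El p c) \<or> (\<exists>e. q = Ev e)"
    and "\<And>q. q \<in> x \<Longrightarrow> 0 < marking c D \<omega> B el \<tau> q"
    and "\<And>q. q \<in> net_places \<Longrightarrow> h q \<Longrightarrow> marking c D \<omega> B el \<tau> q = 0"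
  shows "enabled net_places (decide_tr nv c c' x x' h Q \<xi> fc) (marking c D \<omega> B el \<tau>)"
proof -
  have "pre (decide_tr nv c c' x x' h Q \<xi> fc) q \<le> marking c D \<omega> B el \<tau> q" for q
  proof (cases "q \<in> x")
    case True
    then show ?thesis using assms(5)[OF True] assms(6)[OF True] assms(1) by (auto simp: decide_tr_sel)
  next
    case False
    then show ?thesis using assms(1) card_fst_le[OF assms(2-4)]
      by (cases q) (auto simp: decide_tr_sel marking_def)
  qed
  then show ?thesis using assms(7) by (simp add: enabled_def decide_tr_sel)
qed

lemma in_net_places: "Start \<in> net_places" "Time \<in> net_places" "\<sigma> \<subseteq> P0 \<Longrightarrow> Idle \<sigma> p \<in> net_places" "c \<in> classes \<Longrightarrow> Adding p c \<in> net_places"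
  "c \<in> classes \<Longrightarrow> El p c \<in> net_places" "P < length V \<Longrightarrow> Free P \<in> net_places" "e \<in> lit_sets \<Longrightarrow> Ev e \<in> net_places"
  by (auto simp: net_places_def)

lemma enabled_pre: "enabled net_places t m \<Longrightarrow> q \<in> net_places \<Longrightarrow> pre t q \<le> m q"
  by (simp add: enabled_def)

lemma enabled_inh: "enabled net_places t m \<Longrightarrow> q \<in> net_places \<Longrightarrow> inh t q \<Longrightarrow> m q = 0"
  by (simp add: enabled_def)

lemma enabled_src:
  assumes "enabled net_places (transition l) (marking ctl D \<omega> B el \<tau>)" "l \<in> labels"
  shows "src l = ctl"
proof -
  have "src l \<in> net_places" using assms(2) by (cases l) (auto simp: in_labels intro: in_net_places)
  moreover have "is_ctl (src l)" by (cases l) auto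
  moreover have "pre (transition l) (src l) \<ge> 1" by (cases l) (auto simp: decide_tr_sel)
  ultimately have "1 \<le> marking ctl D \<omega> B el \<tau> (src l)" using enabled_pre[OF assms(1)] order_trans by blast
  then show ?thesis using \<open>is_ctl (src l)\<close> by (cases "src l") (auto simp: marking_def split: if_splits)
qed

text \<open>If all classes are good, the guess satisfies the counting equations that it induces and
  is the truth by \<open>ev_consistent\<close>; conversely the truth is consistent. A capped counter
  equals its threshold iff the full count reaches it, so the test on classes is exact.\<close>

lemma final_iff:
  assumes "inv_idle {1..n} D \<omega> g"
  shows "cond_idle {1..n} g \<omega> \<longleftrightarrow> (\<forall>b\<in>{1..n}. good (cls \<omega> g {1..n} b)) \<and>
    (\<forall>\<kappa>\<in>set \<Gamma>. card_sat (\<lambda>P. card {x\<in>\<omega>. fst x = P}) \<kappa>)"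
proof -
  have J: "\<omega> \<subseteq> U" "\<forall>b\<in>{1..n}. g b \<subseteq> \<Theta> \<and> compat (evt \<Gamma> b) (one_type \<omega> b)" "lo \<omega> {1..n}"
    using assms by (auto simp: inv_idle_def)
  let ?cons = "\<lambda>b. \<forall>\<theta>\<in>\<Theta>. \<theta> \<in> g b \<longleftrightarrow> threshold \<theta> \<le> (\<Sum>x\<in>{1..n}. contrib \<omega> g b x \<theta>)"
  have min: "min k s = k \<longleftrightarrow> k \<le> s" for k s :: nat by auto
  have good: "good (cls \<omega> g {1..n} b) \<longleftrightarrow> ?cons b \<and> ev \<omega> g (\<lambda>_. b) \<phi>" for b
    using ev_one_type[of \<omega> b g] by (simp add: good_def cls_def min)
  have closed: "sat n \<omega> (\<lambda>_. b) \<phi> \<longleftrightarrow> sat n \<omega> (\<lambda>_. 1) \<phi>" for b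
    by (rule sat_cong_fv) (simp add: fv_phi)
  have "(\<forall>b\<in>{1..n}. good (cls \<omega> g {1..n} b)) \<longleftrightarrow>
      sat n \<omega> (\<lambda>_. 1) \<phi> \<and> (\<forall>b\<in>{1..n}. truths \<Theta> n \<omega> b = g b)"
  proof
    assume a: "\<forall>b\<in>{1..n}. good (cls \<omega> g {1..n} b)"
    then have cons: "\<forall>b\<in>{1..n}. ?cons b" using good by blast
    have ev: "ev \<omega> g (\<lambda>_. b) \<psi> \<longleftrightarrow> sat n \<omega> (\<lambda>_. b) \<psi>" if "b \<in> {1..n}" "is_nf \<psi>" "qs \<psi> \<subseteq> \<Theta>" for b \<psi>
      by (rule ev_consistent[OF that(2,3)]) (use cons that(1) in auto)
    \<comment> \<open>The sentence is tested only through the classes of elements, so at least one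
      element must exist.\<close>
    have "1 \<in> {1..n}" using n by simp
    then have "sat n \<omega> (\<lambda>_. 1) \<phi>" using a good ev[of 1 \<phi>] nf_phi by (simp add: \<Theta>_def)
    moreover have "truths \<Theta> n \<omega> b = g b" if b: "b \<in> {1..n}" for b
    proof -
      have "\<theta> \<in> g b \<longleftrightarrow> sat n \<omega> (\<lambda>_. b) \<theta>" if \<theta>: "\<theta> \<in> \<Theta>" for \<theta>
      proof -
        have "is_nf \<theta>" "qs \<theta> \<subseteq> \<Theta>" using qs_sub[OF _ nf_phi] \<theta> by (auto simp: \<Theta>_def)
        then have "ev \<omega> g (\<lambda>_. b) \<theta> \<longleftrightarrow> sat n \<omega> (\<lambda>_. b) \<theta>" by (rule ev[OF b])
        moreover obtain k x \<psi> where "\<theta> = ExistsGe k x \<psi>" using qs_ExistsGe \<theta> unfolding \<Theta>_def by blast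
        ultimately show ?thesis by simp
      qed
      then show ?thesis using J(2) b unfolding truths_def by blast
    qed
    ultimately show "sat n \<omega> (\<lambda>_. 1) \<phi> \<and> (\<forall>b\<in>{1..n}. truths \<Theta> n \<omega> b = g b)" by blast
  next
    assume a: "sat n \<omega> (\<lambda>_. 1) \<phi> \<and> (\<forall>b\<in>{1..n}. truths \<Theta> n \<omega> b = g b)"
    have "?cons b" if "b \<in> {1..n}" for b
      using truths_consistent[OF _ nf_phi _ that, of _ \<Theta> g \<omega>] a by (simp add: \<Theta>_def)
    moreover have "ev \<omega> g (\<lambda>_. b) \<phi>" if "b \<in> {1..n}" for b
      using ev_truths[OF nf_phi, of \<Theta> g "\<lambda>_. b" n \<omega>] a that closed[of b] by (simp add: \<Theta>_def)
    ultimately show "\<forall>b\<in>{1..n}. good (cls \<omega> g {1..n} b)" using good by blast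
  qed
  moreover have "LO R n \<omega>" using LO_lo J by simp
  ultimately show ?thesis using J(2) unfolding cond_idle_def admissible_def sat_constrs_iff by auto
qed

text \<open>With all atoms decided, \<open>\<omega>\<close> is the only candidate.
  \<open>LDone\<close> is enabled iff all classes are good, and the value at \<open>Done\<close>
  tests the cardinalities.\<close>

lemma step_done:
  assumes J: "inv_idle {1..n} U \<omega> g" and \<tau>: "\<tau> + 1 < N"
  shows "cpl U \<omega> (cond_idle {1..n} g) = F (idle_marking {1..n} U \<omega> g p \<tau>)"
proof -
  let ?m = "idle_marking {1..n} U \<omega> g p \<tau>"
  let ?l = "LDone (nullary \<omega>) p"
  have \<omega>: "\<omega> \<subseteq> U" and g: "\<And>b. b \<in> {1..n} \<Longrightarrow> g b \<subseteq> \<Theta>" using J by (auto simp: inv_idle_def)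
  have fin: "finite \<omega>" using \<omega> finite_U finite_subset by blast
  have m: "?m (Free P) = 0" "?m (Ev e) = 0" "?m Done = 0" for P e by (auto simp: idle_marking_def marking_def)
  have el: "?m (El p c) = card {b\<in>{1..n}. cls \<omega> g {1..n} b = c}" for c by (simp add: idle_marking_def marking_def)
  have bd: "?m q < N" for q by (rule idle_marking_bounded[OF J]) (use \<tau> in simp)
  have "F ?m = (\<Sum>l\<in>{?l}. if enabled net_places (transition l) ?m then weight ?m l * F (fire (transition l) ?m) else 0)"
  proof (rule F_restrict)
    show "?m q < N" for q by (rule bd)
    show "?m Done = 0" by (rule m(3))
    show "{?l} \<subseteq> labels" using nullary_sub by (simp add: in_labels)
  next
    fix l assume l: "l \<in> labels" and en: "enabled net_places (transition l) ?m"
    have src: "src l = Idle (nullary \<omega>) p" by (rule enabled_src[OF en[unfolded idle_marking_def] l])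
    show "l \<in> {?l}"
    proof (cases l)
      case (LNew \<sigma> q e t \<gamma>)
      then have "e \<in> lit_sets" using l by (simp add: in_labels)
      then show ?thesis using enabled_pre[OF en in_net_places(7)[of e]] m(2)[of e] LNew by (auto simp: decide_tr_sel)
    next
      case (LRest \<sigma> q P b)
      then have "P < length V" using l by (simp add: in_labels)
      then show ?thesis using enabled_pre[OF en in_net_places(6)[of P]] m(1)[of P] LRest by (auto simp: decide_tr_sel)
    qed (use src in auto)
  qed
  also have "\<dots> = (if enabled net_places (transition ?l) ?m then F (fire (transition ?l) ?m) else 0)"
  proof -
    have "weight ?m ?l = 1" unfolding transition.simps by (subst twt_decide_tr) (auto simp: wt_def)
    then show ?thesis by (simp del: transition.simps)
  qed
  also have "enabled net_places (transition ?l) ?m \<longleftrightarrow> (\<forall>b\<in>{1..n}. good (cls \<omega> g {1..n} b))"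
  proof
    assume en: "enabled net_places (transition ?l) ?m"
    show "\<forall>b\<in>{1..n}. good (cls \<omega> g {1..n} b)"
    proof (rule ccontr)
      assume "\<not> ?thesis"
      then obtain b where b: "b \<in> {1..n}" "\<not> good (cls \<omega> g {1..n} b)" by blast
      have "El p (cls \<omega> g {1..n} b) \<in> net_places" using cls_in_classes[of g b] g[OF b(1)] by (intro in_net_places) auto
      then have "?m (El p (cls \<omega> g {1..n} b)) = 0"
        by (rule enabled_inh[OF en]) (use b(2) in \<open>simp add: decide_tr_sel del: split_paired_Ex; blast\<close>)
      moreover have "b \<in> {x\<in>{1..n}. cls \<omega> g {1..n} x = cls \<omega> g {1..n} b}" using b by simp
      moreover have "finite {x\<in>{1..n}. cls \<omega> g {1..n} x = cls \<omega> g {1..n} b}" by simp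
      ultimately show False unfolding el by (metis card_0_eq empty_iff)
    qed
  next
    assume good: "\<forall>b\<in>{1..n}. good (cls \<omega> g {1..n} b)"
    have "?m (El q d) = 0" if "\<not> good d" for q d
    proof -
      have "{b\<in>{1..n}. cls \<omega> g {1..n} b = d} = {}" using good that by blast
      then show ?thesis unfolding idle_marking_def marking_def by (simp only: place.case card.empty if_cancel)
    qed
    then show "enabled net_places (transition ?l) ?m" unfolding transition.simps using m unfolding idle_marking_def
      by (intro enabled_marking[of _ "inst1 1"]) auto
  qed
  also have "F (fire (transition ?l) ?m) = (if \<forall>\<kappa>\<in>set \<Gamma>. card_sat (\<lambda>P. card {x\<in>\<omega>. fst x = P}) \<kappa> then 1 else 0)"
  proof -
    define el where "el = (\<lambda>q c. if q = p then card {b\<in>{1..n}. cls \<omega> g {1..n} b = c} else 0)"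
    have "fire (transition ?l) ?m = marking Done (U \<union> inst1 1 ` {}) (\<omega> \<union> inst1 1 ` {}) ({1..n} - {1..n}) el (Suc \<tau>)"
      unfolding transition.simps idle_marking_def el_def by (rule fire_marking) (use fin \<omega> in auto)
    then have f: "fire (transition ?l) ?m = marking Done U \<omega> {} el (Suc \<tau>)" by simp
    have eln: "el q c \<le> n" for q c
    proof -
      have "card {b\<in>{1..n}. cls \<omega> g {1..n} b = c} \<le> card {1..n}" by (rule card_mono) auto
      then show ?thesis by (simp add: el_def)
    qed
    have "F (marking Done U \<omega> {} el (Suc \<tau>)) =
        (if \<forall>\<kappa>\<in>set \<Gamma>. card_sat (\<lambda>P. marking Done U \<omega> {} el (Suc \<tau>) (Crd P)) \<kappa> then 1 else 0)"
      by (subst rec) (use marking_bounded[of U \<omega> "{}" el "Suc \<tau>"] \<omega> \<tau> eln in \<open>auto simp: marking_def\<close>)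
    then show ?thesis unfolding f by (simp add: marking_def)
  qed
  finally have "F ?m = (if cond_idle {1..n} g \<omega> then 1 else 0)" unfolding final_iff[OF J] by (simp only: split: if_split) blast
  moreover have "cpl U \<omega> (cond_idle {1..n} g) = (if cond_idle {1..n} g \<omega> then 1 else 0)"
  proof -
    have "{\<omega>'. \<omega>' \<subseteq> U \<and> \<omega>' \<inter> U = \<omega> \<and> cond_idle {1..n} g \<omega>'} = (if cond_idle {1..n} g \<omega> then {\<omega>} else {})"
    proof -
      have "\<omega>' \<subseteq> U \<and> \<omega>' \<inter> U = \<omega> \<and> cond_idle {1..n} g \<omega>' \<longleftrightarrow> \<omega>' = \<omega> \<and> cond_idle {1..n} g \<omega>" for \<omega>'
        using \<omega> by (metis inf.absorb_iff1)
      then show ?thesis by auto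
    qed
    then show ?thesis by (simp add: completions_def wt_def)
  qed
  ultimately show ?thesis by simp
qed

end

section \<open>Deciding the remaining atoms, closing a round, starting\<close>

context counting begin

lemma card_le2: "set as \<subseteq> {a, b} \<Longrightarrow> card (set as) \<le> 2"
  using card_mono[of "{a, b}" "set as"] by (auto simp: card_insert_if split: if_splits)

lemma lo_cong: "(\<And>x y. x \<in> A \<Longrightarrow> y \<in> A \<Longrightarrow> r \<omega> x y \<longleftrightarrow> r \<omega>' x y) \<Longrightarrow> lo \<omega> A \<longleftrightarrow> lo \<omega>' A"
  unfolding lo_def by (intro arg_cong2[of _ _ _ _ "(\<and>)"] ball_cong refl) auto

lemma card_single: "card {x. x = (P, v) \<and> fst x = P} = 1"
proof -
  have "{x. x = (P, v) \<and> fst x = P} = {(P, v)}" by auto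
  then show ?thesis by simp
qed

text \<open>All atoms left have at least three distinct arguments and affect neither 1-types nor
  counters nor the order; only their numbers and weights matter.\<close>

lemma step_rest:
  assumes J: "inv_idle {1..n} D \<omega> g" and D: "D \<noteq> U" and \<tau>: "\<tau> < N"
    and IH: "\<And>D' \<omega>'. inv_idle {1..n} D' \<omega>' g \<Longrightarrow> card (U - D') < card (U - D) \<Longrightarrow>
      cpl D' \<omega>' (cond_idle {1..n} g) = F (idle_marking {1..n} D' \<omega>' g p (Suc \<tau>))"
  shows "cpl D \<omega> (cond_idle {1..n} g) = F (idle_marking {1..n} D \<omega> g p \<tau>)"
proof -
  let ?m = "idle_marking {1..n} D \<omega> g p \<tau>"
  have JD: "D \<subseteq> U" "\<omega> \<subseteq> D" using J by (auto simp: inv_idle_def)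
  have fin: "finite \<omega>" using JD finite_U by (meson finite_subset)
  \<comment> \<open>The inhibitors of \<open>LRest\<close> force the least predicate with undecided
    atoms. Any of its atoms will do, since a marking sees only their number.\<close>
  obtain x where x: "x \<in> U - D" and min: "\<And>y. y \<in> U - D \<Longrightarrow> fst x \<le> fst y"
    using ex_has_least_nat[of "\<lambda>x. x \<in> U - D" _ fst] D JD(1) by blast
  define P where "P = fst x"
  have px: "(P, snd x) = x" by (simp add: P_def)
  have P: "P < length V" using x by (simp add: in_U P_def)
  have big: "\<not> card (set (snd x)) \<le> 2" using x J by (auto simp: inv_idle_def in_U)
  \<comment> \<open>The pattern with the empty argument list is a mere name for one atom of
    \<open>P\<close>; \<open>?\<iota>\<close> sends it to \<open>x\<close>.\<close>
  let ?Q = "{(P, [] :: var list)}"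
  let ?\<iota> = "\<lambda>y :: nat \<times> var list. (fst y, snd x)"
  let ?\<xi> = "\<lambda>b. if b then ?Q else {}"
  let ?l = "\<lambda>b. LRest (nullary \<omega>) p P b"
  have m: "?m (Ev e) = 0" "?m Done = 0" for e by (auto simp: idle_marking_def marking_def)
  have Pm: "?m (Free P) > 0" "P' < P \<Longrightarrow> ?m (Free P') = 0" for P'
  proof -
    have "{y\<in>U - D. fst y = P} \<noteq> {}" using x by (auto simp: P_def simp del: split_paired_Ex split_paired_All)
    then have "0 < card {y\<in>U - D. fst y = P}" using finite_U by (simp add: card_gt_0_iff)
    then show "?m (Free P) > 0" by (simp only: idle_marking_def marking_def place.case)
  next
    assume "P' < P"
    then have "{y\<in>U - D. fst y = P'} = {}" using min leD unfolding P_def by blast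
    then show "?m (Free P') = 0" by (simp only: idle_marking_def marking_def place.case card.empty)
  qed
  have bd: "?m q < N" for q by (rule idle_marking_bounded[OF J \<tau>])
  have step: "cpl (D \<union> ?\<iota> ` ?Q) (\<omega> \<union> ?\<iota> ` ?\<xi> b) (cond_idle {1..n} g) = F (fire (transition (?l b)) ?m)" for b
  proof -
    let ?D = "D \<union> ?\<iota> ` ?Q" and ?w = "\<omega> \<union> ?\<iota> ` ?\<xi> b"
    have agree: "(P', as) \<in> \<omega> \<longleftrightarrow> (P', as) \<in> ?w" if "card (set as) \<le> 2" for P' as
      using big that by (auto simp: px)
    have cl: "cls \<omega> g {1..n} c = cls ?w g {1..n} c" for c
      by (rule cls_cong) (erule agree[OF card_le2], rule refl)
    have nl: "nullary ?w = nullary \<omega>" by (rule nullary_cong, rule agree[symmetric]) simp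
    have lc: "one_type ?w c = one_type \<omega> c" for c
      by (rule one_type_cong, rule agree[symmetric], rule card_le2[of _ c c]) simp
    have "lo ?w {1..n} \<longleftrightarrow> lo \<omega> {1..n}"
      by (rule lo_cong, rule agree[symmetric], rule card_le2) auto
    then have lo: "lo ?w {1..n}" using J unfolding inv_idle_def by (elim conjE) simp
    have e: "?D = insert x D" by (simp add: px)
    have D': "?D \<subseteq> U" unfolding e using x JD by blast
    have w: "?w \<subseteq> ?D" unfolding e using JD by (auto simp: px)
    have "\<forall>y\<in>U. card (set (snd y)) \<le> 2 \<longrightarrow> (y \<in> D \<longleftrightarrow> set (snd y) \<subseteq> {1..n})"
      using J unfolding inv_idle_def by (elim conjE)
    then have mem: "\<forall>y\<in>U. card (set (snd y)) \<le> 2 \<longrightarrow> (y \<in> ?D \<longleftrightarrow> set (snd y) \<subseteq> {1..n})"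
      unfolding e using big by blast
    have g: "\<forall>b\<in>{1..n}. g b \<subseteq> \<Theta> \<and> compat (evt \<Gamma> b) (one_type ?w b)"
      using J unfolding inv_idle_def lc by (elim conjE)
    have J': "inv_idle {1..n} ?D ?w g" unfolding inv_idle_def by (intro conjI order_refl D' w mem g lo)
    have "U - ?D \<subset> U - D" unfolding e using x by blast
    then have "card (U - ?D) < card (U - D)"
      by (intro psubset_card_mono) (use finite_U in auto)
    then have "cpl ?D ?w (cond_idle {1..n} g) = F (idle_marking {1..n} ?D ?w g p (Suc \<tau>))" by (rule IH[OF J'])
    also have "idle_marking {1..n} ?D ?w g p (Suc \<tau>) = fire (transition (?l b)) ?m"
      unfolding transition.simps idle_marking_def nl cl[symmetric]
      by (rule fire_marking[symmetric]) (use x JD fin in \<open>auto simp: P_def split: if_splits\<close>)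
    finally show ?thesis .
  qed
  have "F ?m = (\<Sum>l\<in>?l ` UNIV. if enabled net_places (transition l) ?m then weight ?m l * F (fire (transition l) ?m) else 0)"
  proof (rule F_restrict)
    show "?m q < N" for q by (rule bd)
    show "?m Done = 0" by (rule m(2))
    show "?l ` UNIV \<subseteq> labels" using nullary_sub P by (auto simp: in_labels)
  next
    fix l assume l: "l \<in> labels" and en: "enabled net_places (transition l) ?m"
    have src: "src l = Idle (nullary \<omega>) p" by (rule enabled_src[OF en[unfolded idle_marking_def] l])
    show "l \<in> ?l ` UNIV"
    proof (cases l)
      case (LNew \<sigma> q e t \<gamma>)
      then have "e \<in> lit_sets" using l by (simp add: in_labels)
      then show ?thesis using enabled_pre[OF en in_net_places(7)[of e]] m(1)[of e] LNew by (auto simp: decide_tr_sel)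
    next
      case (LRest \<sigma> q P' b)
      then have P': "P' < length V" using l by (simp add: in_labels)
      have "0 < ?m (Free P')" using enabled_pre[OF en in_net_places(6)[OF P']] LRest by (auto simp: decide_tr_sel card_single)
      then have "\<not> P' < P" using Pm(2)[of P'] by auto
      moreover have "\<not> P < P'"
        using enabled_inh[OF en in_net_places(6)[OF P]] Pm(1) LRest by (auto simp: decide_tr_sel)
      ultimately show ?thesis using LRest src by auto
    next
      case (LDone \<sigma> q)
      then show ?thesis using enabled_inh[OF en in_net_places(6)[OF P]] Pm(1) by (auto simp: decide_tr_sel)
    qed (use src in auto)
  qed
  also have "\<dots> = (\<Sum>b\<in>UNIV. if enabled net_places (transition (?l b)) ?m then weight ?m (?l b) * F (fire (transition (?l b)) ?m) else 0)"
    by (subst sum.reindex) (auto simp: inj_on_def comp_def)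
  also have "\<dots> = (\<Sum>b\<in>UNIV. wt w w' ?Q (?\<xi> b) * cpl (D \<union> ?\<iota> ` ?Q) (\<omega> \<union> ?\<iota> ` ?\<xi> b) (cond_idle {1..n} g))"
  proof (rule sum.cong[OF refl])
    fix b :: bool
    have "enabled net_places (transition (?l b)) ?m" unfolding transition.simps using m Pm unfolding idle_marking_def
      by (intro enabled_marking[of _ ?\<iota>]) (use x in \<open>auto simp: P_def\<close>)
    moreover have "weight ?m (?l b) = wt w w' ?Q (?\<xi> b)"
      unfolding transition.simps by (subst twt_decide_tr) (use P in auto)
    ultimately show "(if enabled net_places (transition (?l b)) ?m then weight ?m (?l b) * F (fire (transition (?l b)) ?m) else 0) =
        wt w w' ?Q (?\<xi> b) * cpl (D \<union> ?\<iota> ` ?Q) (\<omega> \<union> ?\<iota> ` ?\<xi> b) (cond_idle {1..n} g)"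
      unfolding step by simp
  qed
  also have "\<dots> = (\<Sum>\<xi>\<in>?\<xi> ` UNIV. wt w w' ?Q \<xi> * cpl (D \<union> ?\<iota> ` ?Q) (\<omega> \<union> ?\<iota> ` \<xi>) (cond_idle {1..n} g))"
    by (subst sum.reindex) (auto simp: inj_on_def comp_def)
  also have "?\<xi> ` UNIV = Pow ?Q" by (auto simp: UNIV_bool)
  also have "(\<Sum>\<xi>\<in>Pow ?Q. wt w w' ?Q \<xi> * cpl (D \<union> ?\<iota> ` ?Q) (\<omega> \<union> ?\<iota> ` \<xi>) (cond_idle {1..n} g)) =
      cpl D \<omega> (cond_idle {1..n} g)"
    by (rule completions_decide[symmetric]) (use x JD finite_U in \<open>auto simp: P_def\<close>)
  finally show ?thesis ..
qed

text \<open>No atom is decided. The partners of \<open>a\<close> already have parity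
  \<open>\<not> p\<close>, so placing \<open>a\<close> there completes the marking of the next round
  without moving any token back.\<close>

lemma step_fin:
  assumes J: "inv_adding A a A D \<omega> g" and \<tau>: "\<tau> < N"
    and IH: "inv_idle (insert a A) D \<omega> g \<Longrightarrow>
      cpl D \<omega> (cond_idle (insert a A) g) = F (idle_marking (insert a A) D \<omega> g (\<not> p) (Suc \<tau>))"
  shows "cpl D \<omega> (cond_adding A a g) = F (adding_marking A a A D \<omega> g p \<tau>)"
proof -
  let ?m = "adding_marking A a A D \<omega> g p \<tau>"
  define c where "c = cls \<omega> g (insert a A) a"
  let ?l = "LFin p c"
  have JD: "A \<subseteq> {1..n}" "a \<in> {1..n}" "a \<notin> A" "D \<subseteq> U" "\<omega> \<subseteq> D" "g a \<subseteq> \<Theta>" "lo \<omega> A" "r \<omega> a a"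
    "\<And>b. b \<in> A \<Longrightarrow> r \<omega> b a \<and> \<not> r \<omega> a b"
    using J by (auto simp: inv_adding_def)
  have finA: "finite A" using JD(1) finite_subset by blast
  have fin: "finite \<omega>" using JD finite_U by (meson finite_subset)
  have c: "c \<in> classes" unfolding c_def by (rule cls_in_classes[of g a, OF JD(6)])
  have bd: "?m q < N" for q by (rule adding_marking_bounded[OF J \<tau>])
  have m: "?m (El p d) = 0" "?m Done = 0" for d by (auto simp: adding_marking_def marking_def)
  \<comment> \<open>A set of at most two elements that contains \<open>a\<close> is a singleton or a
    pair, which matches the decided atoms after a full round with those over
    \<open>insert a A\<close>.\<close>
  have set_iff: "T \<subseteq> insert a A \<longleftrightarrow> T \<subseteq> A \<or> T = {a} \<or> (\<exists>b\<in>A. T = {a, b})" if "card T \<le> 2" "finite T" for T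
  proof
    assume T: "T \<subseteq> insert a A"
    show "T \<subseteq> A \<or> T = {a} \<or> (\<exists>b\<in>A. T = {a, b})"
    proof (cases "T \<subseteq> A \<or> T = {a}")
      case False
      then obtain b where b: "a \<in> T" "b \<in> T" "b \<in> A" using T by blast
      have "a \<noteq> b" using b(3) JD(3) by blast
      then have "{a, b} = T" using that b by (intro card_seteq) auto
      then show ?thesis using b by blast
    qed blast
  qed auto
  have J': "inv_idle (insert a A) D \<omega> g"
  proof -
    have "x \<in> D \<longleftrightarrow> set (snd x) \<subseteq> insert a A" if "x \<in> U" "card (set (snd x)) \<le> 2" for x
      using J that set_iff[OF that(2)] by (auto simp: inv_adding_def)
    moreover have "lo \<omega> (insert a A)" using JD(3,7,8,9) unfolding lo_def by blast
    ultimately show ?thesis using J unfolding inv_idle_def inv_adding_def by blast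
  qed
  have "F ?m = (\<Sum>l\<in>{?l}. if enabled net_places (transition l) ?m then weight ?m l * F (fire (transition l) ?m) else 0)"
  proof (rule F_restrict)
    show "?m q < N" for q by (rule bd)
    show "?m Done = 0" by (rule m(2))
    show "{?l} \<subseteq> labels" using c by (simp add: in_labels)
  next
    fix l assume l: "l \<in> labels" and en: "enabled net_places (transition l) ?m"
    have src: "src l = Adding p c" unfolding c_def by (rule enabled_src[OF en[unfolded adding_marking_def] l])
    show "l \<in> {?l}"
    proof (cases l)
      case (LPair q c' d t)
      then have "d \<in> classes" using l by (simp add: in_labels)
      then show ?thesis using enabled_pre[OF en in_net_places(5)[of d p]] m(1)[of d] LPair src by (auto simp: decide_tr_sel)
    qed (use src in auto)
  qed
  moreover have "enabled net_places (transition ?l) ?m" unfolding transition.simps using m unfolding adding_marking_def c_def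
    by (intro enabled_marking[of _ "inst1 1"]) auto
  moreover have "weight ?m ?l = 1" unfolding transition.simps by (subst twt_decide_tr) (auto simp: wt_def)
  moreover have "fire (transition ?l) ?m = idle_marking (insert a A) D \<omega> g (\<not> p) (Suc \<tau>)"
  proof -
    have n: "{x\<in>fst c. snd x = []} = nullary \<omega>" by (simp add: c_def cls_def nullary_loc)
    have i: "{b. (b = a \<or> b \<in> A) \<and> cls \<omega> g (insert a A) b = d} =
        (if d = c then insert a {b\<in>A. cls \<omega> g (insert a A) b = d} else {b\<in>A. cls \<omega> g (insert a A) b = d})" for d
      by (auto simp: c_def)
    have "fire (transition ?l) ?m = marking (Idle (nullary \<omega>) (\<not> p)) (D \<union> inst1 1 ` {}) (\<omega> \<union> inst1 1 ` {}) ({1..n} - insert a A)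
      (\<lambda>q d. if q = (\<not> p) then card {b\<in>insert a A. cls \<omega> g (insert a A) b = d} else 0) (Suc \<tau>)"
      unfolding transition.simps adding_marking_def n c_def[symmetric]
      by (rule fire_marking) (use fin JD finA in \<open>auto simp: i simp del: split_paired_Ex split_paired_All\<close>)
    then show ?thesis by (simp add: idle_marking_def)
  qed
  ultimately have "F ?m = cpl D \<omega> (cond_idle (insert a A) g)" using IH[OF J'] by (simp del: transition.simps)
  also have "\<dots> = cpl D \<omega> (cond_adding A a g)"
  proof (rule completions_cong)
    fix \<omega>' assume "\<omega>' \<subseteq> U" "\<omega>' \<inter> D = \<omega>"
    \<comment> \<open>These atoms are decided in \<open>\<omega>\<close>, so the condition that
      \<open>insert a A\<close> precedes the rest reduces to the one that \<open>a\<close> is least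
      among the rest.\<close>
    then have top: "r \<omega>' x a" if "x \<in> insert a A" for x using JD(8,9) that by blast
    have e: "{1..n} - A = insert a ({1..n} - insert a A)" using JD(2,3) by blast
    show "cond_idle (insert a A) g \<omega>' \<longleftrightarrow> cond_adding A a g \<omega>'"
      unfolding cond_idle_def cond_adding_def e using top by blast
  qed
  finally show ?thesis ..
qed

text \<open>The nullary atoms come first because every 1-type contains them; from then on the
  control place remembers them.\<close>

lemma start:
  assumes IH: "\<And>D' \<omega>' g. inv_idle {} D' \<omega>' g \<Longrightarrow> cpl D' \<omega>' (cond_idle {} g) = F (idle_marking {} D' \<omega>' g False 1)"
  shows "cpl {} {} admissible = F (marking Start {} {} {1..n} (\<lambda>_ _. 0) 0)"
proof -
  let ?m = "marking Start {} {} {1..n} (\<lambda>_ _. 0) 0"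
  let ?D = "inst1 1 ` P0"
  have D: "?D = {x\<in>U. snd x = []}" by (rule inst1_P0)
  have inj: "inj_on (inst1 1) P0" by (rule inj_on_subset[OF inj_inst1]) (auto simp: P0_def)
  have step: "cpl ?D (inst1 1 ` \<sigma>) admissible = F (fire (transition (LNull \<sigma>)) ?m)" if \<sigma>: "\<sigma> \<subseteq> P0" for \<sigma>
  proof -
    have sub: "inst1 1 ` \<sigma> \<subseteq> {x\<in>U. snd x = []}" using \<sigma> D by blast
    have J: "inv_idle {} ?D (inst1 1 ` \<sigma>) (\<lambda>_. {})"
      unfolding inv_idle_def D using sub by (auto simp: lo_def)
    have nl: "nullary (inst1 1 ` \<sigma>) = \<sigma>"
    proof -
      have "inst1 1 x \<in> inst1 1 ` \<sigma> \<longleftrightarrow> x \<in> \<sigma>" if "x \<in> P0" for x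
        by (rule inj_on_image_mem_iff[OF inj that \<sigma>])
      then show ?thesis unfolding nullary_def using \<sigma> by blast
    qed
    have "fire (transition (LNull \<sigma>)) ?m = marking (Idle \<sigma> False) ({} \<union> inst1 1 ` P0) ({} \<union> inst1 1 ` \<sigma>) {1..n} (\<lambda>_ _. 0) (Suc 0)"
      unfolding transition.simps by (rule fire_marking) (use finite_P0 inj \<sigma> D in auto)
    also have "\<dots> = idle_marking {} ?D (inst1 1 ` \<sigma>) (\<lambda>_. {}) False 1"
      unfolding idle_marking_def nl by (simp add: fun_eq_iff cong: if_cong)
    finally have "F (fire (transition (LNull \<sigma>)) ?m) = cpl ?D (inst1 1 ` \<sigma>) (cond_idle {} (\<lambda>_. {}))"
      using IH[OF J] by simp
    then show ?thesis by (simp add: cond_idle_def[abs_def])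
  qed
  have "F ?m = (\<Sum>l\<in>LNull ` Pow P0. if enabled net_places (transition l) ?m then weight ?m l * F (fire (transition l) ?m) else 0)"
  proof (rule F_restrict)
    show "?m q < N" for q by (rule marking_bounded) (use N in auto)
    show "?m Done = 0" by (simp add: marking_def)
    show "LNull ` Pow P0 \<subseteq> labels" by (auto simp: in_labels)
  next
    fix l assume l: "l \<in> labels" and en: "enabled net_places (transition l) ?m"
    have "src l = Start" by (rule enabled_src[OF en l])
    then show "l \<in> LNull ` Pow P0" using l by (cases l) (auto simp: in_labels)
  qed
  also have "\<dots> = (\<Sum>\<sigma>\<in>Pow P0. if enabled net_places (transition (LNull \<sigma>)) ?m then weight ?m (LNull \<sigma>) * F (fire (transition (LNull \<sigma>)) ?m) else 0)"
    by (subst sum.reindex) (auto simp: inj_on_def comp_def)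
  also have "\<dots> = (\<Sum>\<sigma>\<in>Pow P0. wt w w' P0 \<sigma> * cpl ({} \<union> inst1 1 ` P0) ({} \<union> inst1 1 ` \<sigma>) admissible)"
  proof (rule sum.cong[OF refl])
    fix \<sigma> assume "\<sigma> \<in> Pow P0"
    moreover have "enabled net_places (transition (LNull \<sigma>)) ?m" unfolding transition.simps
      by (rule enabled_marking[of _ "inst1 1"]) (use inj D in auto)
    moreover have "weight ?m (LNull \<sigma>) = wt w w' P0 \<sigma>"
      unfolding transition.simps by (subst twt_decide_tr) (use finite_P0 fst_P in auto)
    ultimately show "(if enabled net_places (transition (LNull \<sigma>)) ?m then weight ?m (LNull \<sigma>) * F (fire (transition (LNull \<sigma>)) ?m) else 0) =
        wt w w' P0 \<sigma> * cpl ({} \<union> inst1 1 ` P0) ({} \<union> inst1 1 ` \<sigma>) admissible"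
      using step[of \<sigma>] by (simp del: transition.simps)
  qed
  also have "\<dots> = cpl {} {} admissible"
    by (rule completions_decide[symmetric]) (use inj D finite_U in auto)
  finally show ?thesis ..
qed

end

section \<open>Adding an element and pairing it with the earlier ones\<close>

context counting begin

lemma card_remove_if: "card (T - {b}) = card T - (if b \<in> T then 1 else 0)"
  by (simp add: card_Diff_singleton_if)

lemma card_insert_if':
  "b \<notin> T \<Longrightarrow> finite T \<Longrightarrow> card (if Q then insert b T else T) = card T + (if Q then 1 else 0)"
  by simp

lemma RX: "(R, [X, X]) \<in> P1"
  using R by (simp add: P1_def in_PX numeral_2_eq_2)

lemma unary_P1: "P < length V \<Longrightarrow> V ! P = 1 \<Longrightarrow> (P, [X]) \<in> P1"
  by (simp add: P1_def in_PX)

lemma compat_cong: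
  assumes "\<And>P. P < length V \<Longrightarrow> V ! P = 1 \<Longrightarrow> (P, [X]) \<in> t \<longleftrightarrow> (P, [X]) \<in> t'"
  shows "compat e t \<longleftrightarrow> compat e t'"
  unfolding compat_def using assms by blast

lemma inst1_P0_eq: "x \<in> P0 \<Longrightarrow> inst1 a x = inst1 b x"
  by (auto simp: P0_def inst1_def)

text \<open>The element \<open>a\<close> is appended to the processed initial segment \<open>A\<close>, with 1-type \<open>t\<close> and
  guess \<open>\<gamma>\<close>.\<close>

lemma step_new_claim:
  assumes J: "inv_idle A D \<omega> g" and a: "a \<in> {1..n} - A" and \<gamma>: "\<gamma> \<subseteq> \<Theta>" and t: "t \<subseteq> P1"
    and IH: "\<And>D' \<omega>'. inv_adding A a {} D' \<omega>' (g(a := \<gamma>)) \<Longrightarrow> card (U - D') < card (U - D) \<Longrightarrow>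
      cpl D' \<omega>' (cond_adding A a (g(a := \<gamma>))) = F (adding_marking A a {} D' \<omega>' (g(a := \<gamma>)) p (Suc \<tau>))"
  shows "inst1 a ` P1 \<subseteq> U - D"
    and "cpl (D \<union> inst1 a ` P1) (\<omega> \<union> inst1 a ` t) (cond_adding A a (g(a := \<gamma>))) =
      (if (R, [X, X]) \<in> t \<and> compat (evt \<Gamma> a) t
       then F (fire (transition (LNew (nullary \<omega>) p (evt \<Gamma> a) t \<gamma>)) (idle_marking A D \<omega> g p \<tau>)) else 0)"
proof -
  let ?D = "D \<union> inst1 a ` P1" and ?w = "\<omega> \<union> inst1 a ` t" and ?g = "g(a := \<gamma>)"
  have A: "A \<subseteq> {1..n}" and DU: "D \<subseteq> U" and \<omega>D: "\<omega> \<subseteq> D" and lo: "lo \<omega> A"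
    and mem: "\<And>x. x \<in> U \<Longrightarrow> card (set (snd x)) \<le> 2 \<Longrightarrow> x \<in> D \<longleftrightarrow> set (snd x) \<subseteq> A"
    and el: "\<And>b. b \<in> A \<Longrightarrow> g b \<subseteq> \<Theta>" "\<And>b. b \<in> A \<Longrightarrow> compat (evt \<Gamma> b) (one_type \<omega> b)"
    using J by (auto simp: inv_idle_def)
  have a': "a \<in> {1..n}" "a \<notin> A" using a by auto
  have fin: "finite \<omega>" "finite A" using \<omega>D DU finite_U A by (meson finite_subset finite_atLeastAtMost)+
  have at: "inst1 a ` P1 = {x\<in>U. set (snd x) = {a}}" by (rule inst1_P1[OF a'(1)])
  show new: "inst1 a ` P1 \<subseteq> U - D"
  proof
    fix x assume "x \<in> inst1 a ` P1"
    then have x: "x \<in> U" "set (snd x) = {a}" unfolding at by auto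
    then have "x \<notin> D" using mem[of x] a'(2) by auto
    then show "x \<in> U - D" using x by blast
  qed
  have inj: "inj_on (inst1 a) P1" by (rule inj_on_subset[OF inj_inst1]) (auto simp: P1_def)
  have memt: "inst1 a x \<in> ?w \<longleftrightarrow> x \<in> t" if "x \<in> P1" for x
  proof -
    have "inst1 a x \<notin> \<omega>" using new that \<omega>D by blast
    then show ?thesis using inj_on_image_mem_iff[OF inj that t] by blast
  qed
  have agree: "(P, as) \<in> \<omega> \<longleftrightarrow> (P, as) \<in> ?w" if "set as \<noteq> {a}" for P as
  proof -
    have "(P, as) \<notin> {x\<in>U. set (snd x) = {a}}" using that by simp
    then have "(P, as) \<notin> inst1 a ` t" using t at by blast
    then show ?thesis by blast
  qed
  have loca: "one_type ?w a = t \<union> nullary \<omega>"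
  proof -
    have "x \<in> one_type ?w a \<longleftrightarrow> x \<in> t \<union> nullary \<omega>" for x
    proof (cases "x \<in> P1")
      case True
      then have "x \<in> PX" "x \<notin> P0" by (auto simp: P1_def P0_def)
      then show ?thesis using memt[OF True] by (auto simp: one_type_def nullary_def)
    next
      case False
      show ?thesis
      proof (cases "x \<in> P0")
        case True
        then have "snd x = []" "x \<in> PX" by (auto simp: P0_def)
        then have "inst1 a x \<in> ?w \<longleftrightarrow> inst1 a x \<in> \<omega>" using agree[of "snd (inst1 a x)" "fst (inst1 a x)"] by (simp add: inst1_def)
        then show ?thesis using True \<open>x \<in> PX\<close> False t inst1_P0_eq[OF True, of a 1]
          by (auto simp: one_type_def nullary_def)
      next
        case F: False
        then have "x \<notin> PX" using False PX_split by blast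
        then show ?thesis using F False t by (auto simp: one_type_def nullary_def)
      qed
    qed
    then show ?thesis by blast
  qed
  have nl: "nullary ?w = nullary \<omega>" by (rule nullary_cong, rule agree[symmetric]) simp
  have lcb: "one_type ?w b = one_type \<omega> b" if "b \<noteq> a" for b
    by (rule one_type_cong, rule agree[symmetric]) (use that in auto)
  have cl: "cls ?w ?g A b = cls \<omega> g A b" if "b \<in> A" for b
  proof (rule cls_cong)
    fix x P as assume "x \<in> insert b A" "set as \<subseteq> {b, x}"
    then have "set as \<noteq> {a}" using that a'(2) by auto
    then show "(P, as) \<in> ?w \<longleftrightarrow> (P, as) \<in> \<omega>" by (rule agree[symmetric])
  next
    fix x assume "x \<in> insert b A"
    then show "?g x = g x" using that a'(2) by auto
  qed
  let ?ok = "(R, [X, X]) \<in> t \<and> compat (evt \<Gamma> a) t"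
  have cmp: "compat e (t \<union> nullary \<omega>) \<longleftrightarrow> compat e t" for e
    by (rule compat_cong) (auto simp: nullary_def P0_def)
  show "cpl ?D ?w (cond_adding A a ?g) =
      (if ?ok then F (fire (transition (LNew (nullary \<omega>) p (evt \<Gamma> a) t \<gamma>)) (idle_marking A D \<omega> g p \<tau>)) else 0)"
  proof (cases ?ok)
    case True
    have D': "?D \<subseteq> U" using DU new by blast
    have w': "?w \<subseteq> ?D" using \<omega>D t by blast
    have mem': "\<forall>x\<in>U. card (set (snd x)) \<le> 2 \<longrightarrow> (x \<in> ?D \<longleftrightarrow>
        set (snd x) \<subseteq> A \<or> set (snd x) = {a} \<or> (\<exists>b\<in>{}. set (snd x) = {a, b}))"
      unfolding at using mem by blast
    have el': "\<forall>b\<in>insert a A. ?g b \<subseteq> \<Theta> \<and> compat (evt \<Gamma> b) (one_type ?w b)"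
    proof
      fix b assume b: "b \<in> insert a A"
      show "?g b \<subseteq> \<Theta> \<and> compat (evt \<Gamma> b) (one_type ?w b)"
      proof (cases "b = a")
        case b: True
        show ?thesis unfolding b loca cmp using True \<gamma> by simp
      next
        case False
        then show ?thesis using el[of b] b lcb[of b] by simp
      qed
    qed
    have "lo ?w A \<longleftrightarrow> lo \<omega> A"
    proof (rule lo_cong, rule agree[symmetric])
      fix x y assume "x \<in> A" "y \<in> A"
      then show "set [x, y] \<noteq> {a}" using a'(2) by auto
    qed
    then have lo': "lo ?w A" using lo by simp
    have raa: "r ?w a a" using memt[OF RX] True by (simp add: inst1_def)
    have J': "inv_adding A a {} ?D ?w ?g" unfolding inv_adding_def
      by (intro conjI A a D' w' mem' el' lo' raa) auto
    have lt: "card (U - ?D) < card (U - D)"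
    proof (rule psubset_card_mono)
      have "inst1 a (R, [X, X]) \<in> inst1 a ` P1" using RX by blast
      then show "U - ?D \<subset> U - D" using new by blast
    qed (use finite_U in auto)
    have "cpl ?D ?w (cond_adding A a ?g) = F (adding_marking A a {} ?D ?w ?g p (Suc \<tau>))" by (rule IH[OF J' lt])
    also have "adding_marking A a {} ?D ?w ?g p (Suc \<tau>) = fire (transition (LNew (nullary \<omega>) p (evt \<Gamma> a) t \<gamma>)) (idle_marking A D \<omega> g p \<tau>)"
    proof -
      have c: "cls ?w ?g (insert a {}) a = new_cls (t \<union> nullary \<omega>) \<gamma>"
        using new_cls[of ?w a ?g] by (simp add: loca)
      have B: "card {b\<in>{1..n} - insert a A. evt \<Gamma> b = e} =
          card {b\<in>{1..n} - A. evt \<Gamma> b = e} - (if Ev e \<in> {Ev (evt \<Gamma> a)} then 1 else 0) +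
          (if Ev e \<in> {} then 1 else 0)" for e
      proof -
        have "{b\<in>{1..n} - insert a A. evt \<Gamma> b = e} = {b\<in>{1..n} - A. evt \<Gamma> b = e} - {a}" by auto
        then show ?thesis using a by (simp add: card_Diff_singleton_if)
      qed
      have e: "(if q = p then card {b\<in>A - {}. cls ?w ?g A b = d} else card {b\<in>{}. cls ?w ?g (insert a A) b = d}) =
          (if q = p then card {b\<in>A. cls \<omega> g A b = d} else 0) -
          (if El q d \<in> {Ev (evt \<Gamma> a)} then 1 else 0) + (if El q d \<in> {} then 1 else 0)" for q d
      proof -
        have "{b\<in>A. cls ?w ?g A b = d} = {b\<in>A. cls \<omega> g A b = d}" using cl by auto
        then show ?thesis by simp
      qed
      show ?thesis unfolding adding_marking_def idle_marking_def c transition.simps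
        by (rule fire_marking[symmetric]) (use finite_P1 inj new t \<omega>D fin B e in \<open>simp_all\<close>)
    qed
    finally show ?thesis unfolding if_P[OF True] .
  next
    \<comment> \<open>A 1-type that violates reflexivity or the evidence has no admissible
      completion, in accordance with its absence from \<open>labels\<close>.\<close>
    case False
    have "\<not> cond_adding A a ?g \<omega>'" if \<omega>': "\<omega>' \<subseteq> U" "\<omega>' \<inter> ?D = ?w" for \<omega>'
    proof
      assume "cond_adding A a ?g \<omega>'"
      then have LO: "LO R n \<omega>'" and con: "sat_constrs \<omega>' \<Gamma>" by (auto simp: cond_adding_def cond_idle_def admissible_def)
      have m: "inst1 a x \<in> \<omega>' \<longleftrightarrow> x \<in> t" if x: "x \<in> P1" for x
      proof -
        have "inst1 a x \<in> ?D" using x by blast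
        then have "inst1 a x \<in> \<omega>' \<longleftrightarrow> inst1 a x \<in> ?w" using \<omega>'(2) by blast
        then show ?thesis using memt[OF x] by blast
      qed
      have "lo \<omega>' {1..n}" using LO LO_lo[OF \<omega>'(1)] by blast
      then have "r \<omega>' a a" using a'(1) unfolding lo_def by blast
      then have 1: "(R, [X, X]) \<in> t" using m[OF RX] by (simp add: inst1_def)
      have "compat (evt \<Gamma> a) (one_type \<omega>' a)" using con a'(1) unfolding sat_constrs_iff by blast
      moreover have "compat (evt \<Gamma> a) (one_type \<omega>' a) \<longleftrightarrow> compat (evt \<Gamma> a) t"
      proof (rule compat_cong)
        fix P assume P: "P < length V" "V ! P = 1"
        show "(P, [X]) \<in> one_type \<omega>' a \<longleftrightarrow> (P, [X]) \<in> t"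
          using m[OF unary_P1[OF P]] in_one_type_unary[OF P] by (simp add: inst1_def)
      qed
      ultimately show False using 1 False by blast
    qed
    then have "cpl ?D ?w (cond_adding A a ?g) = 0" by (rule completions_False)
    then show ?thesis unfolding if_not_P[OF False] .
  qed
qed

text \<open>The completions are partitioned by the least remaining element \<open>a\<close>, the
  truths at \<open>a\<close>, and its unary patterns. The value of a part depends on
  \<open>a\<close> only through its evidence, so summation over \<open>a\<close> produces the factor
  \<open>Ev e\<close>.\<close>

lemma step_new:
  assumes J: "inv_idle A D \<omega> g" and ne: "A \<noteq> {1..n}" and \<tau>: "\<tau> < N"
    and IH: "\<And>a D' \<omega>' \<gamma>. inv_adding A a {} D' \<omega>' (g(a := \<gamma>)) \<Longrightarrow> card (U - D') < card (U - D) \<Longrightarrow>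
      cpl D' \<omega>' (cond_adding A a (g(a := \<gamma>))) = F (adding_marking A a {} D' \<omega>' (g(a := \<gamma>)) p (Suc \<tau>))"
  shows "cpl D \<omega> (cond_idle A g) = F (idle_marking A D \<omega> g p \<tau>)"
proof -
  let ?m = "idle_marking A D \<omega> g p \<tau>"
  let ?B = "{1..n} - A"
  let ?l = "\<lambda>(e, \<gamma>, t). LNew (nullary \<omega>) p e t \<gamma>"
  define ok where "ok e t \<longleftrightarrow> (R, [X, X]) \<in> t \<and> compat e t" for e t
  define G where "G e \<gamma> t = (if ok e t then wt w w' P1 t * F (fire (transition (LNew (nullary \<omega>) p e t \<gamma>)) ?m) else 0)" for e \<gamma> t
  define T where "T = {(e, \<gamma>, t). e \<in> lit_sets \<and> \<gamma> \<subseteq> \<Theta> \<and> t \<subseteq> P1 \<and> ok e t}"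
  have A: "A \<subseteq> {1..n}" "D \<subseteq> U" "\<omega> \<subseteq> D" using J by (auto simp: inv_idle_def)
  have B: "?B \<noteq> {}" using A(1) ne by blast
  have mEv: "?m (Ev e) = card {b\<in>?B. evt \<Gamma> b = e}" for e by (simp add: idle_marking_def marking_def)
  have mD: "?m Done = 0" by (simp add: idle_marking_def marking_def)
  have bd: "?m q < N" for q by (rule idle_marking_bounded[OF J \<tau>])
  have inj: "inj_on (inst1 a) P1" for a by (rule inj_on_subset[OF inj_inst1]) (auto simp: P1_def)
  have new: "inst1 a ` P1 \<subseteq> U - D" if "a \<in> ?B" for a
    by (rule step_new_claim(1)[OF J that, of "{}" "{}" p \<tau>]) (use IH in auto)
  have "cpl D \<omega> (cond_idle A g) = (\<Sum>a\<in>?B. cpl D \<omega> (\<lambda>\<omega>. cond_idle A g \<omega> \<and> (\<forall>y\<in>?B. r \<omega> a y)))"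
  proof (rule completions_split[OF finite_U])
    fix \<omega>' assume "\<omega>' \<subseteq> U" "cond_idle A g \<omega>'"
    then have "lo \<omega>' {1..n}" using LO_lo by (simp add: cond_idle_def admissible_def)
    then show "\<exists>!a. a \<in> ?B \<and> (\<forall>y\<in>?B. r \<omega>' a y)" by (rule lo_min) (use B in auto)
  qed simp
  also have "\<dots> = (\<Sum>a\<in>?B. \<Sum>\<gamma>\<in>Pow \<Theta>. \<Sum>t\<in>Pow P1. G (evt \<Gamma> a) \<gamma> t)"
  proof (rule sum.cong[OF refl])
    fix a assume a: "a \<in> ?B"
    have "cpl D \<omega> (\<lambda>\<omega>. cond_idle A g \<omega> \<and> (\<forall>y\<in>?B. r \<omega> a y)) =
        (\<Sum>\<gamma>\<in>Pow \<Theta>. cpl D \<omega> (\<lambda>\<omega>. (cond_idle A g \<omega> \<and> (\<forall>y\<in>?B. r \<omega> a y)) \<and> truths \<Theta> n \<omega> a = \<gamma>))"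
      by (rule completions_split[OF finite_U]) (auto simp: finite_Theta truths_def)
    also have "\<dots> = (\<Sum>\<gamma>\<in>Pow \<Theta>. \<Sum>t\<in>Pow P1. G (evt \<Gamma> a) \<gamma> t)"
    proof (rule sum.cong[OF refl])
      fix \<gamma> assume \<gamma>: "\<gamma> \<in> Pow \<Theta>"
      have "cpl D \<omega> (\<lambda>\<omega>. (cond_idle A g \<omega> \<and> (\<forall>y\<in>?B. r \<omega> a y)) \<and> truths \<Theta> n \<omega> a = \<gamma>) = cpl D \<omega> (cond_adding A a (g(a := \<gamma>)))"
      proof (rule completions_cong)
        fix \<omega>'
        have "cond_idle A (g(a := \<gamma>)) \<omega>' \<longleftrightarrow> cond_idle A g \<omega>'"
          unfolding cond_idle_def using a by (auto simp del: atLeastAtMost_iff)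
        then show "((cond_idle A g \<omega>' \<and> (\<forall>y\<in>?B. r \<omega>' a y)) \<and> truths \<Theta> n \<omega>' a = \<gamma>) \<longleftrightarrow> cond_adding A a (g(a := \<gamma>)) \<omega>'"
          unfolding cond_adding_def by (auto simp del: atLeastAtMost_iff)
      qed
      also have "\<dots> = (\<Sum>t\<in>Pow P1. wt w w' P1 t * cpl (D \<union> inst1 a ` P1) (\<omega> \<union> inst1 a ` t) (cond_adding A a (g(a := \<gamma>))))"
        by (rule completions_decide) (use finite_U A inj new[OF a] in auto)
      also have "\<dots> = (\<Sum>t\<in>Pow P1. G (evt \<Gamma> a) \<gamma> t)"
      proof (rule sum.cong[OF refl])
        fix t assume t: "t \<in> Pow P1"
        have "cpl (D \<union> inst1 a ` P1) (\<omega> \<union> inst1 a ` t) (cond_adding A a (g(a := \<gamma>))) =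
          (if ok (evt \<Gamma> a) t then F (fire (transition (LNew (nullary \<omega>) p (evt \<Gamma> a) t \<gamma>)) ?m) else 0)"
          unfolding ok_def by (rule step_new_claim(2)[OF J a]) (use \<gamma> t IH in auto)
        then show "wt w w' P1 t * cpl (D \<union> inst1 a ` P1) (\<omega> \<union> inst1 a ` t) (cond_adding A a (g(a := \<gamma>))) = G (evt \<Gamma> a) \<gamma> t"
          unfolding G_def by simp
      qed
      finally show "cpl D \<omega> (\<lambda>\<omega>. (cond_idle A g \<omega> \<and> (\<forall>y\<in>?B. r \<omega> a y)) \<and> truths \<Theta> n \<omega> a = \<gamma>) =
        (\<Sum>t\<in>Pow P1. G (evt \<Gamma> a) \<gamma> t)" .
    qed
    finally show "cpl D \<omega> (\<lambda>\<omega>. cond_idle A g \<omega> \<and> (\<forall>y\<in>?B. r \<omega> a y)) =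
      (\<Sum>\<gamma>\<in>Pow \<Theta>. \<Sum>t\<in>Pow P1. G (evt \<Gamma> a) \<gamma> t)" .
  qed
  \<comment> \<open>Here the identity of the element disappears: elements with equal evidence
    contribute equal summands, and their number is the content of the place
    \<open>Ev e\<close>.\<close>
  also have "\<dots> = (\<Sum>e\<in>lit_sets. \<Sum>a\<in>{b\<in>?B. evt \<Gamma> b = e}. \<Sum>\<gamma>\<in>Pow \<Theta>. \<Sum>t\<in>Pow P1. G (evt \<Gamma> a) \<gamma> t)"
    by (rule sum.group[symmetric]) (use finite_lit_sets evt_in_lit_sets in auto)
  also have "\<dots> = (\<Sum>e\<in>lit_sets. real (?m (Ev e)) * (\<Sum>\<gamma>\<in>Pow \<Theta>. \<Sum>t\<in>Pow P1. G e \<gamma> t))"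
    unfolding mEv by (intro sum.cong refl) simp
  also have "\<dots> = (\<Sum>(e, \<gamma>, t)\<in>lit_sets \<times> Pow \<Theta> \<times> Pow P1. real (?m (Ev e)) * G e \<gamma> t)"
    by (simp add: sum_distrib_left sum.cartesian_product case_prod_unfold)
  also have "\<dots> = (\<Sum>(e, \<gamma>, t)\<in>T. real (?m (Ev e)) * G e \<gamma> t)"
    by (rule sum.mono_neutral_right) (use finite_lit_sets finite_Theta finite_P1 in \<open>auto simp: T_def G_def split: if_splits\<close>)
  also have "\<dots> = (\<Sum>x\<in>T. if enabled net_places (transition (?l x)) ?m then weight ?m (?l x) * F (fire (transition (?l x)) ?m) else 0)"
  proof (rule sum.cong[OF refl])
    fix x assume "x \<in> T"
    then obtain e \<gamma> t where x: "x = (e, \<gamma>, t)" "e \<in> lit_sets" "t \<subseteq> P1" "ok e t" by (auto simp: T_def)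
    have "weight ?m (LNew (nullary \<omega>) p e t \<gamma>) = wt w w' P1 t * real (?m (Ev e))"
      unfolding transition.simps by (subst twt_decide_tr) (use finite_P1 fst_P in auto)
    moreover have "enabled net_places (transition (LNew (nullary \<omega>) p e t \<gamma>)) ?m" if "0 < ?m (Ev e)"
    proof -
      obtain a where a: "a \<in> ?B" using B by blast
      show ?thesis using that unfolding transition.simps idle_marking_def
        by (intro enabled_marking[OF _ inj _ new[OF a]]) auto
    qed
    ultimately show "(case x of (e, \<gamma>, t) \<Rightarrow> real (?m (Ev e)) * G e \<gamma> t) =
      (if enabled net_places (transition (?l x)) ?m then weight ?m (?l x) * F (fire (transition (?l x)) ?m) else 0)"
      using x by (cases "?m (Ev e) = 0") (auto simp: G_def simp del: transition.simps)
  qed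
  also have "\<dots> = (\<Sum>l\<in>?l ` T. if enabled net_places (transition l) ?m then weight ?m l * F (fire (transition l) ?m) else 0)"
    by (subst sum.reindex) (auto simp: inj_on_def comp_def)
  also have "\<dots> = F ?m"
  proof (rule F_restrict[symmetric])
    show "?m q < N" for q by (rule bd)
    show "?m Done = 0" by (rule mD)
    show "?l ` T \<subseteq> labels" using nullary_sub by (auto simp: in_labels T_def ok_def)
  next
    fix l assume l: "l \<in> labels" and en: "enabled net_places (transition l) ?m"
    have src: "src l = Idle (nullary \<omega>) p" by (rule enabled_src[OF en[unfolded idle_marking_def] l])
    obtain a where a: "a \<in> ?B" using B by blast
    have "{b\<in>?B. evt \<Gamma> b = evt \<Gamma> a} \<noteq> {}" using a by blast
    then have "0 < ?m (Ev (evt \<Gamma> a))" unfolding mEv by (simp add: card_gt_0_iff)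
    \<comment> \<open>An element is still waiting, and its evidence place inhibits
      \<open>LRest\<close> and \<open>LDone\<close>.\<close>
    then have no: "\<not> inh (transition l) (Ev (evt \<Gamma> a))"
      using enabled_inh[OF en in_net_places(7)[OF evt_in_lit_sets]] by fastforce
    show "l \<in> ?l ` T"
    proof (cases l)
      case (LNew \<sigma> q e t \<gamma>)
      then have "l = ?l (e, \<gamma>, t)" using src by simp
      moreover have "(e, \<gamma>, t) \<in> T" using l LNew by (simp add: in_labels T_def ok_def)
      ultimately show ?thesis by blast
    qed (use src no evt_in_lit_sets in \<open>auto simp: decide_tr_sel\<close>)
  qed
  finally show ?thesis .
qed

text \<open>A partner is fixed rather than summed over, so the transition carries no factor for the
  number of tokens. The inhibitors and the injectivity of \<open>num\<close> leave exactly one class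
  to choose the partner from.\<close>

lemma step_pair:
  assumes J: "inv_adding A a S D \<omega> g" and ne: "S \<noteq> A" and \<tau>: "\<tau> < N"
    and IH: "\<And>S' D' \<omega>'. inv_adding A a S' D' \<omega>' g \<Longrightarrow> card (U - D') < card (U - D) \<Longrightarrow>
      cpl D' \<omega>' (cond_adding A a g) = F (adding_marking A a S' D' \<omega>' g p (Suc \<tau>))"
  shows "cpl D \<omega> (cond_adding A a g) = F (adding_marking A a S D \<omega> g p \<tau>)"
proof -
  let ?m = "adding_marking A a S D \<omega> g p \<tau>"
  have A: "A \<subseteq> {1..n}" and a: "a \<in> {1..n}" "a \<notin> A" and S: "S \<subseteq> A" and DU: "D \<subseteq> U"
    and \<omega>D: "\<omega> \<subseteq> D" and lo: "lo \<omega> A" and raa: "r \<omega> a a"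
    and rS: "\<And>b. b \<in> S \<Longrightarrow> r \<omega> b a \<and> \<not> r \<omega> a b"
    and mem: "\<And>x. x \<in> U \<Longrightarrow> card (set (snd x)) \<le> 2 \<Longrightarrow> x \<in> D \<longleftrightarrow>
        set (snd x) \<subseteq> A \<or> set (snd x) = {a} \<or> (\<exists>b\<in>S. set (snd x) = {a, b})"
    and el: "\<And>b. b \<in> insert a A \<Longrightarrow> g b \<subseteq> \<Theta>" "\<And>b. b \<in> insert a A \<Longrightarrow> compat (evt \<Gamma> b) (one_type \<omega> b)"
    using J by (auto simp: inv_adding_def)
  have fin: "finite \<omega>" "finite A" using \<omega>D DU finite_U A by (meson finite_subset finite_atLeastAtMost)+
  have finS: "finite S" using S fin(2) by (rule finite_subset)
  \<comment> \<open>An unpaired element whose class has the least number; which element of that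
    class is taken is invisible in the marking.\<close>
  obtain b where b: "b \<in> A - S"
    and min: "\<And>b'. b' \<in> A - S \<Longrightarrow> num (cls \<omega> g A b) \<le> num (cls \<omega> g A b')"
    using ex_has_least_nat[of "\<lambda>b. b \<in> A - S" _ "\<lambda>b. num (cls \<omega> g A b)"] ne S by blast
  have ab: "a \<noteq> b" and bn: "b \<in> {1..n}" and bS: "b \<notin> S" and bA: "b \<in> A" using b a A by auto
  define c where "c = cls \<omega> g (insert a S) a"
  define d where "d = cls \<omega> g A b"
  have cCL: "c \<in> classes" unfolding c_def by (rule cls_in_classes[of g a, OF el(1)]) simp
  have dCL: "d \<in> classes" unfolding d_def by (rule cls_in_classes[of g b, OF el(1)]) (use bA in simp)
  let ?D = "D \<union> inst2 a b ` P2"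
  have at: "inst2 a b ` P2 = {x\<in>U. set (snd x) = {a, b}}" by (rule inst2_P2[OF a(1) bn ab])
  have new: "inst2 a b ` P2 \<subseteq> U - D"
  proof
    fix x assume "x \<in> inst2 a b ` P2"
    then have x: "x \<in> U" "set (snd x) = {a, b}" unfolding at by auto
    have "\<not> (\<exists>b'\<in>S. {a, b} = {a, b'})" using bS ab by (auto simp: doubleton_eq_iff)
    moreover have "\<not> {a, b} \<subseteq> A" "{a, b} \<noteq> {a}" using a(2) ab by auto
    moreover have "card (set (snd x)) \<le> 2" by (rule card_le2[of _ a b]) (simp add: x)
    ultimately have "x \<notin> D" using mem[OF x(1)] unfolding x(2) by blast
    then show "x \<in> U - D" using x(1) by blast
  qed
  have inj: "inj_on (inst2 a b) P2" by (rule inj_on_subset[OF inj_inst2[OF ab]]) simp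
  let ?l = "\<lambda>t. LPair p c d t"
  define ok where "ok t \<longleftrightarrow> (R, [Y, X]) \<in> t \<and> (R, [X, Y]) \<notin> t" for t :: "(nat \<times> var list) set"
  have RP: "(R, [Y, X]) \<in> P2" "(R, [X, Y]) \<in> P2" using R by (auto simp: P2_def)
  have Re: "inst2 a b (R, [Y, X]) = (R, [b, a])" "inst2 a b (R, [X, Y]) = (R, [a, b])" by (auto simp: inst2_def)
  have mEl: "?m (El p d') = card {b'\<in>A - S. cls \<omega> g A b' = d'}" for d' by (simp add: adding_marking_def marking_def)
  have mD: "?m Done = 0" by (simp add: adding_marking_def marking_def)
  have bd: "?m q < N" for q by (rule adding_marking_bounded[OF J \<tau>])
  have m_pos: "\<exists>b'\<in>A - S. cls \<omega> g A b' = d'" if "0 < ?m (El p d')" for d'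
  proof (rule ccontr)
    assume "\<not> ?thesis"
    then have "{b'\<in>A - S. cls \<omega> g A b' = d'} = {}" by blast
    then show False using that unfolding mEl by (simp only: card.empty)
  qed
  have md: "0 < ?m (El p d)"
  proof -
    have "{b'\<in>A - S. cls \<omega> g A b' = d} \<noteq> {}" using b unfolding d_def by blast
    moreover have "finite {b'\<in>A - S. cls \<omega> g A b' = d}" using fin(2) by simp
    ultimately show ?thesis unfolding mEl card_gt_0_iff by (intro conjI)
  qed
  have claim: "cpl ?D (\<omega> \<union> inst2 a b ` t) (cond_adding A a g) = (if ok t then F (fire (transition (?l t)) ?m) else 0)"
    if t: "t \<subseteq> P2" for t
  proof -
    let ?w = "\<omega> \<union> inst2 a b ` t"
    have memt: "inst2 a b x \<in> ?w \<longleftrightarrow> x \<in> t" if "x \<in> P2" for x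
    proof -
      have "inst2 a b x \<notin> \<omega>" using new that \<omega>D by blast
      then show ?thesis using inj_on_image_mem_iff[OF inj that t] by blast
    qed
    have agree: "(P, as) \<in> \<omega> \<longleftrightarrow> (P, as) \<in> ?w" if "set as \<noteq> {a, b}" for P as
    proof -
      have "(P, as) \<notin> {x\<in>U. set (snd x) = {a, b}}" using that by simp
      then have "(P, as) \<notin> inst2 a b ` t" using t at by blast
      then show ?thesis by blast
    qed
    have plt: "two_type ?w a b = t" unfolding two_type_def using memt t by blast
    have nl: "nullary ?w = nullary \<omega>" by (rule nullary_cong, rule agree[symmetric]) simp
    have lc: "one_type ?w x = one_type \<omega> x" for x
      by (rule one_type_cong, rule agree[symmetric]) (use ab in auto)
    \<comment> \<open>Only atoms over exactly \<open>a\<close> and \<open>b\<close> are decided, so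
      a class can change only if it belongs to one of them and has the other among its
      partners.\<close>
    have clA: "cls ?w g B x = cls \<omega> g B x" if "b \<notin> insert x B \<or> a \<notin> insert x B \<or> (x \<noteq> a \<and> x \<noteq> b)" for B x
    proof (rule cls_cong)
      fix y P as assume y: "y \<in> insert x B" and as: "set as \<subseteq> {x, y}"
      have "set as \<noteq> {a, b}"
      proof
        assume "set as = {a, b}"
        then have "a \<in> {x, y}" "b \<in> {x, y}" using as by auto
        then show False using that y ab by auto
      qed
      then show "(P, as) \<in> ?w \<longleftrightarrow> (P, as) \<in> \<omega>" by (rule agree[symmetric])
    qed (rule refl)
    show ?thesis
    proof (cases "ok t")
      case True
      have D': "?D \<subseteq> U" using DU new by blast
      have w': "?w \<subseteq> ?D" using \<omega>D t by blast
      have S': "insert b S \<subseteq> A" using S bA by blast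
      have mem': "\<forall>x\<in>U. card (set (snd x)) \<le> 2 \<longrightarrow> (x \<in> ?D \<longleftrightarrow>
          set (snd x) \<subseteq> A \<or> set (snd x) = {a} \<or> (\<exists>b'\<in>insert b S. set (snd x) = {a, b'}))"
        unfolding at using mem by blast
      have el': "\<forall>b\<in>insert a A. g b \<subseteq> \<Theta> \<and> compat (evt \<Gamma> b) (one_type ?w b)"
        unfolding lc using el by blast
      have "lo ?w A \<longleftrightarrow> lo \<omega> A"
      proof (rule lo_cong, rule agree[symmetric])
        fix x y assume "x \<in> A" "y \<in> A"
        then show "set [x, y] \<noteq> {a, b}" using a(2) by auto
      qed
      then have lo': "lo ?w A" using lo by simp
      have raa': "r ?w a a" using raa by blast
      have rS': "\<forall>b'\<in>insert b S. r ?w b' a \<and> \<not> r ?w a b'"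
      proof
        fix b' assume b': "b' \<in> insert b S"
        show "r ?w b' a \<and> \<not> r ?w a b'"
        proof (cases "b' = b")
          case True
          then show ?thesis using memt[OF RP(1)] memt[OF RP(2)] \<open>ok t\<close> unfolding Re ok_def by simp
        next
          case False
          then have "b' \<in> S" "set [b', a] \<noteq> {a, b}" "set [a, b'] \<noteq> {a, b}"
            using b' ab by (auto simp: doubleton_eq_iff)
          then show ?thesis using rS agree by blast
        qed
      qed
      have J': "inv_adding A a (insert b S) ?D ?w g" unfolding inv_adding_def
        by (intro conjI A S' D' w' mem' el' lo' raa' rS') (use a in auto)
      have lt: "card (U - ?D) < card (U - D)"
      proof (rule psubset_card_mono)
        have "inst2 a b (R, [X, Y]) \<in> inst2 a b ` P2" using RP by blast
        then show "U - ?D \<subset> U - D" using new by blast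
      qed (use finite_U in auto)
      have "cpl ?D ?w (cond_adding A a g) = F (adding_marking A a (insert b S) ?D ?w g p (Suc \<tau>))" by (rule IH[OF J' lt])
      also have "adding_marking A a (insert b S) ?D ?w g p (Suc \<tau>) = fire (transition (?l t)) ?m"
      proof -
        have c': "c = cls ?w g (insert a S) a" unfolding c_def
          by (rule clA[symmetric]) (use bS ab in auto)
        have d': "d = cls ?w g A b" unfolding d_def
          by (rule clA[symmetric]) (use a(2) ab in auto)
        have un: "upd_new c d t = cls ?w g (insert a (insert b S)) a"
          using upd_new[of "insert a S" b a ?w g A] finS bS ab unfolding c' d' plt
          by (simp add: insert_commute)
        have uo: "upd_old c d t = cls ?w g (insert a A) b"
          using upd_old[of A a b ?w g "insert a S"] fin(2) a(2) ab unfolding c' d' plt by simp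
        have B: "card {x\<in>{1..n} - insert a A. evt \<Gamma> x = e} =
            card {x\<in>{1..n} - insert a A. evt \<Gamma> x = e} - (if Ev e \<in> {El p d} then 1 else 0) +
            (if Ev e \<in> {El (\<not> p) (upd_old c d t)} then 1 else 0)" for e
          by simp
        have E: "(if q = p then card {x\<in>A - insert b S. cls ?w g A x = z}
              else card {x\<in>insert b S. cls ?w g (insert a A) x = z}) =
            (if q = p then card {x\<in>A - S. cls \<omega> g A x = z} else card {x\<in>S. cls \<omega> g (insert a A) x = z}) -
            (if El q z \<in> {El p d} then 1 else 0) + (if El q z \<in> {El (\<not> p) (upd_old c d t)} then 1 else 0)"
          for q z
        proof (cases "q = p")
          case True
          have "{x\<in>A - insert b S. cls ?w g A x = z} = {x\<in>A - S. cls \<omega> g A x = z} - {b}"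
          proof -
            have "cls ?w g A x = cls \<omega> g A x" if "x \<in> A - insert b S" for x
              by (rule clA) (use that a(2) in auto)
            then have "{x\<in>A - insert b S. cls ?w g A x = z} = {x\<in>A - insert b S. cls \<omega> g A x = z}"
              by (intro Collect_cong conj_cong refl) simp
            also have "\<dots> = {x\<in>A - S. cls \<omega> g A x = z} - {b}" by blast
            finally show ?thesis .
          qed
          then have "card {x\<in>A - insert b S. cls ?w g A x = z} =
              card {x\<in>A - S. cls \<omega> g A x = z} - (if b \<in> {x\<in>A - S. cls \<omega> g A x = z} then 1 else 0)"
            by (simp only: card_remove_if)
          moreover have "b \<in> {x\<in>A - S. cls \<omega> g A x = z} \<longleftrightarrow> z = d"
            unfolding d_def mem_Collect_eq using b by (simp only: simp_thms eq_commute)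
          ultimately show ?thesis using True by simp
        next
          case False
          then have q: "q = (\<not> p)" by blast
          have "cls ?w g (insert a A) x = cls \<omega> g (insert a A) x" if "x \<in> S" for x
            by (rule clA) (use that a(2) S bS in auto)
          then have "{x\<in>insert b S. cls ?w g (insert a A) x = z} =
              (if z = upd_old c d t then insert b {x\<in>S. cls \<omega> g (insert a A) x = z}
               else {x\<in>S. cls \<omega> g (insert a A) x = z})"
            unfolding uo by auto
          then have "card {x\<in>insert b S. cls ?w g (insert a A) x = z} =
              card {x\<in>S. cls \<omega> g (insert a A) x = z} + (if z = upd_old c d t then 1 else 0)"
            by (simp only:) (rule card_insert_if', use bS finS in auto)
          then show ?thesis using q by simp
        qed
        have X: "(\<exists>p c. q = El p c) \<or> (\<exists>e. q = Ev e)" if "q \<in> {El p d} \<union> {El (\<not> p) (upd_old c d t)}" for q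
          using that by blast
        show ?thesis unfolding adding_marking_def transition.simps c_def[symmetric] un[symmetric]
          by (rule fire_marking[symmetric];
              (rule B | rule E | erule X | (insert finite_P2 inj new t \<omega>D fin, simp; fail)))
      qed
      finally show ?thesis unfolding if_P[OF True] .
    next
      \<comment> \<open>\<open>b\<close> lies in the initial segment and \<open>a\<close> outside
        it, so a completion must have \<open>R(b, a)\<close> and, by antisymmetry, not
        \<open>R(a, b)\<close>.\<close>
      case False
      have "\<not> cond_adding A a g \<omega>'" if \<omega>': "\<omega>' \<subseteq> U" "\<omega>' \<inter> ?D = ?w" for \<omega>'
      proof
        assume C: "cond_adding A a g \<omega>'"
        have m: "inst2 a b x \<in> \<omega>' \<longleftrightarrow> x \<in> t" if x: "x \<in> P2" for x
        proof -
          have "inst2 a b x \<in> ?D" using x by blast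
          then have "inst2 a b x \<in> \<omega>' \<longleftrightarrow> inst2 a b x \<in> ?w" using \<omega>'(2) by blast
          then show ?thesis using memt[OF x] by blast
        qed
        have "LO R n \<omega>'" and "\<forall>x\<in>A. \<forall>y\<in>{1..n} - A. r \<omega>' x y"
          using C unfolding cond_adding_def cond_idle_def admissible_def by blast+
        then have "lo \<omega>' {1..n}" "r \<omega>' b a" using LO_lo[OF \<omega>'(1)] a bA by blast+
        moreover then have "\<not> r \<omega>' a b" using a(1) bn ab unfolding lo_def by metis
        ultimately show False using m[OF RP(1)] m[OF RP(2)] False unfolding Re ok_def by blast
      qed
      then have "cpl ?D ?w (cond_adding A a g) = 0" by (rule completions_False)
      then show ?thesis unfolding if_not_P[OF False] .
    qed
  qed
  have "cpl D \<omega> (cond_adding A a g) = (\<Sum>t\<in>Pow P2. wt w w' P2 t * cpl ?D (\<omega> \<union> inst2 a b ` t) (cond_adding A a g))"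
    by (rule completions_decide) (use finite_U DU \<omega>D inj new in auto)
  also have "\<dots> = (\<Sum>t\<in>{t\<in>Pow P2. ok t}. wt w w' P2 t * cpl ?D (\<omega> \<union> inst2 a b ` t) (cond_adding A a g))"
    by (rule sum.mono_neutral_right) (use finite_P2 claim in auto)
  also have "\<dots> = (\<Sum>t\<in>{t\<in>Pow P2. ok t}. if enabled net_places (transition (?l t)) ?m then weight ?m (?l t) * F (fire (transition (?l t)) ?m) else 0)"
  proof (rule sum.cong[OF refl])
    fix t assume t: "t \<in> {t\<in>Pow P2. ok t}"
    have "?m (El p d') = 0" if "num d' < num d" for d'
      using m_pos[of d'] min that unfolding d_def by fastforce
    then have "enabled net_places (transition (?l t)) ?m"
      using md unfolding transition.simps adding_marking_def c_def[symmetric]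
      by (intro enabled_marking[OF _ inj _ new]) (auto simp del: split_paired_Ex split_paired_All)
    moreover have "weight ?m (?l t) = wt w w' P2 t"
      unfolding transition.simps by (subst twt_decide_tr) (use finite_P2 fst_P in auto)
    ultimately show "wt w w' P2 t * cpl ?D (\<omega> \<union> inst2 a b ` t) (cond_adding A a g) =
        (if enabled net_places (transition (?l t)) ?m then weight ?m (?l t) * F (fire (transition (?l t)) ?m) else 0)"
      using claim[of t] t by (simp del: transition.simps)
  qed
  also have "\<dots> = (\<Sum>l\<in>?l ` {t\<in>Pow P2. ok t}. if enabled net_places (transition l) ?m then weight ?m l * F (fire (transition l) ?m) else 0)"
    by (subst sum.reindex) (auto simp: inj_on_def comp_def)
  also have "\<dots> = F ?m"
  proof (rule F_restrict[symmetric])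
    show "?m q < N" for q by (rule bd)
    show "?m Done = 0" by (rule mD)
    show "?l ` {t\<in>Pow P2. ok t} \<subseteq> labels" using cCL dCL by (auto simp: in_labels ok_def)
  next
    fix l assume l: "l \<in> labels" and en: "enabled net_places (transition l) ?m"
    have src: "src l = Adding p c" unfolding c_def by (rule enabled_src[OF en[unfolded adding_marking_def] l])
    have noinh: "\<not> inh (transition l) (El p d)"
      using enabled_inh[OF en in_net_places(5)[OF dCL]] md by fastforce
    show "l \<in> ?l ` {t\<in>Pow P2. ok t}"
    proof (cases l)
      case (LPair q c' d' t)
      then have l': "l = LPair p c d' t" and d': "d' \<in> classes" and t: "t \<in> {t\<in>Pow P2. ok t}"
        using l src by (auto simp: in_labels ok_def)
      have "0 < ?m (El p d')"
        using enabled_pre[OF en in_net_places(5)[OF d', of p]] unfolding l' by (auto simp: decide_tr_sel)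
      then have "num d \<le> num d'" using m_pos[of d'] min unfolding d_def by blast
      moreover have "\<not> num d < num d'" using noinh dCL unfolding l' by (auto simp: decide_tr_sel)
      ultimately have "d' = d" using inj_onD[OF num _ d' dCL] by simp
      then show ?thesis using l' t by blast
    next
      case (LFin q c')
      then show ?thesis using noinh src dCL by (auto simp: decide_tr_sel)
    qed (use src in auto)
  qed
  finally show ?thesis .
qed

text \<open>Induction on the number \<open>u\<close> of undecided atoms. Closing a round decides
  none, so at each \<open>u\<close> the idle case is proved first and then used in the adding case.
  The allowances \<open>2 * u + 1\<close> and \<open>2 * u + 2\<close> for the remaining steps
  differ by this one transition.\<close>

lemma completions_net:
  "inv_idle A D \<omega> g \<Longrightarrow> \<tau> + 2 * card (U - D) + 1 < N \<Longrightarrow> cpl D \<omega> (cond_idle A g) = F (idle_marking A D \<omega> g p \<tau>)"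
  "inv_adding A a S D \<omega> g \<Longrightarrow> \<tau> + 2 * card (U - D) + 2 < N \<Longrightarrow> cpl D \<omega> (cond_adding A a g) = F (adding_marking A a S D \<omega> g p \<tau>)"
proof -
  define P1' where "P1' u \<longleftrightarrow> (\<forall>A D \<omega> g p \<tau>. inv_idle A D \<omega> g \<longrightarrow> card (U - D) = u \<longrightarrow> \<tau> + 2 * u + 1 < N \<longrightarrow>
    cpl D \<omega> (cond_idle A g) = F (idle_marking A D \<omega> g p \<tau>))" for u
  define P2' where "P2' u \<longleftrightarrow> (\<forall>A a S D \<omega> g p \<tau>. inv_adding A a S D \<omega> g \<longrightarrow> card (U - D) = u \<longrightarrow> \<tau> + 2 * u + 2 < N \<longrightarrow>
    cpl D \<omega> (cond_adding A a g) = F (adding_marking A a S D \<omega> g p \<tau>))" for u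
  have "P1' u \<and> P2' u" for u
  proof (induction u rule: less_induct)
    case (less u)
    have ih1: "cpl D \<omega> (cond_idle A g) = F (idle_marking A D \<omega> g p \<tau>)"
      if "inv_idle A D \<omega> g" "card (U - D) < u" "\<tau> + 2 * card (U - D) + 1 < N" for A D \<omega> g p \<tau>
      using less[OF that(2)] that unfolding P1'_def by blast
    have ih2: "cpl D \<omega> (cond_adding A a g) = F (adding_marking A a S D \<omega> g p \<tau>)"
      if "inv_adding A a S D \<omega> g" "card (U - D) < u" "\<tau> + 2 * card (U - D) + 2 < N" for A a S D \<omega> g p \<tau>
      using less[OF that(2)] that unfolding P2'_def by blast
    have 1: "P1' u" unfolding P1'_def
    proof (intro allI impI)
      fix A D \<omega> g p \<tau> assume J: "inv_idle A D \<omega> g" and u: "card (U - D) = u" and \<tau>: "\<tau> + 2 * u + 1 < N"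
      show "cpl D \<omega> (cond_idle A g) = F (idle_marking A D \<omega> g p \<tau>)"
      proof (cases "A = {1..n}")
        case False
        show ?thesis
        proof (rule step_new[OF J False])
          fix a D' \<omega>' \<gamma> assume "inv_adding A a {} D' \<omega>' (g(a := \<gamma>))" "card (U - D') < card (U - D)"
          then show "cpl D' \<omega>' (cond_adding A a (g(a := \<gamma>))) = F (adding_marking A a {} D' \<omega>' (g(a := \<gamma>)) p (Suc \<tau>))"
            by (rule ih2[unfolded u[symmetric]]) (use \<tau> u \<open>card (U - D') < card (U - D)\<close> in linarith)
        qed (use \<tau> in simp)
      next
        case A: True
        show ?thesis
        proof (cases "D = U")
          case True
          show ?thesis using step_done[of \<omega> g \<tau> p] J \<tau> unfolding A True by simp
        next
          case False
          show ?thesis unfolding A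
          proof (rule step_rest[OF J[unfolded A] False])
            fix D' \<omega>' assume "inv_idle {1..n} D' \<omega>' g" "card (U - D') < card (U - D)"
            then show "cpl D' \<omega>' (cond_idle {1..n} g) = F (idle_marking {1..n} D' \<omega>' g p (Suc \<tau>))"
              by (rule ih1[unfolded u[symmetric]]) (use \<tau> u \<open>card (U - D') < card (U - D)\<close> in linarith)
          qed (use \<tau> in simp)
        qed
      qed
    qed
    moreover have "P2' u" unfolding P2'_def
    proof (intro allI impI)
      fix A a S D \<omega> g p \<tau> assume J: "inv_adding A a S D \<omega> g" and u: "card (U - D) = u" and \<tau>: "\<tau> + 2 * u + 2 < N"
      show "cpl D \<omega> (cond_adding A a g) = F (adding_marking A a S D \<omega> g p \<tau>)"
      proof (cases "S = A")
        case True
        show ?thesis unfolding True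
        proof (rule step_fin[OF J[unfolded True]])
          assume "inv_idle (insert a A) D \<omega> g"
          then show "cpl D \<omega> (cond_idle (insert a A) g) = F (idle_marking (insert a A) D \<omega> g (\<not> p) (Suc \<tau>))"
            using 1 u \<tau> unfolding P1'_def by simp
        qed (use \<tau> in simp)
      next
        case False
        show ?thesis
        proof (rule step_pair[OF J False])
          fix S' D' \<omega>' assume "inv_adding A a S' D' \<omega>' g" "card (U - D') < card (U - D)"
          then show "cpl D' \<omega>' (cond_adding A a g) = F (adding_marking A a S' D' \<omega>' g p (Suc \<tau>))"
            by (rule ih2[unfolded u[symmetric]]) (use \<tau> u \<open>card (U - D') < card (U - D)\<close> in linarith)
        qed (use \<tau> in simp)
      qed
    qed
    ultimately show ?case by blast
  qed
  then show "inv_idle A D \<omega> g \<Longrightarrow> \<tau> + 2 * card (U - D) + 1 < N \<Longrightarrow> cpl D \<omega> (cond_idle A g) = F (idle_marking A D \<omega> g p \<tau>)"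
    "inv_adding A a S D \<omega> g \<Longrightarrow> \<tau> + 2 * card (U - D) + 2 < N \<Longrightarrow> cpl D \<omega> (cond_adding A a g) = F (adding_marking A a S D \<omega> g p \<tau>)"
    unfolding P1'_def P2'_def by blast+
qed

theorem F_start:
  "F (marking Start {} {} {1..n} (\<lambda>_ _. 0) 0) =
    WFOMC V (\<lambda>\<omega>. models n \<omega> \<phi> \<and> sat_constrs \<omega> \<Gamma> \<and> LO R n \<omega>) n w w'"
proof -
  have "cpl {} {} admissible = F (marking Start {} {} {1..n} (\<lambda>_ _. 0) 0)"
  proof (rule start)
    fix D' \<omega>' g assume J: "inv_idle {} D' \<omega>' g"
    have "card (U - D') \<le> card U" by (rule card_mono) (use finite_U in auto)
    then show "cpl D' \<omega>' (cond_idle {} g) = F (idle_marking {} D' \<omega>' g False 1)"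
      using N by (intro completions_net(1)[OF J]) linarith
  qed
  moreover have "world_weight V n w w' \<omega> = wt w w' (U - {}) \<omega>" if "\<omega> \<subseteq> U" for \<omega>
  proof -
    have "wt w w' (U - {}) \<omega> = wt w w' (\<omega> \<union> (U - \<omega>)) \<omega>" using that by (simp add: Un_absorb1)
    also have "\<dots> = wt w w' \<omega> \<omega> * wt w w' (U - \<omega>) \<omega>"
      unfolding wt_def by (rule prod.union_disjoint) (use finite_U that finite_subset in auto)
    also have "wt w w' \<omega> \<omega> = (\<Prod>x\<in>\<omega>. w (fst x))" unfolding wt_def by (rule prod.cong) auto
    also have "wt w w' (U - \<omega>) \<omega> = (\<Prod>x\<in>U - \<omega>. w' (fst x))" unfolding wt_def by (rule prod.cong) auto
    finally show ?thesis by (simp add: world_weight_def)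
  qed
  then have "WFOMC V (\<lambda>\<omega>. models n \<omega> \<phi> \<and> sat_constrs \<omega> \<Gamma> \<and> LO R n \<omega>) n w w' = cpl {} {} admissible"
    unfolding WFOMC_def completions_def admissible_def models_def by (intro sum.cong) auto
  ultimately show ?thesis by simp
qed

end

section \<open>Counting ground atoms and assembling the net\<close>

lemma card_atoms: "P < length V \<Longrightarrow> card {x\<in>ground_atoms V n. fst x = P} = n ^ (V ! P)"
proof -
  assume P: "P < length V"
  have "{x\<in>ground_atoms V n. fst x = P} = Pair P ` {as. set as \<subseteq> {1..n} \<and> length as = V ! P}"
    using P by (auto simp: ground_atoms_def)
  then show ?thesis using card_lists_length_eq[of "{1..n}" "V ! P"] by (simp add: card_image inj_on_def)
qed

text \<open>With \<open>n + 2\<close> as base, powers increase with the exponent for every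
  \<open>n\<close>, so all arities can be replaced by their sum.\<close>

lemma card_ground_atoms_le: "card (ground_atoms V n) \<le> length V * (n + 2) ^ sum_list V"
proof -
  have "card (ground_atoms V n) = (\<Sum>P<length V. card {x\<in>ground_atoms V n. fst x = P})"
    unfolding card_eq_sum
    by (rule sum.group[OF finite_ground_atoms finite_lessThan, symmetric]) (auto simp: ground_atoms_def)
  also have "\<dots> \<le> (\<Sum>P<length V. (n + 2) ^ sum_list V)"
  proof (rule sum_mono)
    fix P assume P: "P \<in> {..<length V}"
    then have "V ! P \<le> sum_list V" by (intro member_le_sum_list) auto
    then have "(n + 2) ^ (V ! P) \<le> (n + 2) ^ sum_list V" by (intro power_increasing) auto
    moreover have "n ^ (V ! P) \<le> (n + 2) ^ (V ! P)" by (intro power_mono) auto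
    ultimately have "n ^ (V ! P) \<le> (n + 2) ^ sum_list V" by linarith
    then show "card {x\<in>ground_atoms V n. fst x = P} \<le> (n + 2) ^ sum_list V"
      using P by (simp add: card_atoms)
  qed
  finally show ?thesis by simp
qed

lemma wl_decide_tr:
  assumes "finite Q" "\<And>x. x \<in> Q \<Longrightarrow> fst x < nv"
  shows "set (wl (decide_tr nv c c' x x' h Q \<xi> fc)) \<subseteq> {..<2 * nv}"
proof -
  have "set (SOME xs. distinct xs \<and> set xs = Q) = Q"
    using someI_ex[of "\<lambda>xs. distinct xs \<and> set xs = Q"] finite_distinct_list[OF assms(1)] by blast
  then show ?thesis using assms(2) by (fastforce simp: decide_tr_def)
qed

context sentence begin

lemma tr_wl: "l \<in> labels \<Longrightarrow> set (wl (transition l)) \<subseteq> {..<2 * length V}"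
  by (cases l; simp only: transition.simps; rule wl_decide_tr)
    (use finite_P0 finite_P1 finite_P2 fst_P in \<open>auto simp: in_labels\<close>)

lemma tr_time: "pre (transition l) Time = 0" "0 < post (transition l) Time"
  by (cases l; auto simp: decide_tr_sel)+

lemma tr_fac: "l \<in> labels \<Longrightarrow> set (fac (transition l)) \<subseteq> net_places"
  by (cases l) (auto simp: decide_tr_sel in_labels net_places_def)

theorem liftable: "domain_liftable V \<phi> (LO R)"
  unfolding domain_liftable_def
proof (intro allI)
  fix w w' :: "nat \<Rightarrow> real"
  obtain ps0 where ps0: "set ps0 = net_places - {Time}" "distinct ps0"
    using finite_distinct_list[of "net_places - {Time}"] finite_net_places by auto
  \<comment> \<open>\<open>Time\<close> is placed last in order to become the most significant digit
    of the code.\<close>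
  define ps where "ps = ps0 @ [Time]"
  have ps: "set ps = net_places" "distinct ps" using ps0 by (auto simp: ps_def net_places_def)
  define D where "D = length ps"
  have plD: "ps ! (D - 1) = Time" "0 < D" by (simp_all add: D_def ps_def)
  define ix where "ix q = (SOME i. i < D \<and> ps ! i = q)" for q
  have ix: "ix q < D" "ps ! ix q = q" if "q \<in> net_places" for q
  proof -
    have "\<exists>i. i < D \<and> ps ! i = q" using that ps(1) by (metis D_def in_set_conv_nth)
    then have "ix q < D \<and> ps ! ix q = q" unfolding ix_def by (rule someI_ex)
    then show "ix q < D" "ps ! ix q = q" by auto
  qed
  have ix_eq: "ix q = d \<longleftrightarrow> ps ! d = q" if "q \<in> net_places" "d < D" for q d
    using ix[OF that(1)] that(2) ps(2) by (metis D_def nth_eq_iff_index_eq)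
  have plPL: "ps ! d \<in> net_places" if "d < D" for d using that ps(1) by (metis D_def nth_mem)
  obtain ll where ll: "set ll = labels" "distinct ll" using finite_distinct_list[OF finite_labels] by auto
  obtain el where el: "set el = Pow {..<2 * length V}" "distinct el"
    using finite_distinct_list[of "Pow {..<2 * length V}"] by auto
  define conv where "conv t = PTrans (\<lambda>d. if d < D then pre t (ps ! d) else 0) (\<lambda>d. inh t (ps ! d))
    (\<lambda>d. if d < D then post t (ps ! d) else 0) (wl t) (map ix (fac t))" for t :: "place ptrans"
  define ts where "ts = map (\<lambda>l. conv (transition l)) ll"
  \<comment> \<open>Initially there is one token on \<open>Start\<close>, and \<open>Free P\<close>
    holds \<open>n ^ (V ! P)\<close> tokens, the number of ground atoms of \<open>P\<close>.\<close>
  define u0 where "u0 d = (if d < D \<and> (ps ! d = Start \<or> (\<exists>P. ps ! d = Free P)) then 1 else 0 :: nat)" for d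
  define k0 where "k0 d = (case ps ! d of Free P \<Rightarrow> V ! P | _ \<Rightarrow> 0)" for d
  \<comment> \<open>Chosen so that the base exceeds twice the number of ground atoms plus 5; the
    \<open>Suc\<close> in \<open>K\<close> makes it exceed \<open>n\<close> as well.\<close>
  define C where "C = 2 * length V + 8"
  define K where "K = Suc (sum_list V)"
  define cs where "cs = map w [0..<length V] @ map w' [0..<length V]"
  \<comment> \<open>Renames places to digit positions; positions beyond \<open>D\<close> get the
    default 0, so that renaming commutes with \<open>fire\<close>.\<close>
  define M where "M m d = (if d < D then m (ps ! d) else 0)" for m :: "place \<Rightarrow> nat" and d
  have DonePL: "Done \<in> net_places" by (simp add: net_places_def)
  have CrdPL: "P < length V \<Longrightarrow> Crd P \<in> net_places" for P by (simp add: net_places_def)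
  have EvPL: "e \<subseteq> {..<2 * length V} \<Longrightarrow> Ev e \<in> net_places" for e by (simp add: net_places_def lit_sets_def)
  interpret pn: net D ts "ix Done" "\<lambda>P. ix (Crd P)" "length V" el "\<lambda>e. ix (Ev e)" u0 k0 C K
  proof
    show "pre t (D - 1) = 0 \<and> 0 < post t (D - 1) \<and> set (fac t) \<subseteq> {..<D}" if t: "t \<in> set ts" for t
    proof -
      obtain l where l: "l \<in> labels" "t = conv (transition l)" using t ll(1) by (auto simp: ts_def)
      have "ix ` set (fac (transition l)) \<subseteq> {..<D}" using tr_fac[OF l(1)] ix(1) by blast
      then show ?thesis unfolding l(2) conv_def using plD tr_time by simp
    qed
  qed (use el ix(1) DonePL CrdPL EvPL in \<open>auto simp: C_def\<close>)
  have base: "2 * card (ground_atoms V n) + 5 < pn.base n" "n < pn.base n" for n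
  proof -
    have 1: "(n + 2) ^ sum_list V \<le> (n + 2) ^ K" unfolding K_def by (rule power_increasing) auto
    have "length V * (n + 2) ^ sum_list V \<le> length V * (n + 2) ^ K" using 1 by (rule mult_left_mono) simp
    then have "card (ground_atoms V n) \<le> length V * (n + 2) ^ K"
      using card_ground_atoms_le[of V n] by linarith
    moreover have "1 \<le> (n + 2) ^ K" by simp
    ultimately show "2 * card (ground_atoms V n) + 5 < pn.base n"
      unfolding pn.base_def unfolding C_def distrib_right by linarith
    have "(n + 2) ^ 1 \<le> (n + 2) ^ K" unfolding K_def by (rule power_increasing) auto
    also have "\<dots> \<le> C * (n + 2) ^ K" by (simp add: C_def)
    finally show "n < pn.base n" unfolding pn.base_def by simp
  qed
  have initial: "pn.initial n \<Gamma> d = (if d < D then (case ps ! d of Start \<Rightarrow> 1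
      | Free P \<Rightarrow> card {x\<in>ground_atoms V n. fst x = P} | Ev e \<Rightarrow> card {a\<in>{1..n}. evt \<Gamma> a = e} | _ \<Rightarrow> 0) else 0)"
    if wf: "\<forall>\<kappa>\<in>set \<Gamma>. wf_constr V n \<kappa>" for n \<Gamma> d
  proof (cases "d < D")
    case True
    have "Ev (evt \<Gamma> a) \<in> net_places" for a by (rule EvPL, rule evt_subset) (use wf in blast)
    then have ev: "ix (Ev (evt \<Gamma> a)) = d \<longleftrightarrow> ps ! d = Ev (evt \<Gamma> a)" for a using ix_eq True by blast
    show ?thesis
    proof (cases "ps ! d")
      case (Free P)
      then have "P < length V" using plPL[OF True] by (auto simp: net_places_def)
      then show ?thesis using True Free by (simp add: pn.initial_def ev u0_def k0_def card_atoms)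
    next
      case (Ev e)
      have "ix (Ev (evt \<Gamma> a)) = d \<longleftrightarrow> evt \<Gamma> a = e" for a using ev[of a] Ev by auto
      then show ?thesis using True Ev by (simp add: pn.initial_def u0_def)
    qed (use True in \<open>simp_all add: pn.initial_def ev u0_def k0_def\<close>)
  next
    case False
    have "Ev (evt \<Gamma> a) \<in> net_places" for a by (rule EvPL, rule evt_subset) (use wf in blast)
    then have "ix (Ev (evt \<Gamma> a)) \<noteq> d" for a using ix(1) False by blast
    then show ?thesis using False by (simp add: pn.initial_def u0_def)
  qed
  have bounded: "pn.initial n \<Gamma> d < pn.base n" if "(n, \<Gamma>) \<in> wf_instances V" for n \<Gamma> d
  proof -
    have 1: "card {x\<in>ground_atoms V n. fst x = P} < pn.base n" for P
    proof -
      have "card {x\<in>ground_atoms V n. fst x = P} \<le> card (ground_atoms V n)"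
        by (rule card_mono[OF finite_ground_atoms]) auto
      then show ?thesis using base(1)[of n] by linarith
    qed
    have 2: "card {a\<in>{1..n}. evt \<Gamma> a = e} < pn.base n" for e
    proof -
      have "card {a\<in>{1..n}. evt \<Gamma> a = e} \<le> card {1..n}" by (rule card_mono) auto
      then show ?thesis using base(2)[of n] unfolding card_atLeastAtMost by linarith
    qed
    have "\<forall>\<kappa>\<in>set \<Gamma>. wf_constr V n \<kappa>" using that by (simp add: wf_instances_def)
    then show ?thesis using base(1)[of n] 1 2 by (auto simp: initial split: place.splits)
  qed
  have wl: "set (wl t) \<subseteq> {..<length cs}" if t: "t \<in> set ts" for t
  proof -
    obtain l where l: "l \<in> labels" "t = conv (transition l)" using t ll(1) by (auto simp: ts_def)
    have "wl t = wl (transition l)" "length cs = 2 * length V" by (simp_all add: l(2) conv_def cs_def)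
    then show ?thesis using tr_wl[OF l(1)] by (simp only:)
  qed
  obtain c p where cp: "\<And>n \<Gamma>. (n, \<Gamma>) \<in> wf_instances V \<Longrightarrow>
    \<exists>t s F. exec cs c (init (enc_instance (n, \<Gamma>))) t s \<and> t \<le> poly p (instance_size (n, \<Gamma>)) \<and>
     result_of s = F (pn.initial n \<Gamma>) \<and>
     (\<forall>m. (\<forall>d<D. m d < pn.base n) \<longrightarrow> F m =
        (if 0 < m (ix Done) then (if \<forall>\<kappa>\<in>set \<Gamma>. card_sat (\<lambda>P. m (ix (Crd P))) \<kappa> then 1 else 0)
         else (\<Sum>t\<leftarrow>ts. if enabled {..<D} t m then twt cs t m * F (fire t m) else 0)))"
    using pn.net_polytime[OF refl wl bounded] by blast
  show "polytime_computable (map w [0..<length V] @ map w' [0..<length V]) (wf_instances V)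
    enc_instance instance_size (\<lambda>(n, \<Gamma>). WFOMC V (\<lambda>\<omega>. models n \<omega> \<phi> \<and> sat_constrs \<omega> \<Gamma> \<and> LO R n \<omega>) n w w')"
    unfolding polytime_computable_def
  proof (intro exI[of _ c] exI[of _ p] ballI)
    fix x assume "x \<in> wf_instances V"
    then obtain n \<Gamma> where x: "x = (n, \<Gamma>)" "(n, \<Gamma>) \<in> wf_instances V" by (cases x) auto
    then have n: "1 \<le> n" and wfG: "\<forall>\<kappa>\<in>set \<Gamma>. wf_constr V n \<kappa>" by (auto simp: wf_instances_def)
    obtain t s F where ex: "exec cs c (init (enc_instance (n, \<Gamma>))) t s"
      "t \<le> poly p (instance_size (n, \<Gamma>))" "result_of s = F (pn.initial n \<Gamma>)"
      and rec: "\<And>m. (\<forall>d<D. m d < pn.base n) \<Longrightarrow> F m =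
        (if 0 < m (ix Done) then (if \<forall>\<kappa>\<in>set \<Gamma>. card_sat (\<lambda>P. m (ix (Crd P))) \<kappa> then 1 else 0)
         else (\<Sum>t\<leftarrow>ts. if enabled {..<D} t m then twt cs t m * F (fire t m) else 0))"
      using cp[OF x(2)] by blast
    have Mix: "M m (ix q) = m q" if "q \<in> net_places" for m q using ix[OF that] by (simp add: M_def)
    interpret counting V R \<phi> n \<Gamma> w w' "pn.base n" "\<lambda>m. F (M m)"
    proof
      fix m assume m: "\<And>q. q \<in> net_places \<Longrightarrow> m q < pn.base n"
      have "\<forall>d<D. M m d < pn.base n" using m plPL by (simp add: M_def)
      then have "F (M m) = (if 0 < M m (ix Done) then
          (if \<forall>\<kappa>\<in>set \<Gamma>. card_sat (\<lambda>P. M m (ix (Crd P))) \<kappa> then 1 else 0)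
          else (\<Sum>t\<leftarrow>ts. if enabled {..<D} t (M m) then twt cs t (M m) * F (fire t (M m)) else 0))"
        by (rule rec)
      also have "M m (ix Done) = m Done" by (rule Mix[OF DonePL])
      also have "(\<forall>\<kappa>\<in>set \<Gamma>. card_sat (\<lambda>P. M m (ix (Crd P))) \<kappa>) \<longleftrightarrow>
          (\<forall>\<kappa>\<in>set \<Gamma>. card_sat (\<lambda>P. m (Crd P)) \<kappa>)"
      proof (rule ball_cong[OF refl])
        fix \<kappa> assume "\<kappa> \<in> set \<Gamma>"
        then have "wf_constr V n \<kappa>" using wfG by blast
        then show "card_sat (\<lambda>P. M m (ix (Crd P))) \<kappa> \<longleftrightarrow> card_sat (\<lambda>P. m (Crd P)) \<kappa>"
          using Mix CrdPL by (cases \<kappa>) auto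
      qed
      also have "(\<Sum>t\<leftarrow>ts. if enabled {..<D} t (M m) then twt cs t (M m) * F (fire t (M m)) else 0) =
          (\<Sum>l\<leftarrow>ll. if enabled net_places (transition l) m then twt cs (transition l) m * F (M (fire (transition l) m)) else 0)"
      proof -
        have "(if enabled {..<D} (conv (transition l)) (M m) then twt cs (conv (transition l)) (M m) * F (fire (conv (transition l)) (M m)) else 0) =
          (if enabled net_places (transition l) m then twt cs (transition l) m * F (M (fire (transition l) m)) else 0)" if l: "l \<in> labels" for l
        proof -
          have "enabled {..<D} (conv (transition l)) (M m) \<longleftrightarrow> (\<forall>d<D. pre (transition l) (ps ! d) \<le> m (ps ! d) \<and>
              (inh (transition l) (ps ! d) \<longrightarrow> m (ps ! d) = 0))"
            by (auto simp: enabled_def conv_def M_def)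
          also have "\<dots> \<longleftrightarrow> enabled net_places (transition l) m"
            unfolding enabled_def using plPL ix by metis
          finally have "enabled {..<D} (conv (transition l)) (M m) \<longleftrightarrow> enabled net_places (transition l) m" .
          moreover have "map (\<lambda>q. real (M m q)) (map ix (fac (transition l))) = map (\<lambda>q. real (m q)) (fac (transition l))"
            using tr_fac[OF l] Mix by auto
          then have "twt cs (conv (transition l)) (M m) = twt cs (transition l) m"
            unfolding twt_def conv_def ptrans.sel by (simp only:)
          moreover have "fire (conv (transition l)) (M m) = M (fire (transition l) m)"
            by (auto simp: fun_eq_iff fire_def conv_def M_def)
          ultimately show ?thesis by simp
        qed
        then show ?thesis unfolding ts_def map_map comp_def using ll(1) by (intro arg_cong[of _ _ sum_list] map_cong) auto
      qed
      also have "\<dots> = (\<Sum>l\<in>labels. if enabled net_places (transition l) m then twt cs (transition l) m * F (M (fire (transition l) m)) else 0)"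
        using ll by (simp add: sum_list_distinct_conv_sum_set)
      finally show "F (M m) = (if 0 < m Done then (if \<forall>\<kappa>\<in>set \<Gamma>. card_sat (\<lambda>P. m (Crd P)) \<kappa> then 1 else 0)
        else (\<Sum>l\<in>labels. if enabled net_places (transition l) m
          then twt (map w [0..<length V] @ map w' [0..<length V]) (transition l) m * F (M (fire (transition l) m)) else 0))"
        unfolding cs_def .
    qed (use n wfG base in auto)
    have "pn.initial n \<Gamma> = M (marking Start {} {} {1..n} (\<lambda>_ _. 0) 0)"
    proof
      fix d
      show "pn.initial n \<Gamma> d = M (marking Start {} {} {1..n} (\<lambda>_ _. 0) 0) d"
        unfolding initial[OF wfG] M_def marking_def by (cases "ps ! d") auto
    qed
    then have "result_of s = WFOMC V (\<lambda>\<omega>. models n \<omega> \<phi> \<and> sat_constrs \<omega> \<Gamma> \<and> LO R n \<omega>) n w w'"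
      using ex(3) F_start by simp
    then show "\<exists>t s. exec (map w [0..<length V] @ map w' [0..<length V]) c (init (enc_instance x)) t s \<and>
        result_of s = (case x of (n, \<Gamma>) \<Rightarrow> WFOMC V (\<lambda>\<omega>. models n \<omega> \<phi> \<and> sat_constrs \<omega> \<Gamma> \<and> LO R n \<omega>) n w w') \<and>
        t \<le> poly p (instance_size x)"
      using ex(1,2) unfolding x(1) cs_def prod.case by blast
  qed
qed

end

theorem theorem4p11:
  fixes V :: vocabulary and \<Phi> :: fm and R :: nat
  assumes "C2_sentence V \<Phi>"
    and "R < length V" and "V ! R = 2"
  shows "domain_liftable V \<Phi> (LO R)"
proof -
  \<comment> \<open>The normal form has the same models, so proving the result for it is
    enough.\<close>
  interpret sentence V R "nf \<Phi>"
    using assms by unfold_locales (auto simp: C2_sentence_def wf_nf is_nf_nf fv_nf)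
  show ?thesis using liftable unfolding domain_liftable_def models_def sat_nf .
qed

end
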